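(* Let $p$ be a prime and let $$1\to N\overset{\iota}{\to}G\overset{\pi}{\to}\bar G\to 1$$ be a special extension of pro-$p$ groups which splits, i.e., there is a continuous homomorphism $\theta\colon\bar G\to G$ with $\pi\circ\theta=\mathrm{id}_{\bar G}$. Then there exists a closed free pro-$p$ subgroup $F\subseteq N$ such that $G$ is isomorphic to $F\coprod\bar G$.
   Context: $\coprod$ denotes the free product (coproduct) in the category of pro-$p$ groups. For a pro-$p$ group $H$, $\Phi(H)=\mathrm{cl}(H^p[H,H])$ is the Frattini subgroup, $H^{\mathrm{ab},\mathrm{el}}=H/\Phi(H)$, and $\mathbb{F}_p[\![H]\!]=\varprojlim_W\mathbb{F}_p[H/W]$ is the completed group algebra. An extension of pro-$p$ groups $1\to N\overset{\iota}{\to}G\overset{\pi}{\to}\bar G\to 1$ is called special if: (i) $N$ is a free pro-$p$ group; (ii) $N^{\mathrm{ab},\mathrm{el}}$, with the $\bar G$-action induced by conjugation in $G$, is a projective profinite left $\mathbb{F}_p[\![\bar G]\!]$-module; (iii) the induced extension of pro-$p$ groups $1\to N^{\mathrm{ab},\mathrm{el}}\to G/\iota(\Phi(N))\to\bar G\to 1$ splits. *)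

theory Defs
  imports
    "HOL-Analysis.Analysis"
    "HOL-Algebra.Generated_Groups"
    "HOL-Algebra.Module"
    "HOL-Number_Theory.Residues"
begin

section \<open>Pro-p groups\<close>

text \<open>A topological group is a pair of a group and an abstract topology on its carrier, so that
  closed subgroups and quotients are again such pairs.\<close>

definition topological_group :: "('a, 'm) monoid_scheme \<Rightarrow> 'a topology \<Rightarrow> bool" where
  "topological_group G T \<longleftrightarrow>
     group G \<and> topspace T = carrier G \<and>
     continuous_map (prod_topology T T) T (\<lambda>(x, y). x \<otimes>\<^bsub>G\<^esub> y) \<and>
     continuous_map T T (\<lambda>x. inv\<^bsub>G\<^esub> x)"

definition totally_disconnected_space :: "'a topology \<Rightarrow> bool" where
  "totally_disconnected_space T \<longleftrightarrow> (\<forall>S. connectedin T S \<longrightarrow> (\<exists>x. S \<subseteq> {x}))"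

definition profinite_group :: "('a, 'm) monoid_scheme \<Rightarrow> 'a topology \<Rightarrow> bool" where
  "profinite_group G T \<longleftrightarrow>
     topological_group G T \<and> compact_space T \<and> Hausdorff_space T \<and> totally_disconnected_space T"

definition open_normal_subgroups :: "('a, 'm) monoid_scheme \<Rightarrow> 'a topology \<Rightarrow> 'a set set" where
  "open_normal_subgroups G T = {W. W \<lhd> G \<and> openin T W}"

definition pro_p_group :: "nat \<Rightarrow> ('a, 'm) monoid_scheme \<Rightarrow> 'a topology \<Rightarrow> bool" where
  "pro_p_group p G T \<longleftrightarrow>
     profinite_group G T \<and> (\<forall>W \<in> open_normal_subgroups G T. \<exists>k. order (G Mod W) = p ^ k)"

definition continuous_hom ::
  "('a, 'm) monoid_scheme \<Rightarrow> 'a topology \<Rightarrow> ('b, 'n) monoid_scheme \<Rightarrow> 'b topology \<Rightarrow> ('a \<Rightarrow> 'b) \<Rightarrow> bool"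
where
  "continuous_hom G TG H TH h \<longleftrightarrow> h \<in> hom G H \<and> continuous_map TG TH h"

text \<open>The topology on the set of cosets of \<open>K\<close> for which the projection from \<open>G\<close> is a quotient map.\<close>

definition quotient_topology :: "('a, 'm) monoid_scheme \<Rightarrow> 'a topology \<Rightarrow> 'a set \<Rightarrow> 'a set topology" where
  "quotient_topology G T K =
     topology (\<lambda>U. U \<subseteq> rcosets\<^bsub>G\<^esub> K \<and> openin T {x \<in> topspace T. K #>\<^bsub>G\<^esub> x \<in> U})"

lemma openin_quotient_topology:
  "openin (quotient_topology G T K) U \<longleftrightarrow>
     U \<subseteq> rcosets\<^bsub>G\<^esub> K \<and> openin T {x \<in> topspace T. K #>\<^bsub>G\<^esub> x \<in> U}"
proof -
  have "istopology (\<lambda>U. U \<subseteq> rcosets\<^bsub>G\<^esub> K \<and> openin T {x \<in> topspace T. K #>\<^bsub>G\<^esub> x \<in> U})"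
    unfolding istopology_def
  proof (intro conjI allI impI)
    fix S S' :: "'a set set"
    assume a: "S \<subseteq> rcosets\<^bsub>G\<^esub> K \<and> openin T {x \<in> topspace T. K #>\<^bsub>G\<^esub> x \<in> S}"
      "S' \<subseteq> rcosets\<^bsub>G\<^esub> K \<and> openin T {x \<in> topspace T. K #>\<^bsub>G\<^esub> x \<in> S'}"
    then show "S \<inter> S' \<subseteq> rcosets\<^bsub>G\<^esub> K" by blast
    have "{x \<in> topspace T. K #>\<^bsub>G\<^esub> x \<in> S \<inter> S'} =
      {x \<in> topspace T. K #>\<^bsub>G\<^esub> x \<in> S} \<inter> {x \<in> topspace T. K #>\<^bsub>G\<^esub> x \<in> S'}" by blast
    with a show "openin T {x \<in> topspace T. K #>\<^bsub>G\<^esub> x \<in> S \<inter> S'}" by auto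
  next
    fix \<K> :: "'a set set set"
    assume a: "\<forall>U\<in>\<K>. U \<subseteq> rcosets\<^bsub>G\<^esub> K \<and> openin T {x \<in> topspace T. K #>\<^bsub>G\<^esub> x \<in> U}"
    then show "\<Union>\<K> \<subseteq> rcosets\<^bsub>G\<^esub> K" by blast
    have "{x \<in> topspace T. K #>\<^bsub>G\<^esub> x \<in> \<Union>\<K>} = (\<Union>U\<in>\<K>. {x \<in> topspace T. K #>\<^bsub>G\<^esub> x \<in> U})"
      by blast
    with a show "openin T {x \<in> topspace T. K #>\<^bsub>G\<^esub> x \<in> \<Union>\<K>}" by auto
  qed
  then show ?thesis by (simp add: quotient_topology_def)
qed

text \<open>The closure of \<open>H\<^sup>p[H, H]\<close>, and the quotient of \<open>H\<close> by it.\<close>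

definition frattini :: "nat \<Rightarrow> 'a monoid \<Rightarrow> 'a topology \<Rightarrow> 'a set" where
  "frattini p H T =
     T closure_of (generate H {x [^]\<^bsub>H\<^esub> p | x. x \<in> carrier H} <#>\<^bsub>H\<^esub> derived H (carrier H))"

definition ab_el :: "nat \<Rightarrow> 'a monoid \<Rightarrow> 'a topology \<Rightarrow> 'a set monoid" where
  "ab_el p H T = H Mod frattini p H T"

definition ab_el_topology :: "nat \<Rightarrow> 'a monoid \<Rightarrow> 'a topology \<Rightarrow> 'a set topology" where
  "ab_el_topology p H T = quotient_topology H T (frattini p H T)"


section \<open>Free pro-p groups and free pro-p products\<close>

text \<open>Universal properties quantify over all objects of a category, which in HOL requires a type
  hosting the test objects. A Hausdorff space with a dense subset of cardinality \<open>\<kappa>\<close> has at most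
  \<open>2^(2^\<kappa>)\<close> points, so a pro-p group topologically generated by (the image of) \<open>'a\<close>, or a profinite
  module topologically generated by \<open>'a\<close> over a ring on \<open>'a\<close>, has an isomorphic copy on \<open>'a test\<close>.
  In each universal property below (and in the lifting property defining projectivity) an arbitrary
  test object may be replaced by such a closed subobject, generated by the images of the given data.
  Hence testing on \<open>'a test\<close> is the same as testing on all types.\<close>

type_synonym 'a test = "(nat + 'a) set set"

text \<open>A family \<open>f\<close> indexed by \<open>S\<close> converges to 1 if every open subgroup contains all but finitely
  many of its members.\<close>

definition converges_to_one ::
  "('a, 'm) monoid_scheme \<Rightarrow> 'a topology \<Rightarrow> 'i set \<Rightarrow> ('i \<Rightarrow> 'a) \<Rightarrow> bool"
where
  "converges_to_one G T S f \<longleftrightarrow>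
     f \<in> S \<rightarrow> carrier G \<and> (\<forall>U. subgroup U G \<and> openin T U \<longrightarrow> finite {x \<in> S. f x \<notin> U})"

definition free_pro_p_on :: "nat \<Rightarrow> 'a monoid \<Rightarrow> 'a topology \<Rightarrow> 'a set \<Rightarrow> bool" where
  "free_pro_p_on p F T S \<longleftrightarrow>
     pro_p_group p F T \<and> converges_to_one F T S (\<lambda>x. x) \<and>
     (\<forall>(H :: 'a test monoid) TH \<phi>.
        pro_p_group p H TH \<and> converges_to_one H TH S \<phi> \<longrightarrow>
        (\<exists>!h. h \<in> extensional (carrier F) \<and> continuous_hom F T H TH h \<and> (\<forall>x\<in>S. h x = \<phi> x)))"

text \<open>The map from the generating set to a free pro-p group is automatically injective, so a basis
  may be taken to be a subset.\<close>

definition free_pro_p :: "nat \<Rightarrow> 'a monoid \<Rightarrow> 'a topology \<Rightarrow> bool" where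
  "free_pro_p p F T \<longleftrightarrow> (\<exists>S. free_pro_p_on p F T S)"

text \<open>\<open>P\<close> together with \<open>i : A \<rightarrow> P\<close> and \<open>j : B \<rightarrow> P\<close> is a coproduct of \<open>A\<close> and \<open>B\<close> in the category of
  pro-p groups. As coproducts are determined up to isomorphism, a group is isomorphic to the free
  pro-p product of \<open>A\<close> and \<open>B\<close> iff it carries such \<open>i\<close> and \<open>j\<close>.\<close>

definition pro_p_coproduct ::
  "nat \<Rightarrow> 'a monoid \<Rightarrow> 'a topology \<Rightarrow> 'b monoid \<Rightarrow> 'b topology \<Rightarrow>
   'c monoid \<Rightarrow> 'c topology \<Rightarrow> ('a \<Rightarrow> 'c) \<Rightarrow> ('b \<Rightarrow> 'c) \<Rightarrow> bool"
where
  "pro_p_coproduct p A TA B TB P TP i j \<longleftrightarrow>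
     pro_p_group p A TA \<and> pro_p_group p B TB \<and> pro_p_group p P TP \<and>
     continuous_hom A TA P TP i \<and> continuous_hom B TB P TP j \<and>
     (\<forall>(H :: ('a + 'b + 'c) test monoid) TH \<alpha> \<beta>.
        pro_p_group p H TH \<and> continuous_hom A TA H TH \<alpha> \<and> continuous_hom B TB H TH \<beta> \<longrightarrow>
        (\<exists>!h. h \<in> extensional (carrier P) \<and> continuous_hom P TP H TH h \<and>
              (\<forall>x\<in>carrier A. h (i x) = \<alpha> x) \<and> (\<forall>y\<in>carrier B. h (j y) = \<beta> y)))"


section \<open>The completed group algebra\<close>

text \<open>The group algebra of a finite group \<open>Q\<close> over \<open>R\<close>, as functions \<open>Q \<rightarrow> R\<close> under convolution.\<close>

definition group_algebra :: "'r ring \<Rightarrow> 'q monoid \<Rightarrow> ('q \<Rightarrow> 'r) ring" where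
  "group_algebra R Q =
     \<lparr>carrier = carrier Q \<rightarrow>\<^sub>E carrier R,
      monoid.mult = (\<lambda>f g. \<lambda>x\<in>carrier Q. \<Oplus>\<^bsub>R\<^esub>y\<in>carrier Q. f y \<otimes>\<^bsub>R\<^esub> g (inv\<^bsub>Q\<^esub> y \<otimes>\<^bsub>Q\<^esub> x)),
      one = (\<lambda>x\<in>carrier Q. if x = \<one>\<^bsub>Q\<^esub> then \<one>\<^bsub>R\<^esub> else \<zero>\<^bsub>R\<^esub>),
      zero = (\<lambda>x\<in>carrier Q. \<zero>\<^bsub>R\<^esub>),
      add = (\<lambda>f g. \<lambda>x\<in>carrier Q. f x \<oplus>\<^bsub>R\<^esub> g x)\<rparr>"

text \<open>\<open>\<F>\<^sub>p[Q/W]\<close>, and for \<open>V \<subseteq> W\<close> the map \<open>\<F>\<^sub>p[Q/V] \<rightarrow> \<F>\<^sub>p[Q/W]\<close> induced by \<open>Q/V \<rightarrow> Q/W\<close>: the coefficient of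
  a coset \<open>C\<close> of \<open>W\<close> is the sum of the coefficients of the cosets of \<open>V\<close> contained in it.\<close>

abbreviation Fp_quotient_algebra :: "nat \<Rightarrow> 'q monoid \<Rightarrow> 'q set \<Rightarrow> ('q set \<Rightarrow> int) ring" where
  "Fp_quotient_algebra p Q W \<equiv> group_algebra (residue_ring (int p)) (Q Mod W)"

definition quotient_algebra_map ::
  "nat \<Rightarrow> 'q monoid \<Rightarrow> 'q set \<Rightarrow> 'q set \<Rightarrow> ('q set \<Rightarrow> int) \<Rightarrow> ('q set \<Rightarrow> int)"
where
  "quotient_algebra_map p Q V W f =
     (\<lambda>C\<in>carrier (Q Mod W). \<Oplus>\<^bsub>residue_ring (int p)\<^esub>D\<in>{D \<in> carrier (Q Mod V). D \<subseteq> C}. f D)"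

text \<open>The inverse limit of the \<open>\<F>\<^sub>p[Q/W]\<close> over the open normal subgroups \<open>W\<close> of \<open>Q\<close>, with the
  topology inherited from the product of the finite discrete rings \<open>\<F>\<^sub>p[Q/W]\<close>.\<close>

definition completed_group_algebra ::
  "nat \<Rightarrow> 'q monoid \<Rightarrow> 'q topology \<Rightarrow> ('q set \<Rightarrow> 'q set \<Rightarrow> int) ring"
where
  "completed_group_algebra p Q T =
     (let I = open_normal_subgroups Q T; A = Fp_quotient_algebra p Q in
     \<lparr>carrier = {r \<in> (\<Pi>\<^sub>E W\<in>I. carrier (A W)).
                  \<forall>V\<in>I. \<forall>W\<in>I. V \<subseteq> W \<longrightarrow> quotient_algebra_map p Q V W (r V) = r W},
      monoid.mult = (\<lambda>r s. \<lambda>W\<in>I. r W \<otimes>\<^bsub>A W\<^esub> s W),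
      one = (\<lambda>W\<in>I. \<one>\<^bsub>A W\<^esub>),
      zero = (\<lambda>W\<in>I. \<zero>\<^bsub>A W\<^esub>),
      add = (\<lambda>r s. \<lambda>W\<in>I. r W \<oplus>\<^bsub>A W\<^esub> s W)\<rparr>)"

definition completed_group_algebra_topology ::
  "nat \<Rightarrow> 'q monoid \<Rightarrow> 'q topology \<Rightarrow> ('q set \<Rightarrow> 'q set \<Rightarrow> int) topology"
where
  "completed_group_algebra_topology p Q T =
     subtopology
       (product_topology (\<lambda>W. discrete_topology (carrier (Fp_quotient_algebra p Q W)))
          (open_normal_subgroups Q T))
       (carrier (completed_group_algebra p Q T))"

text \<open>The canonical map from \<open>Q\<close> to the units of its completed group algebra.\<close>

definition group_like :: "'q monoid \<Rightarrow> 'q topology \<Rightarrow> 'q \<Rightarrow> ('q set \<Rightarrow> 'q set \<Rightarrow> int)" where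
  "group_like Q T q =
     (\<lambda>W\<in>open_normal_subgroups Q T. \<lambda>C\<in>carrier (Q Mod W). if C = W #>\<^bsub>Q\<^esub> q then 1 else 0)"


section \<open>Profinite modules\<close>

text \<open>The library locale \<open>module\<close> requires a commutative ring of scalars.\<close>

locale left_module = R?: ring R + M?: abelian_group M 
  for R :: "('a, 'm) ring_scheme" (structure) and M :: "('a, 'b, 'n) module_scheme" (structure) +
  assumes smult_closed:
      "\<lbrakk>a \<in> carrier R; x \<in> carrier M\<rbrakk> \<Longrightarrow> a \<odot>\<^bsub>M\<^esub> x \<in> carrier M"
    and smult_l_distr:
      "\<lbrakk>a \<in> carrier R; b \<in> carrier R; x \<in> carrier M\<rbrakk> \<Longrightarrow>
       (a \<oplus> b) \<odot>\<^bsub>M\<^esub> x = a \<odot>\<^bsub>M\<^esub> x \<oplus>\<^bsub>M\<^esub> b \<odot>\<^bsub>M\<^esub> x"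
    and smult_r_distr:
      "\<lbrakk>a \<in> carrier R; x \<in> carrier M; y \<in> carrier M\<rbrakk> \<Longrightarrow>
       a \<odot>\<^bsub>M\<^esub> (x \<oplus>\<^bsub>M\<^esub> y) = a \<odot>\<^bsub>M\<^esub> x \<oplus>\<^bsub>M\<^esub> a \<odot>\<^bsub>M\<^esub> y"
    and smult_assoc1:
      "\<lbrakk>a \<in> carrier R; b \<in> carrier R; x \<in> carrier M\<rbrakk> \<Longrightarrow>
       (a \<otimes> b) \<odot>\<^bsub>M\<^esub> x = a \<odot>\<^bsub>M\<^esub> (b \<odot>\<^bsub>M\<^esub> x)"
    and smult_one:
      "x \<in> carrier M \<Longrightarrow> \<one> \<odot>\<^bsub>M\<^esub> x = x"

definition profinite_module ::
  "'r ring \<Rightarrow> 'r topology \<Rightarrow> ('r, 'm) module \<Rightarrow> 'm topology \<Rightarrow> bool"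
where
  "profinite_module R TR M TM \<longleftrightarrow>
     left_module R M \<and> profinite_group (add_monoid M) TM \<and>
     continuous_map (prod_topology TR TM) TM (\<lambda>(a, x). a \<odot>\<^bsub>M\<^esub> x)"

definition continuous_module_hom ::
  "'r ring \<Rightarrow> ('r, 'm) module \<Rightarrow> 'm topology \<Rightarrow> ('r, 'n) module \<Rightarrow> 'n topology \<Rightarrow> ('m \<Rightarrow> 'n) \<Rightarrow> bool"
where
  "continuous_module_hom R M TM L TL f \<longleftrightarrow>
     continuous_hom (add_monoid M) TM (add_monoid L) TL f \<and>
     (\<forall>a\<in>carrier R. \<forall>x\<in>carrier M. f (a \<odot>\<^bsub>M\<^esub> x) = a \<odot>\<^bsub>L\<^esub> f x)"

definition projective_profinite_module ::
  "'r ring \<Rightarrow> 'r topology \<Rightarrow> ('r, 'm) module \<Rightarrow> 'm topology \<Rightarrow> bool"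
where
  "projective_profinite_module R TR M TM \<longleftrightarrow>
     profinite_module R TR M TM \<and>
     (\<forall>(A :: ('r, ('r + 'm) test) module) TA (B :: ('r, ('r + 'm) test) module) TB f g.
        profinite_module R TR A TA \<and> profinite_module R TR B TB \<and>
        continuous_module_hom R A TA B TB f \<and> f ` carrier A = carrier B \<and>
        continuous_module_hom R M TM B TB g \<longrightarrow>
        (\<exists>h. continuous_module_hom R M TM A TA h \<and> (\<forall>x\<in>carrier M. f (h x) = g x)))"

text \<open>An abelian group, written multiplicatively, with a scalar multiplication; the fields
  \<open>mult\<close> and \<open>one\<close> of a module record play no role.\<close>

definition module_of_group :: "'m monoid \<Rightarrow> ('r \<Rightarrow> 'm \<Rightarrow> 'm) \<Rightarrow> ('r, 'm) module" where
  "module_of_group A s =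
     \<lparr>carrier = carrier A, monoid.mult = undefined, one = undefined,
      zero = \<one>\<^bsub>A\<^esub>, add = (\<lambda>x y. x \<otimes>\<^bsub>A\<^esub> y), smult = s\<rparr>"


section \<open>Special extensions\<close>

definition pro_p_extension ::
  "nat \<Rightarrow> 'n monoid \<Rightarrow> 'n topology \<Rightarrow> ('n \<Rightarrow> 'g) \<Rightarrow> 'g monoid \<Rightarrow> 'g topology \<Rightarrow>
   ('g \<Rightarrow> 'q) \<Rightarrow> 'q monoid \<Rightarrow> 'q topology \<Rightarrow> bool"
where
  "pro_p_extension p N TN \<iota> G TG \<pi> Q TQ \<longleftrightarrow>
     pro_p_group p N TN \<and> pro_p_group p G TG \<and> pro_p_group p Q TQ \<and>
     continuous_hom N TN G TG \<iota> \<and> continuous_hom G TG Q TQ \<pi> \<and>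
     inj_on \<iota> (carrier N) \<and> \<iota> ` carrier N = kernel G Q \<pi> \<and> \<pi> ` carrier G = carrier Q"

definition splits ::
  "'g monoid \<Rightarrow> 'g topology \<Rightarrow> ('g \<Rightarrow> 'q) \<Rightarrow> 'q monoid \<Rightarrow> 'q topology \<Rightarrow> bool"
where
  "splits G TG \<pi> Q TQ \<longleftrightarrow> (\<exists>\<theta>. continuous_hom Q TQ G TG \<theta> \<and> (\<forall>q\<in>carrier Q. \<pi> (\<theta> q) = q))"

text \<open>The action of \<open>Q\<close> on the maximal elementary abelian quotient of \<open>N\<close> sends
  the class of \<open>n\<close> to that of \<open>g n g\<inverse>\<close>, where \<open>g\<close> is any lift of the acting element to \<open>G\<close>. The scalar
  multiplication \<open>s\<close> of the completed group algebra extending it is unique, since the linear span of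
  the group-like elements is dense. The map \<open>\<lambda>C. the_elem (\<pi> ` C)\<close> is the homomorphism
  induced by \<open>\<pi>\<close> on the quotient of \<open>G\<close> by a subgroup of its kernel.\<close>

definition special_extension ::
  "nat \<Rightarrow> 'n monoid \<Rightarrow> 'n topology \<Rightarrow> ('n \<Rightarrow> 'g) \<Rightarrow> 'g monoid \<Rightarrow> 'g topology \<Rightarrow>
   ('g \<Rightarrow> 'q) \<Rightarrow> 'q monoid \<Rightarrow> 'q topology \<Rightarrow> bool"
where
  "special_extension p N TN \<iota> G TG \<pi> Q TQ \<longleftrightarrow>
     pro_p_extension p N TN \<iota> G TG \<pi> Q TQ \<and>
     free_pro_p p N TN \<and>
     (\<exists>s. (\<forall>g\<in>carrier G. \<forall>n\<in>carrier N. \<forall>n'\<in>carrier N.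
             \<iota> n' = g \<otimes>\<^bsub>G\<^esub> \<iota> n \<otimes>\<^bsub>G\<^esub> inv\<^bsub>G\<^esub> g \<longrightarrow>
             s (group_like Q TQ (\<pi> g)) (frattini p N TN #>\<^bsub>N\<^esub> n) = frattini p N TN #>\<^bsub>N\<^esub> n') \<and>
          projective_profinite_module
            (completed_group_algebra p Q TQ) (completed_group_algebra_topology p Q TQ)
            (module_of_group (ab_el p N TN) s) (ab_el_topology p N TN)) \<and>
     (let K = \<iota> ` frattini p N TN in
        splits (G Mod K) (quotient_topology G TG K) (\<lambda>C. the_elem (\<pi> ` C)) Q TQ)"

end

theory Submission
  imports Defs "HOL-Algebra.Group_Action" "HOL-Algebra.Elementary_Groups" "HOL-Algebra.Weak_Morphisms"
    "HOL-Algebra.SndIsomorphismGrp"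
begin

text \<open>Let \<open>Q\<close> act on \<open>N\<close> by conjugation through the splitting \<open>\<theta>\<close>, and let \<open>N\<close> be free on \<open>S\<close>. The
  \<open>Q\<close>-invariant characters \<open>N \<rightarrow> \<int>/p\<close> form a space of functions with finite support on \<open>S\<close>; the
  leading positions \<open>X \<subseteq> S\<close> of an echelon basis make restriction to \<open>X\<close> an isomorphism onto the functions
  with finite support on \<open>X\<close>. The group \<open>F\<close> is the closed subgroup generated by \<open>X\<close>.

  Given a finite p-group \<open>K\<close>, a homomorphism \<open>\<beta> : Q \<rightarrow> K\<close> and values on \<open>X\<close>, induction on the order
  of \<open>K\<close> along central extensions by \<open>\<int>/p\<close> produces a unique equivariant homomorphism \<open>N \<rightarrow> K\<close> with these
  values. The obstruction to equivariance of a lift is a cocycle of \<open>Q\<close> in the dual of the Frattini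
  quotient, and it vanishes because that quotient is projective; the remaining freedom is an
  invariant character, which is determined by its values on \<open>X\<close>. Passing to the limit over the finite
  quotients and gluing with \<open>\<beta>\<close> along \<open>G = N \<rtimes> Q\<close> gives the universal property of the coproduct.\<close>

section \<open>Finite p-groups\<close>

text \<open>If \<open>G\<close> is the coproduct of \<open>F\<close> and \<open>Q\<close>, the
  Frattini quotient of \<open>N\<close> is the module induced from that of \<open>F\<close>, and its
  coinvariants give back the latter. Dually, the invariant characters of \<open>N\<close> must be
  the characters of \<open>F\<close>; this dictates the choice of \<open>X\<close>. Taking
  \<open>X\<close> inside the given basis \<open>S\<close>, instead of lifting an abstract basis of
  the coinvariants, makes freeness of \<open>F\<close> immediate: values on \<open>X\<close> extend
  by 1 to \<open>S\<close>.

  The coproduct is never constructed. Its universal property is checked on \<open>G\<close> itself,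
  which avoids a description of the kernel of a coproduct onto a factor. Projectivity enters through
  the vanishing of first cohomology of the dual, for which finite modules of functions on
  \<open>Q/W\<close> suffice as test objects. Uniqueness at finite level is more than half of the
  statement: it makes the solutions over different quotients compatible, so that they have a limit.

  An induction in HOL stays on one type. All groups \<open>K\<close> of the induction therefore live
  on \<open>nat\<close>, and quotients and test groups are moved there and back by
  isomorphisms.\<close>

lemma finite_group_isomorphic_copy:
  assumes "group H" "finite (carrier H)" "infinite (UNIV :: 'b set)"
  obtains K :: "'b monoid" and f where "group K" "f \<in> iso H K" "finite (carrier K)"
proof -
  obtain B :: "'b set" where B: "finite B" "card B = card (carrier H)"
    using infinite_arbitrarily_large[OF assms(3)] by blast
  then obtain f where f: "bij_betw f (carrier H) B"
    using finite_same_card_bij[OF assms(2) B(1)] by metis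
  then have inj: "inj_on f (carrier H)" by (rule bij_betw_imp_inj_on)
  show thesis
  proof
    show "group (image_group f H)" using group.inj_imp_image_group_is_group[OF assms(1) inj] .
    show "f \<in> iso H (image_group f H)" using inj_imp_image_group_iso[OF inj] .
    show "finite (carrier (image_group f H))" using assms(2) by (simp add: image_group_carrier)
  qed
qed

lemma order_surj_hom:
  assumes "group G" "group H" "h \<in> hom G H" "h ` carrier G = carrier H"
  shows "order G = order H * card (kernel G H h)"
proof -
  interpret group_hom G H h by (simp add: group_hom.intro group_hom_axioms.intro assms)
  have "order (G Mod kernel G H h) = order H"
    using iso_same_card[OF FactGroup_iso[OF assms(4)]] by (simp add: order_def)
  moreover have "order (G Mod kernel G H h) * card (kernel G H h) = order G"
    using G.lagrange[OF subgroup_kernel] by (simp add: FactGroup_def order_def)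
  ultimately show ?thesis by simp
qed

lemma order_surj_hom_prime_power:
  assumes "group G" "group H" "h \<in> hom G H" "h ` carrier G = carrier H"
    and "prime p" "order G = p ^ k"
  shows "\<exists>j. order H = p ^ j"
proof -
  have "order H dvd p ^ k" using order_surj_hom[OF assms(1-4)] assms(6) by simp
  then show ?thesis using assms(5) divides_primepow_nat by blast
qed

lemma prime_power_order_finite:
  assumes "prime p" "order G = p ^ k" shows "finite (carrier G)"
  using assms by (metis card.infinite order_def power_not_zero not_prime_0)

lemma (in group) prime_power_order_pow_eq_one:
  assumes "order G = p ^ k" "x \<in> carrier G"
  shows "x [^] (p ^ k) = \<one>"
  using pow_order_eq_1[OF assms(2)] assms(1) by simp

text \<open>With \<open>n\<close> least such that the \<open>p ^ n\<close>-th power of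
  \<open>x\<close> is trivial, the power one step earlier has order p.\<close>

lemma (in group) order_p_power_ex:
  assumes p: "prime p" and k: "order G = p ^ k" and x: "x \<in> carrier G" "x \<noteq> \<one>"
  obtains m where "x [^] (p ^ m :: nat) \<noteq> \<one>" "(x [^] (p ^ m :: nat)) [^] p = \<one>"
proof -
  define n where "n = (LEAST n. x [^] (p ^ n) = \<one>)"
  have n: "x [^] (p ^ n) = \<one>" unfolding n_def
    by (rule LeastI[of _ k]) (rule prime_power_order_pow_eq_one[OF k x(1)])
  have "n \<noteq> 0" using n x by (metis nat_pow_eone power_0)
  then obtain m where m: "n = Suc m" by (cases n) auto
  have "x [^] (p ^ m) \<noteq> \<one>" using not_less_Least[of m "\<lambda>n. x [^] (p ^ n) = \<one>"] m n_def by auto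
  moreover have "(x [^] (p ^ m)) [^] p = \<one>"
    using n x(1) by (simp add: nat_pow_pow m mult.commute)
  ultimately show thesis using that by blast
qed

text \<open>Orbits of the conjugation action have p-power length, so the number of central elements is
  divisible by p.\<close>

lemma (in group) prime_power_order_center:
  assumes p: "prime p" and k: "order G = p ^ k" "k > 0"
  obtains z where "z \<in> carrier G" "z \<noteq> \<one>" "\<And>x. x \<in> carrier G \<Longrightarrow> x \<otimes> z = z \<otimes> x"
proof -
  let ?\<phi> = "\<lambda>g. (\<lambda>h \<in> carrier G. g \<otimes> h \<otimes> inv g)"
  interpret A: group_action G "carrier G" ?\<phi> by (rule action_by_conjugation)
  define Z where "Z = {z \<in> carrier G. \<forall>x \<in> carrier G. x \<otimes> z = z \<otimes> x}"
  have fin: "finite (carrier G)" using prime_power_order_finite[OF p k(1)] .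
  have orb: "orbit G ?\<phi> x = (\<lambda>g. g \<otimes> x \<otimes> inv g) ` carrier G" if "x \<in> carrier G" for x
    using that by (auto simp: orbit_def)
  have conj_eq: "g \<otimes> x \<otimes> inv g = x \<longleftrightarrow> g \<otimes> x = x \<otimes> g" if "x \<in> carrier G" "g \<in> carrier G" for x g
    using that by (metis inv_solve_right m_closed)
  have orbZ: "orbit G ?\<phi> x = {x}" if "x \<in> Z" for x
  proof -
    have "x \<in> carrier G" using that by (simp add: Z_def)
    moreover have "g \<otimes> x \<otimes> inv g = x" if "g \<in> carrier G" for g
      using conj_eq[OF \<open>x \<in> carrier G\<close> that] that \<open>x \<in> Z\<close> unfolding Z_def by blast
    ultimately show ?thesis by (auto simp: orb image_iff intro!: exI[of _ \<one>])
  qed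
  have dvd: "p dvd card ob" if ob: "ob \<in> orbits G (carrier G) ?\<phi>" "\<not> (\<exists>z\<in>Z. ob = {z})" for ob
  proof -
    obtain x where x: "x \<in> carrier G" "ob = orbit G ?\<phi> x" using ob(1) unfolding orbits_def by blast
    have "card ob dvd p ^ k"
      unfolding x(2) k(1)[symmetric] A.orbit_stabilizer_theorem[OF x(1), symmetric] by simp
    then obtain j where j: "card ob = p ^ j" using p divides_primepow_nat by blast
    \<comment> \<open>An orbit of length 1 would make \<open>x\<close> central, against the
      assumption on \<open>ob\<close>.\<close>
    have "j \<noteq> 0"
    proof
      assume "j = 0"
      then obtain y where y: "ob = {y}" using j by (auto simp: card_1_singleton_iff)
      have "x \<in> ob" using A.orbit_refl x by simp
      with y have ox: "orbit G ?\<phi> x = {x}" using x by auto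
      have "x \<in> Z" using x(1) ox unfolding orb[OF x(1)] Z_def
        by (auto simp: image_iff set_eq_iff conj_eq[OF x(1)]) (metis conj_eq x(1))
      then show False using ob ox x by auto
    qed
    then show ?thesis using j by simp
  qed
  define O1 where "O1 = {ob \<in> orbits G (carrier G) ?\<phi>. \<exists>z\<in>Z. ob = {z}}"
  define O2 where "O2 = orbits G (carrier G) ?\<phi> - O1"
  have finO: "finite (orbits G (carrier G) ?\<phi>)"
    unfolding orbits_def using fin by auto
  have part: "partition (carrier G) (orbits G (carrier G) ?\<phi>)" using A.orbit_partition .
  have "order G = card (\<Union>(orbits G (carrier G) ?\<phi>))"
    using A.orbits_coverture by (simp add: order_def)
  also have "\<dots> = (\<Sum>ob\<in>orbits G (carrier G) ?\<phi>. card ob)"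
  proof (rule card_Union_disjoint)
    show "pairwise disjnt (orbits G (carrier G) ?\<phi>)"
      unfolding pairwise_def disjnt_def using A.disjoint_union by blast
    fix A assume "A \<in> orbits G (carrier G) ?\<phi>"
    then have "A \<subseteq> carrier G" using A.orbits_coverture by blast
    then show "finite A" using fin by (rule finite_subset)
  qed
  also have "\<dots> = sum card O1 + sum card O2"
    unfolding O2_def using sum.subset_diff[OF _ finO, of O1 card] by (simp add: O1_def add.commute)
  finally have "p ^ k = sum card O1 + sum card O2" using k by simp
  moreover have "p dvd sum card O2"
    by (rule dvd_sum) (use dvd O1_def O2_def in blast)
  moreover have "p dvd p ^ k" using k by simp
  ultimately have d: "p dvd sum card O1" by (metis dvd_add_left_iff)
  have "O1 = (\<lambda>z. {z}) ` Z"
  proof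
    show "O1 \<subseteq> (\<lambda>z. {z}) ` Z" by (auto simp: O1_def)
    show "(\<lambda>z. {z}) ` Z \<subseteq> O1"
    proof
      fix ob assume "ob \<in> (\<lambda>z. {z}) ` Z"
      then obtain z where z: "z \<in> Z" "ob = {z}" by blast
      then have "ob = orbit G ?\<phi> z" "z \<in> carrier G" using orbZ by (auto simp: Z_def)
      then have "ob \<in> orbits G (carrier G) ?\<phi>" unfolding orbits_def by blast
      then show "ob \<in> O1" using z by (auto simp: O1_def)
    qed
  qed
  then have "sum card O1 = card Z" by (simp add: sum.reindex)
  with d have "p dvd card Z" by simp
  moreover have "\<one> \<in> Z" by (simp add: Z_def)
  moreover have "finite Z" using fin by (simp add: Z_def)
  ultimately have "Z \<noteq> {\<one>}" using p by (metis One_nat_def card.empty card.insert empty_iff finite.emptyI nat_dvd_1_iff_1 not_prime_1)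
  then obtain z where "z \<in> Z" "z \<noteq> \<one>" using \<open>\<one> \<in> Z\<close> by blast
  then show thesis using that by (auto simp: Z_def)
qed

text \<open>Some p-power of a non-trivial central element has order p, and powers of central
  elements stay central.\<close>

lemma (in group) prime_power_order_central_element:
  assumes p: "prime p" and k: "order G = p ^ k" "k > 0"
  obtains c where "c \<in> carrier G" "c \<noteq> \<one>" "c [^] p = \<one>" "\<And>x. x \<in> carrier G \<Longrightarrow> x \<otimes> c = c \<otimes> x"
proof -
  obtain z where z: "z \<in> carrier G" "z \<noteq> \<one>" "\<And>x. x \<in> carrier G \<Longrightarrow> x \<otimes> z = z \<otimes> x"
    using prime_power_order_center[OF assms] by blast
  obtain m where m: "z [^] (p ^ m :: nat) \<noteq> \<one>" "(z [^] (p ^ m :: nat)) [^] p = \<one>"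
    using order_p_power_ex[OF p k(1) z(1,2)] by blast
  have "x \<otimes> z [^] (n :: nat) = z [^] n \<otimes> x" if x: "x \<in> carrier G" for x n
  proof (induct n)
    case (Suc n)
    then show ?case using x z(1) z(3)[OF x] by (simp add: m_assoc[symmetric]) (metis m_assoc nat_pow_closed z(1))
  qed (simp add: x)
  then show thesis using that m z(1) by blast
qed

section \<open>Elements of order p and central quotients\<close>

lemma (in group) int_pow_eq_one_iff_prime:
  assumes "prime p" "c \<in> carrier G" "c \<noteq> \<one>" "c [^] p = \<one>"
  shows "c [^] (i :: int) = \<one> \<longleftrightarrow> int p dvd i"
proof -
  have "ord c dvd p" using assms pow_eq_id by blast
  moreover have "ord c \<noteq> 1" using assms ord_eq_1 by blast
  ultimately have "ord c = p" using assms(1) prime_nat_iff by blast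
  then show ?thesis using int_pow_eq_id[OF assms(2)] by simp
qed

text \<open>This lets integers up to congruence stand for Z/p: later, characters are integer-valued
  functions whose values serve as exponents of \<open>c\<close>.\<close>

lemma (in group) int_pow_eq_iff_cong_prime:
  assumes "prime p" "c \<in> carrier G" "c \<noteq> \<one>" "c [^] p = \<one>"
  shows "c [^] (i :: int) = c [^] j \<longleftrightarrow> [i = j] (mod int p)"
proof -
  have "c [^] i = c [^] j \<longleftrightarrow> c [^] (i - j) = \<one>"
  proof
    assume "c [^] i = c [^] j"
    then show "c [^] (i - j) = \<one>" using assms(2) by (simp add: int_pow_diff)
  next
    assume "c [^] (i - j) = \<one>"
    then have "c [^] (i - j) \<otimes> c [^] j = c [^] j" using assms(2) by simp
    then show "c [^] i = c [^] j" using assms(2) by (simp flip: int_pow_mult)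
  qed
  then show ?thesis using int_pow_eq_one_iff_prime[OF assms] by (simp add: cong_iff_dvd_diff)
qed

lemma (in group) int_pow_central:
  assumes "c \<in> carrier G" "\<And>x. x \<in> carrier G \<Longrightarrow> x \<otimes> c = c \<otimes> x" "x \<in> carrier G"
  shows "x \<otimes> c [^] (i :: int) = c [^] i \<otimes> x"
proof -
  have nat: "x \<otimes> c [^] (n :: nat) = c [^] n \<otimes> x" for n
  proof (induct n)
    case (Suc n)
    then show ?case using assms by (simp add: m_assoc[symmetric]) (metis m_assoc nat_pow_closed)
  qed (simp add: assms)
  show ?thesis
  proof (cases i)
    case (nonneg n)
    then show ?thesis using nat by (simp add: int_pow_int)
  next
    case (neg n)
    define d where "d = c [^] (Suc n)"
    have d: "d \<in> carrier G" "x \<otimes> d = d \<otimes> x" using nat[of "Suc n"] assms(1) by (auto simp: d_def)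
    have "c [^] i = inv d" using neg int_pow_neg_int[OF assms(1), of "Suc n"] by (simp add: d_def)
    moreover have "inv d \<otimes> (x \<otimes> d) \<otimes> inv d = x \<otimes> inv d"
      unfolding d(2) using d(1) assms(3) by (simp add: m_assoc[symmetric])
    moreover have "inv d \<otimes> (x \<otimes> d) \<otimes> inv d = inv d \<otimes> x"
      using d(1) assms(3) by (simp add: m_assoc)
    ultimately show ?thesis by simp
  qed
qed

text \<open>One step of the induction on the order of a p-group: \<open>K\<close> is a copy on
  \<open>nat\<close> of the quotient by the central subgroup of order p generated by
  \<open>c\<close>. The last clause records the fibres as cosets of the powers of \<open>c\<close>,
  the form in which two lifts are compared later.\<close>

lemma (in group) prime_power_order_central_quotient:
  assumes p: "prime p" and k: "order G = p ^ k" "k > 0"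
  obtains c and K :: "nat monoid" and \<kappa> j
  where "c \<in> carrier G" "c \<noteq> \<one>" "c [^] p = \<one>" "\<And>x. x \<in> carrier G \<Longrightarrow> x \<otimes> c = c \<otimes> x"
    "group K" "order K = p ^ j" "order K < order G" "\<kappa> \<in> hom G K" "\<kappa> ` carrier G = carrier K"
    "\<And>x y. x \<in> carrier G \<Longrightarrow> y \<in> carrier G \<Longrightarrow> \<kappa> x = \<kappa> y \<longleftrightarrow> (\<exists>i::int. x = y \<otimes> c [^] i)"
proof -
  obtain c where c: "c \<in> carrier G" "c \<noteq> \<one>" "c [^] p = \<one>" "\<And>x. x \<in> carrier G \<Longrightarrow> x \<otimes> c = c \<otimes> x"
    using prime_power_order_central_element[OF assms] by blast
  have fin: "finite (carrier G)" using prime_power_order_finite[OF p k(1)] .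
  define C where "C = generate G {c}"
  have C: "C = {c [^] (i :: int) | i. i \<in> UNIV}" unfolding C_def using generate_pow[OF c(1)] by simp
  have sub: "subgroup C G" unfolding C_def using generate_is_subgroup c(1) by simp
  have CG: "C \<lhd> G"
  proof (rule normal_invI[OF sub])
    fix x h assume x: "x \<in> carrier G" and h: "h \<in> C"
    then obtain i :: int where i: "h = c [^] i" using C by auto
    then have "x \<otimes> h \<otimes> inv x = h"
      using int_pow_central[OF c(1) c(4) x, of i] x c(1) by (simp add: m_assoc)
    then show "x \<otimes> h \<otimes> inv x \<in> C" using h by simp
  qed
  interpret C: normal C G by (rule CG)
  have "finite (carrier (G Mod C))" using fin by (simp add: C.factorgroup_is_group FactGroup_def RCOSETS_def)
  then obtain K :: "nat monoid" and f where K: "group K" "f \<in> iso (G Mod C) K" "finite (carrier K)"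
    using finite_group_isomorphic_copy[OF C.factorgroup_is_group, where 'b=nat] infinite_UNIV_nat by blast
  define \<kappa> where "\<kappa> = (\<lambda>x. f (C #> x))"
  have fhom: "f \<in> hom (G Mod C) K" and fbij: "bij_betw f (carrier (G Mod C)) (carrier K)"
    using K(2) by (auto simp: iso_def)
  have qhom: "(\<lambda>x. C #> x) \<in> hom G (G Mod C)" by (rule C.r_coset_hom_Mod)
  have qsurj: "(\<lambda>x. C #> x) ` carrier G = carrier (G Mod C)" by (auto simp: FactGroup_def RCOSETS_def)
  have hom: "\<kappa> \<in> hom G K" 
    using Group.hom_compose[OF qhom fhom] by (simp add: \<kappa>_def comp_def)
  have "\<kappa> ` carrier G = f ` ((\<lambda>x. C #> x) ` carrier G)" by (auto simp: \<kappa>_def)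
  then have surj: "\<kappa> ` carrier G = carrier K" using qsurj fbij by (simp add: bij_betw_def)
  have ker: "\<kappa> x = \<kappa> y \<longleftrightarrow> (\<exists>i::int. x = y \<otimes> c [^] i)" if x: "x \<in> carrier G" and y: "y \<in> carrier G" for x y
  proof -
    have "\<kappa> x = \<kappa> y \<longleftrightarrow> C #> x = C #> y"
      using fbij x y qsurj unfolding \<kappa>_def bij_betw_def by (metis imageI inj_on_eq_iff)
    also have "\<dots> \<longleftrightarrow> x \<in> C #> y"
      using repr_independence[OF _ _ sub, of x y] rcos_self[OF x sub] x y by metis
    also have "\<dots> \<longleftrightarrow> (\<exists>i::int. x = c [^] i \<otimes> y)" by (auto simp: r_coset_def C)
    also have "\<dots> \<longleftrightarrow> (\<exists>i::int. x = y \<otimes> c [^] i)" using int_pow_central[OF c(1) c(4) y] by simp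
    finally show ?thesis .
  qed
  obtain j where j: "order K = p ^ j" using order_surj_hom_prime_power[OF is_group K(1) hom surj p k(1)] by blast
  \<comment> \<open>The kernel contains \<open>\<one>\<close> and \<open>c\<close>, so the order
    strictly drops.\<close>
  have "\<one> \<in> kernel G K \<kappa>" "c \<in> kernel G K \<kappa>"
    using ker[of c \<one>] c(1) hom_one[OF hom is_group K(1)] c(1)
    by (auto simp: kernel_def intro!: exI[of _ 1])
  moreover have "finite (kernel G K \<kappa>)" using fin by (simp add: kernel_def)
  ultimately have "card (kernel G K \<kappa>) \<ge> card {\<one>, c}" by (intro card_mono) auto
  then have "card (kernel G K \<kappa>) \<ge> 2" using c(2) by simp
  moreover have "order K > 0" using j p by (simp add: prime_gt_0_nat)
  ultimately have "order K < order K * card (kernel G K \<kappa>)" by simp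
  then have "order K < order G" using order_surj_hom[OF is_group K(1) hom surj] by simp
  then show thesis using that c K(1) j hom surj ker by blast
qed

section \<open>Topological groups\<close>

abbreviation discrete_on :: "('a, 'm) monoid_scheme \<Rightarrow> 'a topology" where
  "discrete_on H \<equiv> discrete_topology (carrier H)"

lemma topological_groupD:
  assumes "topological_group G T"
  shows "group G" "topspace T = carrier G"
    "continuous_map (prod_topology T T) T (\<lambda>(x, y). x \<otimes>\<^bsub>G\<^esub> y)"
    "continuous_map T T (\<lambda>x. inv\<^bsub>G\<^esub> x)"
  using assms by (auto simp: topological_group_def)

lemma pro_p_groupD:
  assumes "pro_p_group p G T"
  shows "profinite_group G T" "topological_group G T" "group G" "topspace T = carrier G"
    "compact_space T" "Hausdorff_space T" "totally_disconnected_space T"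
  using assms by (auto simp: pro_p_group_def profinite_group_def topological_group_def)

section \<open>Continuity of translations and of homomorphisms to discrete groups\<close>

lemma continuous_map_group_mult:
  assumes "topological_group G T" "continuous_map X T f" "continuous_map X T g"
  shows "continuous_map X T (\<lambda>x. f x \<otimes>\<^bsub>G\<^esub> g x)"
proof -
  have "continuous_map X (prod_topology T T) (\<lambda>x. (f x, g x))"
    using assms by (simp add: continuous_map_pairedI)
  then have "continuous_map X T ((\<lambda>(x, y). x \<otimes>\<^bsub>G\<^esub> y) \<circ> (\<lambda>x. (f x, g x)))"
    using topological_groupD(3)[OF assms(1)] continuous_map_compose by blast
  then show ?thesis by (simp add: comp_def)
qed

lemma continuous_map_group_inv:
  assumes "topological_group G T" "continuous_map X T f"
  shows "continuous_map X T (\<lambda>x. inv\<^bsub>G\<^esub> f x)"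
  using continuous_map_compose[OF assms(2) topological_groupD(4)[OF assms(1)]] by (simp add: comp_def)

lemma continuous_map_translate:
  assumes "topological_group G T" "a \<in> carrier G"
  shows "continuous_map T T (\<lambda>x. x \<otimes>\<^bsub>G\<^esub> a)" "continuous_map T T (\<lambda>x. a \<otimes>\<^bsub>G\<^esub> x)"
proof -
  have "continuous_map T T (\<lambda>x. a)" "continuous_map T T (\<lambda>x. x)"
    using assms topological_groupD(2) by auto
  then show "continuous_map T T (\<lambda>x. x \<otimes>\<^bsub>G\<^esub> a)" "continuous_map T T (\<lambda>x. a \<otimes>\<^bsub>G\<^esub> x)"
    using continuous_map_group_mult[OF assms(1), of T "\<lambda>x. x" "\<lambda>x. a"]
      continuous_map_group_mult[OF assms(1), of T "\<lambda>x. a" "\<lambda>x. x"] by simp_all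
qed

lemma continuous_map_discrete_hom_iff:
  assumes G: "topological_group G T" and "group H" and h: "h \<in> hom G H"
  shows "continuous_map T (discrete_on H) h \<longleftrightarrow> openin T {x \<in> carrier G. h x = \<one>\<^bsub>H\<^esub>}"
proof
  interpret G: group G using topological_groupD[OF G] by simp
  interpret H: group H by fact
  interpret group_hom G H h by unfold_locales (rule h)
  note top = topological_groupD(2)[OF G]
  show "openin T {x \<in> carrier G. h x = \<one>\<^bsub>H\<^esub>}" if "continuous_map T (discrete_on H) h"
    using openin_continuous_map_preimage[OF that, of "{\<one>\<^bsub>H\<^esub>}"] by (simp add: top)
  assume op: "openin T {x \<in> carrier G. h x = \<one>\<^bsub>H\<^esub>}"
  show "continuous_map T (discrete_on H) h"
  proof (unfold continuous_map_def, intro conjI allI impI)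
    show "h \<in> topspace T \<rightarrow> topspace (discrete_on H)" using h by (auto simp: top hom_def)
    fix U assume "openin (discrete_on H) U"
    show "openin T {x \<in> topspace T. h x \<in> U}"
    proof (subst openin_subopen, intro ballI)
      fix a assume a: "a \<in> {x \<in> topspace T. h x \<in> U}"
      then have ac: "a \<in> carrier G" by (simp add: top)
      \<comment> \<open>The translate of the kernel by \<open>a\<close> is an open neighbourhood of
        \<open>a\<close> on which \<open>h\<close> is constant.\<close>
      let ?V = "{x \<in> topspace T. x \<otimes>\<^bsub>G\<^esub> inv\<^bsub>G\<^esub> a \<in> {x \<in> carrier G. h x = \<one>\<^bsub>H\<^esub>}}"
      have "openin T ?V"
        by (rule openin_continuous_map_preimage[OF continuous_map_translate(1)[OF G] op]) (simp add: ac)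
      moreover have "a \<in> ?V" using ac by (simp add: top)
      moreover have "?V \<subseteq> {x \<in> topspace T. h x \<in> U}"
      proof
        fix x assume x: "x \<in> ?V"
        then have xc: "x \<in> carrier G" "h (x \<otimes>\<^bsub>G\<^esub> inv\<^bsub>G\<^esub> a) = \<one>\<^bsub>H\<^esub>" by (auto simp: top)
        then have "h x \<otimes>\<^bsub>H\<^esub> inv\<^bsub>H\<^esub> h a = \<one>\<^bsub>H\<^esub>" using ac by simp
          have "h x \<otimes>\<^bsub>H\<^esub> inv\<^bsub>H\<^esub> h a \<otimes>\<^bsub>H\<^esub> h a = h a"
            using \<open>h x \<otimes>\<^bsub>H\<^esub> inv\<^bsub>H\<^esub> h a = \<one>\<^bsub>H\<^esub>\<close> ac by simp
          then have "h x = h a" using ac xc(1) by (simp add: H.m_assoc)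
        then show "x \<in> {x \<in> topspace T. h x \<in> U}" using a xc by (simp add: top)
      qed
      ultimately show "\<exists>V. openin T V \<and> a \<in> V \<and> V \<subseteq> {x \<in> topspace T. h x \<in> U}" by blast
    qed
  qed
qed

lemma continuous_hom_discrete_iff:
  assumes "topological_group G T" "group H"
  shows "continuous_hom G T H (discrete_on H) h \<longleftrightarrow> h \<in> hom G H \<and> openin T {x \<in> carrier G. h x = \<one>\<^bsub>H\<^esub>}"
  using continuous_map_discrete_hom_iff[OF assms] by (auto simp: continuous_hom_def)

text \<open>A subgroup is the union of the translates of \<open>V\<close> by its elements.\<close>

lemma open_subgroup_superset:
  assumes G: "topological_group G T" and H: "subgroup H G"
    and V: "openin T V" "\<one>\<^bsub>G\<^esub> \<in> V" "V \<subseteq> H"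
  shows "openin T H"
proof (subst openin_subopen, intro ballI)
  interpret G: group G using topological_groupD[OF G] by simp
  fix a assume a: "a \<in> H"
  then have ac: "a \<in> carrier G" using subgroup.mem_carrier[OF H] by blast
  let ?V = "{x \<in> topspace T. x \<otimes>\<^bsub>G\<^esub> inv\<^bsub>G\<^esub> a \<in> V}"
  have "openin T ?V"
    by (rule openin_continuous_map_preimage[OF continuous_map_translate(1)[OF G] V(1)]) (use ac in simp)
  moreover have "a \<in> ?V" using ac V(2) topological_groupD(2)[OF G] by simp
  moreover have "?V \<subseteq> H"
  proof
    fix x assume x: "x \<in> ?V"
    then have xc: "x \<in> carrier G" using topological_groupD(2)[OF G] by simp
    have "x \<otimes>\<^bsub>G\<^esub> inv\<^bsub>G\<^esub> a \<otimes>\<^bsub>G\<^esub> a \<in> H" using subgroup.m_closed[OF H _ a] x V(3) by blast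
    then show "x \<in> H" using ac xc by (simp add: G.m_assoc)
  qed
  ultimately show "\<exists>V. openin T V \<and> a \<in> V \<and> V \<subseteq> H" by blast
qed

text \<open>Continuity only requires some open set around 1 inside the kernel. This suits maps built
  from several others, where the common kernel of the ingredients is such a set.\<close>

lemma continuous_hom_kernel_superset:
  assumes G: "topological_group G T" and H: "group H" and h: "h \<in> hom G H"
    and V: "openin T V" "\<one>\<^bsub>G\<^esub> \<in> V" "\<And>x. x \<in> V \<Longrightarrow> h x = \<one>\<^bsub>H\<^esub>"
  shows "continuous_hom G T H (discrete_on H) h"
proof -
  interpret G: group G using topological_groupD[OF G] by simp
  interpret H: group H by (rule H)
  interpret group_hom G H h by unfold_locales (rule h)
  have "V \<subseteq> kernel G H h"
    using V(3) openin_subset[OF V(1)] topological_groupD(2)[OF G] by (auto simp: kernel_def)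
  then have "openin T (kernel G H h)" by (rule open_subgroup_superset[OF G subgroup_kernel V(1,2)])
  then show ?thesis using h by (simp add: continuous_hom_discrete_iff[OF G H] kernel_def)
qed

lemma continuous_hom_discreteD:
  assumes "topological_group G T" "group H" "continuous_hom G T H (discrete_on H) h"
  shows "h \<in> hom G H" "openin T {x \<in> carrier G. h x = \<one>\<^bsub>H\<^esub>}" "\<And>x. x \<in> carrier G \<Longrightarrow> h x \<in> carrier H"
    "\<And>x y. x \<in> carrier G \<Longrightarrow> y \<in> carrier G \<Longrightarrow> h (x \<otimes>\<^bsub>G\<^esub> y) = h x \<otimes>\<^bsub>H\<^esub> h y" "h \<one>\<^bsub>G\<^esub> = \<one>\<^bsub>H\<^esub>"
  using assms continuous_hom_discrete_iff[OF assms(1,2)] hom_in_carrier[of h G H] hom_mult[of h G H]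
    hom_one[of h G H] topological_groupD(1)[OF assms(1)] by auto

lemma continuous_hom_compose:
  assumes "continuous_hom A TA B TB f" "continuous_hom B TB C TC g"
  shows "continuous_hom A TA C TC (\<lambda>x. g (f x))"
  using assms continuous_map_compose[of TA TB f TC g] Group.hom_compose[of f A B g C]
  by (simp add: continuous_hom_def comp_def)

lemma continuous_hom_restrict:
  assumes "continuous_hom A TA H TH h" "topological_group A TA"
  shows "continuous_hom A TA H TH (restrict h (carrier A))"
  using assms monoid.m_closed[OF group.is_monoid[OF topological_groupD(1)[OF assms(2)]]]
    topological_groupD(2)[OF assms(2)]
  by (auto simp: continuous_hom_def hom_def intro: continuous_map_eq)

text \<open>Open subgroups pull back to open subgroups, so the finiteness condition
  transfers.\<close>

lemma converges_to_one_hom: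
  assumes G: "topological_group G T" and H: "group H" and h: "continuous_hom G T H TH h"
    and f: "converges_to_one G T X f"
  shows "converges_to_one H TH X (\<lambda>x. h (f x))"
  unfolding converges_to_one_def
proof (intro conjI allI impI)
  have hc: "h \<in> hom G H" "continuous_map T TH h" using h by (auto simp: continuous_hom_def)
  interpret group_hom G H h using topological_groupD(1)[OF G] H hc by (simp add: group_hom_def group_hom_axioms_def)
  have fX: "f x \<in> carrier G" if "x \<in> X" for x using f that by (auto simp: converges_to_one_def)
  then show "(\<lambda>x. h (f x)) \<in> X \<rightarrow> carrier H" by auto
  fix U assume U: "subgroup U H \<and> openin TH U"
  let ?V = "{x \<in> carrier G. h x \<in> U}"
  have "subgroup ?V G"
    using U subgroup.one_closed[of U H] subgroup.m_closed[of U H] subgroup.m_inv_closed[of U H]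
    by (intro G.subgroupI) auto
  moreover have "openin T ?V"
    using openin_continuous_map_preimage[OF hc(2), of U] U topological_groupD(2)[OF G] by simp
  ultimately have "finite {x \<in> X. f x \<notin> ?V}" using f unfolding converges_to_one_def by blast
  then show "finite {x \<in> X. h (f x) \<notin> U}" by (rule rev_finite_subset) (use fX in auto)
qed

text \<open>In a discrete group the trivial subgroup is open, so convergence to 1 amounts to finite
  support.\<close>

lemma finite_support_discrete:
  assumes "group K" "converges_to_one K (discrete_on K) X \<phi>"
  shows "finite {x \<in> X. \<phi> x \<noteq> \<one>\<^bsub>K\<^esub>}"
proof -
  have "subgroup {\<one>\<^bsub>K\<^esub>} K" "openin (discrete_on K) {\<one>\<^bsub>K\<^esub>}"
    using group.triv_subgroup[OF assms(1)] monoid.one_closed[OF group.is_monoid[OF assms(1)]] by auto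
  then show ?thesis using assms(2) by (auto simp: converges_to_one_def)
qed

lemma converges_to_one_discrete:
  assumes "f \<in> X \<rightarrow> carrier K" "finite {x \<in> X. f x \<noteq> \<one>\<^bsub>K\<^esub>}"
  shows "converges_to_one K (discrete_on K) X f"
  unfolding converges_to_one_def
proof (intro conjI allI impI assms(1))
  fix U assume "subgroup U K \<and> openin (discrete_on K) U"
  then have "{x \<in> X. f x \<notin> U} \<subseteq> {x \<in> X. f x \<noteq> \<one>\<^bsub>K\<^esub>}" using subgroup.one_closed[of U K] by auto
  then show "finite {x \<in> X. f x \<notin> U}" using assms(2) by (rule finite_subset)
qed

text \<open>The continuous operations carry closures into closures; for multiplication, the closure
  of \<open>K \<times> K\<close> is the product of the closures.\<close>

lemma closure_of_subgroup:
  assumes G: "topological_group G T" and K: "subgroup K G"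
  shows "subgroup (T closure_of K) G"
proof -
  interpret G: group G using topological_groupD[OF G] by simp
  note top = topological_groupD(2)[OF G]
  have sub: "K \<subseteq> T closure_of K"
    using closure_of_subset subgroup.subset[OF K] top by metis
  show ?thesis
  proof (rule G.subgroupI)
    show "T closure_of K \<subseteq> carrier G" using closure_of_subset_topspace top by metis
    show "T closure_of K \<noteq> {}" using sub subgroup.one_closed[OF K] by blast
    fix a assume a: "a \<in> T closure_of K"
    have "(\<lambda>x. inv\<^bsub>G\<^esub> x) ` (T closure_of K) \<subseteq> T closure_of ((\<lambda>x. inv\<^bsub>G\<^esub> x) ` K)"
      using continuous_map_image_closure_subset[OF topological_groupD(4)[OF G]] .
    moreover have "(\<lambda>x. inv\<^bsub>G\<^esub> x) ` K \<subseteq> K" using subgroup.m_inv_closed[OF K] by blast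
    ultimately show "inv\<^bsub>G\<^esub> a \<in> T closure_of K" using a closure_of_mono by blast
    fix b assume b: "b \<in> T closure_of K"
    let ?m = "\<lambda>(x, y). x \<otimes>\<^bsub>G\<^esub> y"
    have "?m ` ((prod_topology T T) closure_of (K \<times> K)) \<subseteq> T closure_of (?m ` (K \<times> K))"
      using continuous_map_image_closure_subset[OF topological_groupD(3)[OF G]] .
    moreover have "?m ` (K \<times> K) \<subseteq> K" using subgroup.m_closed[OF K] by auto
    ultimately have "?m ` ((T closure_of K) \<times> (T closure_of K)) \<subseteq> T closure_of K"
      unfolding closure_of_Times by (rule subset_trans[OF _ closure_of_mono])
    moreover have "(a, b) \<in> (T closure_of K) \<times> (T closure_of K)" using a b by blast
    ultimately have "?m (a, b) \<in> T closure_of K" by blast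
    then show "a \<otimes>\<^bsub>G\<^esub> b \<in> T closure_of K" by simp
  qed
qed

section \<open>Open normal subgroups\<close>

lemma open_normal_subgroupD:
  assumes "W \<in> open_normal_subgroups G T"
  shows "W \<lhd> G" "openin T W" "subgroup W G"
  using assms by (auto simp: open_normal_subgroups_def normal_def)

lemma carrier_open_normal: "topological_group G T \<Longrightarrow> carrier G \<in> open_normal_subgroups G T"
  using group.normal_inv_iff[of G "carrier G"] group.subgroup_self[of G]
    topological_groupD[of G T] openin_topspace[of T] unfolding open_normal_subgroups_def
  by (simp add: group.inv_closed group.is_monoid monoid.m_closed)

lemma open_normal_Int:
  assumes "topological_group G T" "V \<in> open_normal_subgroups G T" "W \<in> open_normal_subgroups G T"
  shows "V \<inter> W \<in> open_normal_subgroups G T"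
  using assms group.normal_subgroup_intersect[OF topological_groupD(1)[OF assms(1)]]
  unfolding open_normal_subgroups_def by auto

text \<open>The open normal subgroups are directed downwards, so finitely many conditions on finite
  quotients can be tested at a single \<open>V\<close>.\<close>

lemma open_normal_Inter:
  assumes G: "topological_group G T" and "finite \<V>" "\<V> \<subseteq> open_normal_subgroups G T"
  shows "\<exists>V \<in> open_normal_subgroups G T. \<forall>W \<in> \<V>. V \<subseteq> W"
  using assms(2,3)
proof (induct rule: finite_induct)
  case empty
  then show ?case using carrier_open_normal[OF G] by blast
next
  case (insert W \<V>)
  then obtain V where "V \<in> open_normal_subgroups G T" "\<forall>W \<in> \<V>. V \<subseteq> W" by blast
  then show ?case using open_normal_Int[OF G, of V W] insert by (intro bexI[of _ "V \<inter> W"]) auto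
qed

text \<open>In a compact Hausdorff space quasi-components are connected components, hence points
  under total disconnectedness. A quasi-component is separated by a clopen set from any compact set
  disjoint from it, here from the complement of \<open>U\<close>.\<close>

lemma clopen_base_compact_totally_disconnected:
  assumes T: "compact_space T" "Hausdorff_space T" "totally_disconnected_space T"
    and U: "openin T U" "x \<in> U"
  obtains K where "openin T K" "closedin T K" "x \<in> K" "K \<subseteq> U"
proof -
  have xt: "x \<in> topspace T" using U openin_subset by blast
  define C where "C = quasi_component_of_set T x"
  have C: "C \<in> quasi_components_of T"
    unfolding C_def quasi_components_of_def using xt by blast
  have "compactin T C"
    using C T(1) closedin_quasi_components_of closedin_compact_space by blast
  then have "C \<in> connected_components_of T"
    using C compact_quasi_eq_connected_components_of[OF compact_imp_locally_compact_space[OF T(1)] T(2)] by blast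
  then have "connectedin T C" by (simp add: connectedin_connected_components_of)
  then obtain y where "C \<subseteq> {y}" using T(3) unfolding totally_disconnected_space_def by blast
  moreover have "x \<in> C" unfolding C_def using xt by simp
  ultimately have Cx: "C = {x}" by blast
  have comp: "compactin T (topspace T - U)"
    using closedin_compact_space[OF T(1)] closedin_diff[OF closedin_topspace U(1)] by blast
  have "separated_between T C (topspace T - U)"
    using separated_between_quasi_component_compact[OF C comp] U Cx by (simp add: disjnt_def)
  then show thesis using that Cx unfolding separated_between using openin_subset by fastforce
qed

text \<open>The witness consists of the elements acting trivially on the syntactic congruence classes of
  a clopen neighbourhood \<open>K\<close>; its complement is the projection of a clopen set along a compact space.\<close>

lemma profinite_open_normal_base:
  assumes G: "profinite_group G T" and A: "openin T A" "\<one>\<^bsub>G\<^esub> \<in> A"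
  obtains U where "U \<in> open_normal_subgroups G T" "U \<subseteq> A"
proof -
  have tg: "topological_group G T" and T: "compact_space T" "Hausdorff_space T" "totally_disconnected_space T"
    using G by (auto simp: profinite_group_def)
  interpret G: group G using topological_groupD[OF tg] by simp
  note top = topological_groupD(2)[OF tg]
  obtain K where K: "openin T K" "closedin T K" "\<one>\<^bsub>G\<^esub> \<in> K" "K \<subseteq> A"
    using clopen_base_compact_totally_disconnected[OF T A] by blast
  define U where "U = {u \<in> carrier G. \<forall>a\<in>carrier G. \<forall>b\<in>carrier G. a \<otimes>\<^bsub>G\<^esub> u \<otimes>\<^bsub>G\<^esub> b \<in> K \<longleftrightarrow> a \<otimes>\<^bsub>G\<^esub> b \<in> K}"
  have UD: "a \<otimes>\<^bsub>G\<^esub> u \<otimes>\<^bsub>G\<^esub> b \<in> K \<longleftrightarrow> a \<otimes>\<^bsub>G\<^esub> b \<in> K"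
    if "u \<in> U" "a \<in> carrier G" "b \<in> carrier G" for u a b using that by (auto simp: U_def)
  have Uc: "u \<in> carrier G" if "u \<in> U" for u using that by (auto simp: U_def)
  have sub: "subgroup U G"
  proof (rule G.subgroupI)
    show "U \<subseteq> carrier G" by (auto simp: U_def)
    show "U \<noteq> {}" by (auto simp: U_def intro!: exI[of _ "\<one>\<^bsub>G\<^esub>"])
    fix u assume u: "u \<in> U"
    show "inv\<^bsub>G\<^esub> u \<in> U"
      unfolding U_def
    proof (intro CollectI conjI ballI)
      fix a b assume ab: "a \<in> carrier G" "b \<in> carrier G"
      have "a \<otimes>\<^bsub>G\<^esub> inv\<^bsub>G\<^esub> u \<otimes>\<^bsub>G\<^esub> u \<otimes>\<^bsub>G\<^esub> b \<in> K \<longleftrightarrow> a \<otimes>\<^bsub>G\<^esub> inv\<^bsub>G\<^esub> u \<otimes>\<^bsub>G\<^esub> b \<in> K"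
        using UD[OF u, of "a \<otimes>\<^bsub>G\<^esub> inv\<^bsub>G\<^esub> u" b] ab Uc[OF u] by simp
      then show "(a \<otimes>\<^bsub>G\<^esub> inv\<^bsub>G\<^esub> u \<otimes>\<^bsub>G\<^esub> b \<in> K) = (a \<otimes>\<^bsub>G\<^esub> b \<in> K)"
        using ab Uc[OF u] by (simp add: G.m_assoc)
    qed (use Uc[OF u] in simp)
    fix v assume v: "v \<in> U"
    show "u \<otimes>\<^bsub>G\<^esub> v \<in> U"
      unfolding U_def
    proof (intro CollectI conjI ballI)
      fix a b assume ab: "a \<in> carrier G" "b \<in> carrier G"
      show "(a \<otimes>\<^bsub>G\<^esub> (u \<otimes>\<^bsub>G\<^esub> v) \<otimes>\<^bsub>G\<^esub> b \<in> K) = (a \<otimes>\<^bsub>G\<^esub> b \<in> K)"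
        using UD[OF v, of "a \<otimes>\<^bsub>G\<^esub> u" b] UD[OF u ab] ab Uc[OF u] Uc[OF v] by (simp add: G.m_assoc)
    qed (use Uc[OF u] Uc[OF v] in simp)
  qed
  have normal: "U \<lhd> G"
  proof (rule G.normal_invI[OF sub])
    fix g u assume g: "g \<in> carrier G" and u: "u \<in> U"
    show "g \<otimes>\<^bsub>G\<^esub> u \<otimes>\<^bsub>G\<^esub> inv\<^bsub>G\<^esub> g \<in> U"
      unfolding U_def
    proof (intro CollectI conjI ballI)
      fix a b assume ab: "a \<in> carrier G" "b \<in> carrier G"
      have "g \<otimes>\<^bsub>G\<^esub> (inv\<^bsub>G\<^esub> g \<otimes>\<^bsub>G\<^esub> b) = b"
        using ab g by (simp add: G.m_assoc[symmetric])
      then show "(a \<otimes>\<^bsub>G\<^esub> (g \<otimes>\<^bsub>G\<^esub> u \<otimes>\<^bsub>G\<^esub> inv\<^bsub>G\<^esub> g) \<otimes>\<^bsub>G\<^esub> b \<in> K) = (a \<otimes>\<^bsub>G\<^esub> b \<in> K)"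
        using UD[OF u, of "a \<otimes>\<^bsub>G\<^esub> g" "inv\<^bsub>G\<^esub> g \<otimes>\<^bsub>G\<^esub> b"] ab g Uc[OF u] by (simp add: G.m_assoc)
    qed (use g Uc[OF u] in simp)
  qed
  have "U \<subseteq> K"
  proof
    fix u assume u: "u \<in> U"
    then show "u \<in> K" using UD[OF u, of "\<one>\<^bsub>G\<^esub>" "\<one>\<^bsub>G\<^esub>"] K(3) Uc[OF u] by simp
  qed
  moreover have "openin T U"
  proof -
    let ?X = "prod_topology T (prod_topology T T)"
    let ?f = "\<lambda>(u, a, b). a \<otimes>\<^bsub>G\<^esub> u \<otimes>\<^bsub>G\<^esub> b" and ?g = "\<lambda>(u, a, b). a \<otimes>\<^bsub>G\<^esub> b"
    have c1: "continuous_map ?X T fst" by (rule continuous_map_fst)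
    have c2: "continuous_map ?X T (\<lambda>z. fst (snd z))"
      using continuous_map_compose[OF continuous_map_snd continuous_map_fst] by (simp add: comp_def)
    have c3: "continuous_map ?X T (\<lambda>z. snd (snd z))"
      using continuous_map_compose[OF continuous_map_snd continuous_map_snd] by (simp add: comp_def)
    have cf: "continuous_map ?X T ?f"
      using continuous_map_group_mult[OF tg continuous_map_group_mult[OF tg c2 c1] c3]
      by (simp add: case_prod_unfold)
    have cg: "continuous_map ?X T ?g"
      using continuous_map_group_mult[OF tg c2 c3] by (simp add: case_prod_unfold)
    \<comment> \<open>\<open>?B\<close> consists of the triples whose \<open>a\<close> and
      \<open>b\<close> show that \<open>u\<close> is not in \<open>U\<close>; it is closed because
      \<open>K\<close> is clopen.\<close>
    let ?B = "({z \<in> topspace ?X. ?f z \<in> K} \<inter> {z \<in> topspace ?X. ?g z \<in> topspace T - K})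
        \<union> ({z \<in> topspace ?X. ?f z \<in> topspace T - K} \<inter> {z \<in> topspace ?X. ?g z \<in> K})"
    have "closedin ?X ?B"
      by (intro closedin_Un closedin_Int closedin_continuous_map_preimage[OF cf]
          closedin_continuous_map_preimage[OF cg] closedin_diff) (auto simp: K)
    moreover have "closed_map ?X T fst"
      by (rule Abstract_Topological_Spaces.closed_map_fst) (use T(1) compact_space_prod_topology in blast)
    ultimately have "closedin T (fst ` ?B)" by (auto simp: closed_map_def)
    moreover have "U = topspace T - fst ` ?B"
    proof (rule Set.set_eqI)
      fix u
      show "u \<in> U \<longleftrightarrow> u \<in> topspace T - fst ` ?B"
      proof (cases "u \<in> carrier G")
        case True
        have "u \<in> fst ` B \<longleftrightarrow> (\<exists>a b. (u, a, b) \<in> B)" for B :: "('a \<times> 'a \<times> 'a) set" by force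
        then have "u \<in> fst ` ?B \<longleftrightarrow> (\<exists>a b. (u, a, b) \<in> ?B)" .
        also have "\<dots> \<longleftrightarrow> u \<notin> U" using True by (auto simp: U_def top)
        finally show ?thesis using True by (auto simp: top)
      qed (auto simp: U_def top)
    qed
    ultimately show ?thesis by blast
  qed
  ultimately show thesis using that[of U] normal K(4) by (auto simp: open_normal_subgroups_def)
qed

text \<open>If \<open>x\<close> and \<open>y\<close> differ, the complement of the point
  \<open>x\<close> times the inverse of \<open>y\<close> is an open set around 1. It contains an
  open normal \<open>W\<close>, and the two cosets of \<open>W\<close> are then distinct.\<close>

lemma profinite_eq_if_all_cosets_eq:
  assumes G: "profinite_group G T" and x: "x \<in> carrier G" and y: "y \<in> carrier G"
    and eq: "\<And>W. W \<in> open_normal_subgroups G T \<Longrightarrow> W #>\<^bsub>G\<^esub> x = W #>\<^bsub>G\<^esub> y"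
  shows "x = y"
proof (rule ccontr)
  assume "x \<noteq> y"
  have tg: "topological_group G T" and T2: "Hausdorff_space T"
    using G by (auto simp: profinite_group_def)
  interpret G: group G using topological_groupD[OF tg] by simp
  note top = topological_groupD(2)[OF tg]
  let ?A = "topspace T - {x \<otimes>\<^bsub>G\<^esub> inv\<^bsub>G\<^esub> y}"
  have "closedin T {x \<otimes>\<^bsub>G\<^esub> inv\<^bsub>G\<^esub> y}"
    using T2 x y top by (simp add: Hausdorff_imp_t1_space closedin_t1_singleton)
  moreover have ne: "x \<otimes>\<^bsub>G\<^esub> inv\<^bsub>G\<^esub> y \<noteq> \<one>\<^bsub>G\<^esub>"
    using \<open>x \<noteq> y\<close> x y by (metis G.inv_equality G.inv_inv G.inv_closed)
  ultimately obtain W where W: "W \<in> open_normal_subgroups G T" "W \<subseteq> ?A"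
    using profinite_open_normal_base[OF G openin_diff[OF openin_topspace]] top G.one_closed
    by (metis Diff_iff singletonD)
  have "x \<in> W #>\<^bsub>G\<^esub> y"
    using eq[OF W(1)] G.rcos_self[OF x open_normal_subgroupD(3)[OF W(1)]] by simp
  then obtain w where w: "w \<in> W" "x = w \<otimes>\<^bsub>G\<^esub> y" by (auto simp: r_coset_def)
  moreover have "w \<in> carrier G" using W w open_normal_subgroupD(3) subgroup.mem_carrier by metis
  ultimately have "x \<otimes>\<^bsub>G\<^esub> inv\<^bsub>G\<^esub> y = w" using y by (simp add: G.m_assoc)
  then show False using W(2) w by blast
qed

lemma continuous_hom_quotient:
  assumes G: "topological_group G T" and W: "W \<in> open_normal_subgroups G T"
  shows "continuous_hom G T (G Mod W) (discrete_on (G Mod W)) (\<lambda>x. W #>\<^bsub>G\<^esub> x)"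
proof -
  interpret W: normal W G using open_normal_subgroupD[OF W] by simp
  have "{x \<in> carrier G. W #>\<^bsub>G\<^esub> x = \<one>\<^bsub>G Mod W\<^esub>} = W"
    using W.rcos_const W.subset W.rcos_self[OF _ W.is_subgroup] by (auto simp: FactGroup_def)
  then show ?thesis
    using continuous_hom_discrete_iff[OF G W.factorgroup_is_group] W.r_coset_hom_Mod open_normal_subgroupD(2)[OF W]
    by simp
qed

section \<open>Finite p-groups as discrete pro-p groups\<close>

lemma finite_discrete_profinite:
  assumes "group H" "finite (carrier H)"
  shows "profinite_group H (discrete_on H)"
proof -
  interpret H: group H by fact
  have "totally_disconnected_space (discrete_on H)"
    unfolding totally_disconnected_space_def connectedin_discrete_topology by (auto simp: subset_singleton_iff)
  then show ?thesis
    unfolding profinite_group_def topological_group_def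
    using assms by (auto simp: compact_space_discrete_topology prod_topology_discrete_topology[symmetric])
qed

lemma prime_power_order_discrete_pro_p:
  assumes p: "prime p" and H: "group H" "order H = p ^ k"
  shows "pro_p_group p H (discrete_on H)"
proof -
  interpret H: group H by fact
  have fin: "finite (carrier H)" using prime_power_order_finite[OF p H(2)] .
  have "\<exists>j. order (H Mod W) = p ^ j" if W: "W \<in> open_normal_subgroups H (discrete_on H)" for W
  proof -
    interpret W: normal W H using open_normal_subgroupD[OF W] by simp
    show ?thesis
      by (rule order_surj_hom_prime_power[OF H(1) W.factorgroup_is_group W.r_coset_hom_Mod _ p H(2)])
        (auto simp: FactGroup_def RCOSETS_def)
  qed
  then show ?thesis
    using finite_discrete_profinite[OF H(1) fin] by (auto simp: pro_p_group_def)
qed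

lemma pro_p_quotient_order:
  assumes "pro_p_group p G T" "W \<in> open_normal_subgroups G T"
  obtains k where "order (G Mod W) = p ^ k"
  using assms by (auto simp: pro_p_group_def)

section \<open>Echelon bases modulo a prime\<close>

text \<open>Fix a well-order of \<open>S\<close>. The set \<open>X\<close> consists of the leading positions of the members
  of \<open>D\<close>, where the leading position of a function with finite support is the largest element of its
  support.\<close>

lemma echelon_positions:
  fixes D :: "('a \<Rightarrow> int) set" and S :: "'a set"
  assumes p: "prime p"
    and zero: "(\<lambda>_. 0) \<in> D"
    and lin: "\<And>d e k. d \<in> D \<Longrightarrow> e \<in> D \<Longrightarrow> (\<lambda>s. d s + k * e s) \<in> D"
    and fin: "\<And>d. d \<in> D \<Longrightarrow> finite {s \<in> S. \<not> [d s = 0] (mod int p)}"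
  obtains X where "X \<subseteq> S"
    "\<And>d. d \<in> D \<Longrightarrow> (\<And>x. x \<in> X \<Longrightarrow> [d x = 0] (mod int p)) \<Longrightarrow> (\<And>s. s \<in> S \<Longrightarrow> [d s = 0] (mod int p))"
    "\<And>f. finite {x \<in> X. \<not> [f x = 0] (mod int p)} \<Longrightarrow> \<exists>d\<in>D. \<forall>x\<in>X. [d x = f x] (mod int p)"
proof -
  obtain r where wo: "well_order_on S r" using well_order_on by blast
  define lt where "lt = r - Id"
  have wf: "wf lt" using wo by (simp add: well_order_on_def lt_def)
  have trans: "trans lt" and total: "\<And>x y. x \<in> S \<Longrightarrow> y \<in> S \<Longrightarrow> x \<noteq> y \<Longrightarrow> (x, y) \<in> lt \<or> (y, x) \<in> lt"
    and irr: "\<And>x. (x, x) \<notin> lt"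
    using wo unfolding well_order_on_def linear_order_on_def partial_order_on_def preorder_on_def lt_def
    by (auto simp: total_on_def trans_diff_Id)
  define lead where "lead d x \<longleftrightarrow> x \<in> S \<and> \<not> [d x = 0] (mod int p)
      \<and> (\<forall>s\<in>S. (x, s) \<in> lt \<longrightarrow> [d s = 0] (mod int p))" for d x
  have ex_lead: "\<exists>x. lead d x" if d: "d \<in> D" and s: "s \<in> S" "\<not> [d s = 0] (mod int p)" for d s
  proof -
    define A where "A = {s \<in> S. \<not> [d s = 0] (mod int p)}"
    have A: "finite A" "A \<noteq> {}" using fin[OF d] s by (auto simp: A_def)
    \<comment> \<open>A non-empty finite support has a largest element, because on a finite set the
      converse of \<open>lt\<close> is well-founded as well.\<close>
    have "acyclic (lt\<inverse>)" using wf by (simp add: wf_acyclic)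
    then have "wf (lt\<inverse> \<inter> A \<times> A)"
      using A(1) by (intro finite_acyclic_wf) (auto intro: acyclic_subset)
    then obtain x where x: "x \<in> A" "\<And>y. (y, x) \<in> lt\<inverse> \<inter> A \<times> A \<Longrightarrow> y \<notin> A"
      using wfE_min[of "lt\<inverse> \<inter> A \<times> A" _ A] A(2) by blast
    then have "lead d x" by (auto simp: lead_def A_def)
    then show ?thesis ..
  qed
  define X where "X = {x. \<exists>d\<in>D. lead d x}"
  have XS: "X \<subseteq> S" by (auto simp: X_def lead_def)
  have inverse: "\<exists>c. [c * a = 1] (mod int p)" if "\<not> [a = 0] (mod int p)" for a
  proof -
    have "coprime a (int p)"
      using that p prime_imp_coprime[of "int p" a] by (simp add: cong_0_iff coprime_commute)
    then show ?thesis using cong_solve_coprime_int[of a "int p"] by (metis mult.commute)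
  qed
  \<comment> \<open>Reduced echelon form: each position in \<open>X\<close> has a member of
    \<open>D\<close> that is 1 there and 0 at the rest of \<open>X\<close>. The induction runs
    upwards along the well-order.\<close>
  have unit: "\<exists>d\<in>D. \<forall>y\<in>X. [d y = (if y = x then 1 else 0)] (mod int p)" if "x \<in> X" for x
    using wf that
  proof (induct x rule: wf_induct_rule)
    case (less x)
    then obtain d where d: "d \<in> D" "lead d x" by (auto simp: X_def)
    obtain c where c: "[c * d x = 1] (mod int p)" using inverse d(2) unfolding lead_def by blast
    \<comment> \<open>The entries of \<open>d\<close> at other positions of \<open>X\<close>, still
      to be cleared. They lie below the leading position \<open>x\<close>, so the induction
      hypothesis supplies unit vectors to clear them with.\<close>
    define A where "A = {y \<in> X. y \<noteq> x \<and> \<not> [d y = 0] (mod int p)}"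
    have "finite A" by (rule finite_subset[OF _ fin[OF d(1)]]) (use XS A_def in auto)
    have A: "(y, x) \<in> lt" if "y \<in> A" for y
      using that total[of y x] d(2) XS less.prems unfolding A_def lead_def by blast
    \<comment> \<open>\<open>B\<close> is the set of entries already cleared; the factor
      \<open>c\<close> normalises the entry at \<open>x\<close> to 1.\<close>
    have "B \<subseteq> A \<Longrightarrow> \<exists>e\<in>D. \<forall>y\<in>X. [e y = (if y = x then 1 else if y \<in> B then 0 else c * d y)] (mod int p)" for B
    proof -
      have "finite B" if "B \<subseteq> A" using \<open>finite A\<close> that finite_subset by blast
      then show "B \<subseteq> A \<Longrightarrow> ?thesis"
      proof (induct B rule: infinite_finite_induct)
        case empty
        have "(\<lambda>s. 0 + c * d s) \<in> D" using lin[OF zero d(1)] .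
        then show ?case using c by (intro bexI[of _ "\<lambda>s. 0 + c * d s"]) auto
      next
        case (insert b B)
        then obtain e where e: "e \<in> D"
          "\<And>y. y \<in> X \<Longrightarrow> [e y = (if y = x then 1 else if y \<in> B then 0 else c * d y)] (mod int p)"
          using finite_subset by blast
        have b: "b \<in> X" "b \<noteq> x" "(b, x) \<in> lt" using insert A by (auto simp: A_def)
        then obtain u where u: "u \<in> D" "\<And>y. y \<in> X \<Longrightarrow> [u y = (if y = b then 1 else 0)] (mod int p)"
          using less.hyps by blast
        have "(\<lambda>s. e s + (- e b) * u s) \<in> D" by (rule lin[OF e(1) u(1)])
        moreover have "[e y + (- e b) * u y = (if y = x then 1 else if y \<in> insert b B then 0 else c * d y)] (mod int p)"
          if y: "y \<in> X" for y
        proof -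
          have c0: "[e y + (- e b) * u y = e y + (- e b) * (if y = b then 1 else 0)] (mod int p)"
            using u(2)[OF y] by (intro cong_add cong_mult) auto
          have c1: "e y + (- e b) * (if y = b then 1 else 0) = (if y = b then 0 else e y)" by simp
          have eq: "[e y + (- e b) * u y = (if y = b then 0 else e y)] (mod int p)" by (rule c0[unfolded c1])
          show ?thesis
          proof (cases "y = b")
            case True
            then have c2: "(if y = x then 1 else if y \<in> insert b B then 0 else c * d y) = (if y = b then 0 else e y)"
              using b(2) by simp
            show ?thesis unfolding c2 by (rule eq)
          next
            case False
            then have c2: "(if y = x then 1 else if y \<in> insert b B then 0 else c * d y)
                = (if y = x then 1 else if y \<in> B then 0 else c * d y)" by simp
            have c3: "(if y = b then 0 else e y) = e y" using False by simp
            show ?thesis unfolding c2 by (rule cong_trans[OF eq[unfolded c3] e(2)[OF y]])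
          qed
        qed
        ultimately show ?case by (intro bexI[of _ "\<lambda>s. e s + (- e b) * u s"] ballI)
      qed (use that in auto)
    qed
    from this[OF order_refl] obtain e where e: "e \<in> D"
      "\<And>y. y \<in> X \<Longrightarrow> [e y = (if y = x then 1 else if y \<in> A then 0 else c * d y)] (mod int p)" by blast
    have "[e y = (if y = x then 1 else 0)] (mod int p)" if y: "y \<in> X" for y
    proof (cases "y = x \<or> y \<in> A")
      case True
      then show ?thesis using e(2)[OF y] by (auto split: if_splits)
    next
      case False
      then have "[d y = 0] (mod int p)" using y by (auto simp: A_def)
      then have "[c * d y = 0] (mod int p)" by (metis cong_scalar_left mult_zero_right)
      then show ?thesis using e(2)[OF y] False by (auto intro: cong_trans)
    qed
    then show ?case using e(1) by blast
  qed
  show thesis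
  proof (rule that[OF XS])
    show "[d s = 0] (mod int p)"
      if asm: "d \<in> D" "\<And>x. x \<in> X \<Longrightarrow> [d x = 0] (mod int p)" "s \<in> S" for d s
    proof (rule ccontr)
      assume "\<not> [d s = 0] (mod int p)"
      \<comment> \<open>A non-zero \<open>d\<close> has a leading position. It belongs to
        \<open>X\<close>, and \<open>d\<close> does not vanish there.\<close>
      then obtain x where "lead d x" using ex_lead[OF asm(1,3)] by blast
      then show False using asm by (auto simp: X_def lead_def)
    qed
    show "\<exists>d\<in>D. \<forall>x\<in>X. [d x = f x] (mod int p)" if f: "finite {x \<in> X. \<not> [f x = 0] (mod int p)}" for f
    proof -
      \<comment> \<open>A function with finite support on \<open>X\<close> is matched by the finite
        sum of its values times the unit vectors.\<close>
      let ?A = "{x \<in> X. \<not> [f x = 0] (mod int p)}"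
      have "B \<subseteq> X \<Longrightarrow> \<exists>d\<in>D. \<forall>x\<in>X. [d x = (if x \<in> B then f x else 0)] (mod int p)" if "finite B" for B
        using that
      proof (induct B)
        case empty
        then show ?case using zero by (intro bexI[of _ "\<lambda>_. 0"]) auto
      next
        case (insert b B)
        then obtain d where d: "d \<in> D" "\<And>x. x \<in> X \<Longrightarrow> [d x = (if x \<in> B then f x else 0)] (mod int p)" by blast
        obtain u where u: "u \<in> D" "\<And>y. y \<in> X \<Longrightarrow> [u y = (if y = b then 1 else 0)] (mod int p)"
          using unit insert.prems by blast
        have "[d x + f b * u x = (if x \<in> insert b B then f x else 0)] (mod int p)" if x: "x \<in> X" for x
        proof -
          have c0: "[d x + f b * u x = (if x \<in> B then f x else 0) + f b * (if x = b then 1 else 0)] (mod int p)"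
            using u(2)[OF x] d(2)[OF x] by (intro cong_add cong_mult) auto
          have c1: "(if x \<in> B then f x else 0) + f b * (if x = b then 1 else 0) = (if x \<in> insert b B then f x else 0)"
            using insert.hyps by auto
          show ?thesis by (rule c0[unfolded c1])
        qed
        then show ?case
          using lin[OF d(1) u(1), of "f b"] by (intro bexI[of _ "\<lambda>s. d s + f b * u s"] ballI)
      qed
      from this[OF f] obtain d where d: "d \<in> D"
        "\<And>x. x \<in> X \<Longrightarrow> [d x = (if x \<in> ?A then f x else 0)] (mod int p)" by blast
      have "[d x = f x] (mod int p)" if "x \<in> X" for x
        using d(2)[OF that] that by (auto split: if_splits intro: cong_trans cong_sym)
      then show ?thesis using d(1) by blast
    qed
  qed
qed

section \<open>The completed group algebra in coordinates\<close>

text \<open>Coefficients in the residue ring are handled as integers from 0 to p - 1, with one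
  reduction at the end of a sum.\<close>

lemma residue_ring_finsum:
  assumes "p > 1" "finite K" "f \<in> K \<rightarrow> {0..<p}"
  shows "(\<Oplus>\<^bsub>residue_ring p\<^esub>x\<in>K. f x) = (\<Sum>x\<in>K. f x) mod p"
proof -
  interpret residues p "residue_ring p" by unfold_locales (use assms in auto)
  have c: "carrier (residue_ring p) = {0..<p}" by (auto simp: res_carrier_eq)
  show ?thesis using assms(2,3)
  proof (induct K rule: finite_induct)
    case empty
    then show ?case by (simp add: res_zero_eq)
  next
    case (insert x F)
    then have "f \<in> F \<rightarrow> carrier (residue_ring p)" "f x \<in> carrier (residue_ring p)" by (auto simp: c)
    then have "(\<Oplus>\<^bsub>residue_ring p\<^esub>x\<in>insert x F. f x) = f x \<oplus>\<^bsub>residue_ring p\<^esub> (\<Oplus>\<^bsub>residue_ring p\<^esub>x\<in>F. f x)"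
      using finsum_insert[OF insert(1,2)] by simp
    then show ?case using insert by (simp add: res_add_eq mod_add_right_eq)
  qed
qed

locale pro_p_algebra =
  fixes p :: nat and Q :: "'q monoid" and TQ :: "'q topology"
  assumes prime: "prime p" and pro_p: "pro_p_group p Q TQ"
begin

abbreviation "ONS \<equiv> open_normal_subgroups Q TQ"
abbreviation "cosets W \<equiv> carrier (Q Mod W)"
abbreviation "\<Lambda> \<equiv> completed_group_algebra p Q TQ"
abbreviation "T\<Lambda> \<equiv> completed_group_algebra_topology p Q TQ"

lemma p_gt_1: "int p > 1" using prime prime_gt_1_nat by auto

lemma pgroups: "profinite_group Q TQ" "topological_group Q TQ" "group Q" "topspace TQ = carrier Q"
  using pro_p_groupD[OF pro_p] by auto

lemma residue_carrier: "carrier (residue_ring (int p)) = {0..<int p}"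
  by (auto simp: residue_ring_def)

lemma finite_cosets: "W \<in> ONS \<Longrightarrow> finite (cosets W)"
  using pro_p_quotient_order[OF pro_p] prime_power_order_finite[OF prime] by metis

lemma group_quotient: "W \<in> ONS \<Longrightarrow> group (Q Mod W)"
  using normal.factorgroup_is_group open_normal_subgroupD(1) by metis

lemma coset_in: "W \<in> ONS \<Longrightarrow> q \<in> carrier Q \<Longrightarrow> W #>\<^bsub>Q\<^esub> q \<in> cosets W"
  by (auto simp: FactGroup_def RCOSETS_def)

lemma coset_cases:
  assumes "C \<in> cosets W" obtains q where "q \<in> carrier Q" "C = W #>\<^bsub>Q\<^esub> q"
  using assms by (auto simp: FactGroup_def RCOSETS_def)

lemma coset_mult:
  assumes "W \<in> ONS" "x \<in> carrier Q" "y \<in> carrier Q"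
  shows "(W #>\<^bsub>Q\<^esub> x) \<otimes>\<^bsub>Q Mod W\<^esub> (W #>\<^bsub>Q\<^esub> y) = W #>\<^bsub>Q\<^esub> (x \<otimes>\<^bsub>Q\<^esub> y)"
  using normal.rcos_sum[OF open_normal_subgroupD(1)[OF assms(1)] assms(2,3)] by (simp add: FactGroup_def)

lemma coset_eq_iff:
  assumes "W \<in> ONS" "x \<in> carrier Q" "y \<in> carrier Q"
  shows "W #>\<^bsub>Q\<^esub> x = W #>\<^bsub>Q\<^esub> y \<longleftrightarrow> x \<in> W #>\<^bsub>Q\<^esub> y"
  using group.repr_independence[OF pgroups(3) _ assms(3) open_normal_subgroupD(3)[OF assms(1)]]
    group.rcos_self[OF pgroups(3) assms(2) open_normal_subgroupD(3)[OF assms(1)]] by metis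

lemma algebra_carrier:
  "carrier \<Lambda> = {r \<in> (\<Pi>\<^sub>E W\<in>ONS. cosets W \<rightarrow>\<^sub>E {0..<int p}).
     \<forall>V\<in>ONS. \<forall>W\<in>ONS. V \<subseteq> W \<longrightarrow> quotient_algebra_map p Q V W (r V) = r W}"
  unfolding completed_group_algebra_def by (simp add: Let_def group_algebra_def residue_carrier)

lemma algebra_memD:
  assumes "r \<in> carrier \<Lambda>" "W \<in> ONS"
  shows "r W \<in> cosets W \<rightarrow>\<^sub>E {0..<int p}"
    and "C \<in> cosets W \<Longrightarrow> 0 \<le> r W C" "C \<in> cosets W \<Longrightarrow> r W C < int p"
proof -
  show 1: "r W \<in> cosets W \<rightarrow>\<^sub>E {0..<int p}" using assms unfolding algebra_carrier by (auto simp: PiE_iff)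
  show "C \<in> cosets W \<Longrightarrow> 0 \<le> r W C" "C \<in> cosets W \<Longrightarrow> r W C < int p" using PiE_mem[OF 1] by fastforce+
qed

lemma algebra_compat:
  assumes "r \<in> carrier \<Lambda>" "V \<in> ONS" "W \<in> ONS" "V \<subseteq> W" "C \<in> cosets W"
  shows "r W C = (\<Sum>D\<in>{D \<in> cosets V. D \<subseteq> C}. r V D) mod int p"
proof -
  have "r W = quotient_algebra_map p Q V W (r V)" using assms(1-4) unfolding algebra_carrier by simp
  then have "r W C = (\<Oplus>\<^bsub>residue_ring (int p)\<^esub>D\<in>{D \<in> cosets V. D \<subseteq> C}. r V D)"
    using assms(5) by (simp add: quotient_algebra_map_def)
  also have "\<dots> = (\<Sum>D\<in>{D \<in> cosets V. D \<subseteq> C}. r V D) mod int p"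
    by (rule residue_ring_finsum[OF p_gt_1])
      (use finite_cosets[OF assms(2)] algebra_memD[OF assms(1,2)] in auto)
  finally show ?thesis .
qed

lemma algebra_add:
  assumes "W \<in> ONS" "C \<in> cosets W"
  shows "(r \<oplus>\<^bsub>\<Lambda>\<^esub> s) W C = (r W C + s W C) mod int p"
  using assms by (simp add: completed_group_algebra_def Let_def group_algebra_def residue_ring_def)

lemma algebra_zero:
  assumes "W \<in> ONS" "C \<in> cosets W" shows "\<zero>\<^bsub>\<Lambda>\<^esub> W C = 0"
  using assms by (simp add: completed_group_algebra_def Let_def group_algebra_def residue_ring_def)

lemma algebra_one:
  assumes "W \<in> ONS" "C \<in> cosets W" shows "\<one>\<^bsub>\<Lambda>\<^esub> W C = (if C = \<one>\<^bsub>Q Mod W\<^esub> then 1 else 0)"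
  using assms by (simp add: completed_group_algebra_def Let_def group_algebra_def residue_ring_def)

lemma algebra_mult:
  assumes r: "r \<in> carrier \<Lambda>" and s: "s \<in> carrier \<Lambda>" and W: "W \<in> ONS" and C: "C \<in> cosets W"
  shows "(r \<otimes>\<^bsub>\<Lambda>\<^esub> s) W C = (\<Sum>D\<in>cosets W. r W D * s W (inv\<^bsub>Q Mod W\<^esub> D \<otimes>\<^bsub>Q Mod W\<^esub> C)) mod int p"
proof -
  interpret G: group "Q Mod W" using group_quotient[OF W] .
  have "(r \<otimes>\<^bsub>\<Lambda>\<^esub> s) W C = (\<Oplus>\<^bsub>residue_ring (int p)\<^esub>D\<in>cosets W.
      (r W D * s W (inv\<^bsub>Q Mod W\<^esub> D \<otimes>\<^bsub>Q Mod W\<^esub> C)) mod int p)"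
    using W C by (simp add: completed_group_algebra_def Let_def group_algebra_def)
      (simp add: residue_ring_def)
  also have "\<dots> = (\<Sum>D\<in>cosets W. (r W D * s W (inv\<^bsub>Q Mod W\<^esub> D \<otimes>\<^bsub>Q Mod W\<^esub> C)) mod int p) mod int p"
    by (rule residue_ring_finsum[OF p_gt_1 finite_cosets[OF W]]) (use p_gt_1 in auto)
  also have "\<dots> = (\<Sum>D\<in>cosets W. r W D * s W (inv\<^bsub>Q Mod W\<^esub> D \<otimes>\<^bsub>Q Mod W\<^esub> C)) mod int p"
    by (rule mod_sum_eq)
  finally show ?thesis .
qed

lemma group_like_value:
  assumes "W \<in> ONS" "C \<in> cosets W"
  shows "group_like Q TQ q W C = (if C = W #>\<^bsub>Q\<^esub> q then 1 else 0)"
  using assms by (simp add: group_like_def)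

text \<open>This singles out the one term that can survive when the coefficients of a group-like
  element are summed over the cosets of \<open>V\<close> inside \<open>C\<close>.\<close>

lemma coset_subset_coset:
  assumes "V \<in> ONS" "W \<in> ONS" "V \<subseteq> W" "q \<in> carrier Q" "C \<in> cosets W"
  shows "V #>\<^bsub>Q\<^esub> q \<subseteq> C \<longleftrightarrow> C = W #>\<^bsub>Q\<^esub> q"
proof
  assume a: "V #>\<^bsub>Q\<^esub> q \<subseteq> C"
  have "q \<in> V #>\<^bsub>Q\<^esub> q"
    using group.rcos_self[OF pgroups(3) assms(4) open_normal_subgroupD(3)[OF assms(1)]] .
  with a have "q \<in> C" by blast
  moreover obtain x where "x \<in> carrier Q" "C = W #>\<^bsub>Q\<^esub> x" using coset_cases[OF assms(5)] .
  ultimately show "C = W #>\<^bsub>Q\<^esub> q" using coset_eq_iff[OF assms(2,4)] by metis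
next
  assume "C = W #>\<^bsub>Q\<^esub> q"
  then show "V #>\<^bsub>Q\<^esub> q \<subseteq> C" using assms(3) by (auto simp: r_coset_def)
qed

lemma group_like_closed:
  assumes q: "q \<in> carrier Q" shows "group_like Q TQ q \<in> carrier \<Lambda>"
proof -
  have "group_like Q TQ q \<in> (\<Pi>\<^sub>E W\<in>ONS. cosets W \<rightarrow>\<^sub>E {0..<int p})"
    using p_gt_1 by (auto simp: group_like_def)
  moreover have "quotient_algebra_map p Q V W (group_like Q TQ q V) = group_like Q TQ q W"
    if V: "V \<in> ONS" and W: "W \<in> ONS" and VW: "V \<subseteq> W" for V W
  proof (rule ext)
    fix C
    show "quotient_algebra_map p Q V W (group_like Q TQ q V) C = group_like Q TQ q W C"
    proof (cases "C \<in> cosets W")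
      case True
      let ?A = "{D \<in> cosets V. D \<subseteq> C}"
      have fin: "finite ?A" using finite_cosets[OF V] by simp
      have "quotient_algebra_map p Q V W (group_like Q TQ q V) C
          = (\<Oplus>\<^bsub>residue_ring (int p)\<^esub>D\<in>?A. group_like Q TQ q V D)"
        using True by (simp add: quotient_algebra_map_def)
      also have "\<dots> = (\<Sum>D\<in>?A. group_like Q TQ q V D) mod int p"
        by (rule residue_ring_finsum[OF p_gt_1 fin]) (use p_gt_1 group_like_value[OF V] in auto)
      also have "(\<Sum>D\<in>?A. group_like Q TQ q V D) = (\<Sum>D\<in>?A. if D = V #>\<^bsub>Q\<^esub> q then 1 else 0)"
        by (rule sum.cong) (auto simp: group_like_value[OF V])
      also have "\<dots> = (if V #>\<^bsub>Q\<^esub> q \<subseteq> C then 1 else 0)"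
        using fin coset_in[OF V q] by (simp add: sum.delta)
      also have "\<dots> = group_like Q TQ q W C"
        using coset_subset_coset[OF V W VW q True] group_like_value[OF W True] by auto
      finally show ?thesis using p_gt_1 group_like_value[OF W True] by auto
    qed (use W in \<open>simp add: quotient_algebra_map_def group_like_def\<close>)
  qed
  ultimately show ?thesis unfolding algebra_carrier by simp
qed

text \<open>Vanishing at level \<open>V\<close> is inherited by every coarser level. This is why the
  elements vanishing at one \<open>V\<close> can play the part of a basic neighbourhood of
  zero.\<close>

lemma algebra_zero_above:
  assumes "r \<in> carrier \<Lambda>" "V \<in> ONS" "W \<in> ONS" "V \<subseteq> W"
    and "\<And>D. D \<in> cosets V \<Longrightarrow> r V D = 0" and "C \<in> cosets W"
  shows "r W C = 0"
  using algebra_compat[OF assms(1-4,6)] assms(5) by simp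

text \<open>A continuous additive map is determined by its values on the group-like elements, since these
  span every finite quotient algebra.\<close>

lemma additive_vanishes:
  assumes ring: "ring \<Lambda>" and V: "V \<in> ONS"
    and add: "\<And>r s. r \<in> carrier \<Lambda> \<Longrightarrow> s \<in> carrier \<Lambda> \<Longrightarrow> [v (r \<oplus>\<^bsub>\<Lambda>\<^esub> s) = v r + v s] (mod int p)"
    and ker: "\<And>r. r \<in> carrier \<Lambda> \<Longrightarrow> (\<And>D. D \<in> cosets V \<Longrightarrow> r V D = 0) \<Longrightarrow> [v r = 0] (mod int p)"
    and gl: "\<And>q. q \<in> carrier Q \<Longrightarrow> [v (group_like Q TQ q) = 0] (mod int p)"
    and r: "r \<in> carrier \<Lambda>"
  shows "[v r = 0] (mod int p)"
proof -
  interpret R: ring \<Lambda> by (rule ring)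
  \<comment> \<open>Adding \<open>n\<close> copies of the group-like element of \<open>q\<close>
    leaves \<open>v\<close> unchanged modulo p and moves only the coordinate of level
    \<open>V\<close> at the coset of \<open>q\<close>.\<close>
  have shift: "\<exists>s\<in>carrier \<Lambda>. [v s = v r] (mod int p) \<and>
      (\<forall>D\<in>cosets V. s V D = (r V D + (if D = V #>\<^bsub>Q\<^esub> q then int n else 0)) mod int p)"
    if r: "r \<in> carrier \<Lambda>" and q: "q \<in> carrier Q" for r q n
  proof (induct n)
    case 0
    have "r V D = r V D mod int p" if "D \<in> cosets V" for D
      using algebra_memD(2,3)[OF r V that] by simp
    then show ?case using r by (intro bexI[of _ r]) auto
  next
    case (Suc n)
    then obtain s where s: "s \<in> carrier \<Lambda>" "[v s = v r] (mod int p)"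
      "\<And>D. D \<in> cosets V \<Longrightarrow> s V D = (r V D + (if D = V #>\<^bsub>Q\<^esub> q then int n else 0)) mod int p" by blast
    let ?g = "group_like Q TQ q"
    have g: "?g \<in> carrier \<Lambda>" using group_like_closed[OF q] .
    have "[v s + v ?g = v r + 0] (mod int p)" by (rule cong_add[OF s(2) gl[OF q]])
    then have "[v (s \<oplus>\<^bsub>\<Lambda>\<^esub> ?g) = v r + 0] (mod int p)" by (rule cong_trans[OF add[OF s(1) g]])
    moreover have "(s \<oplus>\<^bsub>\<Lambda>\<^esub> ?g) V D = (r V D + (if D = V #>\<^bsub>Q\<^esub> q then int (Suc n) else 0)) mod int p"
      if D: "D \<in> cosets V" for D
      unfolding algebra_add[OF V D] s(3)[OF D] group_like_value[OF V D]
      by (simp add: mod_simps algebra_simps)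
    ultimately show ?case using s(1) g by (intro bexI[of _ "s \<oplus>\<^bsub>\<Lambda>\<^esub> ?g"]) auto
  qed
  \<comment> \<open>Induction on a set \<open>A\<close> of cosets outside which \<open>r\<close>
    vanishes at level \<open>V\<close>.\<close>
  have "\<forall>r\<in>carrier \<Lambda>. (\<forall>D\<in>cosets V - A. r V D = 0) \<longrightarrow> [v r = 0] (mod int p)"
    if "finite A" "A \<subseteq> cosets V" for A
    using that
  proof (induct A)
    case empty
    then show ?case using ker by simp
  next
    case (insert C A)
    show ?case
    proof (intro ballI impI)
      fix r assume r: "r \<in> carrier \<Lambda>" and z: "\<forall>D\<in>cosets V - insert C A. r V D = 0"
      obtain q where q: "q \<in> carrier Q" "C = V #>\<^bsub>Q\<^esub> q" using coset_cases[of C V] insert by blast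
      have rC: "0 \<le> r V C" "r V C < int p" using algebra_memD(2,3)[OF r V] insert by auto
      \<comment> \<open>\<open>p - r V C\<close> copies cancel the coordinate at \<open>C\<close>; a
        zero coordinate receives p copies and stays zero.\<close>
      obtain s where s: "s \<in> carrier \<Lambda>" "[v s = v r] (mod int p)"
        "\<And>D. D \<in> cosets V \<Longrightarrow> s V D = (r V D + (if D = C then int (nat (int p - r V C)) else 0)) mod int p"
        using shift[OF r q(1), of "nat (int p - r V C)"] q(2) by blast
      have "s V D = 0" if "D \<in> cosets V - A" for D
        using s(3)[of D] that z rC by (cases "D = C") auto
      then have "[v s = 0] (mod int p)" using insert s(1) by blast
      then show "[v r = 0] (mod int p)" using s(2) cong_trans cong_sym by blast
    qed
  qed
  from this[OF finite_cosets[OF V] order_refl] show ?thesis using r by simp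
qed

section \<open>The topology of the completed group algebra\<close>

lemma topspace_algebra: "topspace T\<Lambda> = carrier \<Lambda>"
  unfolding completed_group_algebra_topology_def
  by (auto simp: algebra_carrier group_algebra_def residue_carrier)

lemma openin_algebra_coordinate:
  assumes W: "W \<in> ONS" shows "openin T\<Lambda> {r \<in> carrier \<Lambda>. r W = f}"
proof -
  let ?A = "Fp_quotient_algebra p Q"
  let ?T = "product_topology (\<lambda>W. discrete_topology (carrier (?A W))) ONS"
  have c: "continuous_map T\<Lambda> (discrete_topology (carrier (?A W))) (\<lambda>r. r W)"
    unfolding completed_group_algebra_topology_def
    by (intro continuous_map_from_subtopology continuous_map_product_projection W)
  \<comment> \<open>An arbitrary \<open>f\<close> need not lie in the finite ring; intersecting with
    its carrier gives an open set of the discrete factor.\<close>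
  have "openin T\<Lambda> {r \<in> topspace T\<Lambda>. r W \<in> {f} \<inter> carrier (?A W)}"
    by (rule openin_continuous_map_preimage[OF c]) simp
  moreover have cW: "r W \<in> carrier (?A W)" if "r \<in> carrier \<Lambda>" for r
    using algebra_memD(1)[OF that W] by (simp add: group_algebra_def residue_carrier)
  moreover have "{r \<in> topspace T\<Lambda>. r W \<in> {f} \<inter> carrier (?A W)} = {r \<in> carrier \<Lambda>. r W = f}"
    unfolding topspace_algebra using cW by blast
  ultimately show ?thesis by simp
qed

text \<open>A basic neighbourhood of zero constrains finitely many coordinates. Any \<open>V\<close>
  contained in all these levels and in \<open>W\<close> works: vanishing at \<open>V\<close> forces
  the constrained coordinates to vanish.\<close>

lemma open_nhd_zero_algebra:
  assumes U: "openin T\<Lambda> U" "\<zero>\<^bsub>\<Lambda>\<^esub> \<in> U" and W: "W \<in> ONS"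
  obtains V where "V \<in> ONS" "V \<subseteq> W"
    "\<And>r. r \<in> carrier \<Lambda> \<Longrightarrow> (\<And>D. D \<in> cosets V \<Longrightarrow> r V D = 0) \<Longrightarrow> r \<in> U"
proof -
  let ?X = "\<lambda>W. discrete_topology (carrier (Fp_quotient_algebra p Q W))"
  obtain U' where U': "openin (product_topology ?X ONS) U'" "U = U' \<inter> carrier \<Lambda>"
    using U(1) unfolding completed_group_algebra_topology_def openin_subtopology by blast
  then have z: "\<zero>\<^bsub>\<Lambda>\<^esub> \<in> U'" using U(2) by blast
  from bspec[OF U'(1)[unfolded openin_product_topology_alt] z]
  obtain B where B: "finite {i \<in> ONS. B i \<noteq> topspace (?X i)}"
    "\<zero>\<^bsub>\<Lambda>\<^esub> \<in> Pi\<^sub>E ONS B" "Pi\<^sub>E ONS B \<subseteq> U'"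
    by (elim exE conjE) (rule that)
  let ?F = "{i \<in> ONS. B i \<noteq> topspace (?X i)}"
  obtain V where V: "V \<in> ONS" "\<forall>Z \<in> insert W ?F. V \<subseteq> Z"
    using open_normal_Inter[OF pgroups(2), of "insert W ?F"] B(1) W by auto
  have "r \<in> U" if r: "r \<in> carrier \<Lambda>" and z: "\<And>D. D \<in> cosets V \<Longrightarrow> r V D = 0" for r
  proof -
    have "r i \<in> B i" if i: "i \<in> ONS" for i
    proof (cases "i \<in> ?F")
      case True
      have "r i = \<zero>\<^bsub>\<Lambda>\<^esub> i"
      proof (rule ext)
        fix C
        show "r i C = \<zero>\<^bsub>\<Lambda>\<^esub> i C"
        proof (cases "C \<in> cosets i")
          case T: True
          then show ?thesis using algebra_zero_above[OF r V(1) i _ z T] V(2) True algebra_zero[OF i T] by auto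
        next
          case False
          then show ?thesis using algebra_memD(1)[OF r i] i
            by (auto simp: PiE_iff extensional_def completed_group_algebra_def Let_def group_algebra_def)
        qed
      qed
      then show ?thesis using B(2) i by (auto simp: PiE_iff)
    next
      case False
      then have "B i = carrier (Fp_quotient_algebra p Q i)" using i by simp
      then show ?thesis using algebra_memD(1)[OF r i] by (simp add: group_algebra_def residue_carrier)
    qed
    moreover have "r \<in> extensional ONS" using r by (auto simp: algebra_carrier PiE_iff)
    ultimately have "r \<in> Pi\<^sub>E ONS B" by (auto simp: PiE_iff)
    then show ?thesis using B(3) U'(2) r by blast
  qed
  then show thesis using that V by blast
qed

end

section \<open>Characters modulo p\<close>

text \<open>A continuous homomorphism to Z/p is represented by any integer-valued lift, with
  openness of the kernel in place of continuity. The integer values serve both as exponents of a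
  central element of order p and as entries in the echelon argument.\<close>

definition fp_chars :: "nat \<Rightarrow> ('a, 'm) monoid_scheme \<Rightarrow> 'a topology \<Rightarrow> ('a \<Rightarrow> int) set" where
  "fp_chars p N T = {e. (\<forall>m\<in>carrier N. \<forall>n\<in>carrier N. [e (m \<otimes>\<^bsub>N\<^esub> n) = e m + e n] (mod int p))
     \<and> openin T {n \<in> carrier N. [e n = 0] (mod int p)}}"

lemma fp_charsD:
  assumes "e \<in> fp_chars p N T"
  shows "m \<in> carrier N \<Longrightarrow> n \<in> carrier N \<Longrightarrow> [e (m \<otimes>\<^bsub>N\<^esub> n) = e m + e n] (mod int p)"
    "openin T {n \<in> carrier N. [e n = 0] (mod int p)}"
  using assms by (auto simp: fp_chars_def)

lemma fp_char_hom:
  assumes "p > 0" "e \<in> fp_chars p N T"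
  shows "(\<lambda>n. e n mod int p) \<in> hom N (integer_mod_group p)"
proof -
  have "e (m \<otimes>\<^bsub>N\<^esub> n) mod int p = (e m mod int p + e n mod int p) mod int p"
    if "m \<in> carrier N" "n \<in> carrier N" for m n
    using fp_charsD(1)[OF assms(2) that] by (simp add: cong_def mod_add_eq)
  then show ?thesis using assms(1) by (auto simp: hom_def carrier_integer_mod_group)
qed

lemma fp_char_continuous:
  assumes "p > 0" "topological_group N T" "e \<in> fp_chars p N T"
  shows "continuous_hom N T (integer_mod_group p) (discrete_on (integer_mod_group p)) (\<lambda>n. e n mod int p)"
  using continuous_hom_discrete_iff[OF assms(2) group_integer_mod_group] fp_char_hom[OF assms(1,3)]
    fp_charsD(2)[OF assms(3)] by (simp add: cong_def)

lemma fp_char_kernel: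
  assumes p: "p > 0" and N: "topological_group N T" and e: "e \<in> fp_chars p N T"
  shows "subgroup {n \<in> carrier N. [e n = 0] (mod int p)} N"
    "closedin T {n \<in> carrier N. [e n = 0] (mod int p)}"
proof -
  interpret N: group N using topological_groupD[OF N] by simp
  interpret Z: group "integer_mod_group p" by simp
  interpret group_hom N "integer_mod_group p" "\<lambda>n. e n mod int p"
    by unfold_locales (rule fp_char_hom[OF p e])
  have eq: "{n \<in> carrier N. [e n = 0] (mod int p)} = kernel N (integer_mod_group p) (\<lambda>n. e n mod int p)"
    by (simp add: kernel_def cong_def)
  show "subgroup {n \<in> carrier N. [e n = 0] (mod int p)} N" unfolding eq by (rule subgroup_kernel)
  have "continuous_map T (discrete_on (integer_mod_group p)) (\<lambda>n. e n mod int p)"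
    using fp_char_continuous[OF assms] by (simp add: continuous_hom_def)
  from closedin_continuous_map_preimage[OF this, of "{0}"]
  show "closedin T {n \<in> carrier N. [e n = 0] (mod int p)}"
    using p topological_groupD(2)[OF N] by (simp add: carrier_integer_mod_group cong_def)
qed

text \<open>Normality of the derived subgroup makes the set product a subgroup before the closure is
  taken.\<close>

lemma frattini_subgroup:
  assumes N: "topological_group N T"
  shows "subgroup (frattini p N T) N"
proof -
  interpret N: group N using topological_groupD[OF N] by simp
  let ?P = "generate N {x [^]\<^bsub>N\<^esub> p | x. x \<in> carrier N}"
  have P: "subgroup ?P N" by (rule N.generate_is_subgroup) auto
  have D: "derived N (carrier N) \<lhd> N" by (rule N.derived_self_is_normal)
  have "second_isomorphism_grp (derived N (carrier N)) N ?P"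
    using P D by (simp add: second_isomorphism_grp_def second_isomorphism_grp_axioms_def)
  then have "subgroup (derived N (carrier N) <#>\<^bsub>N\<^esub> ?P) N"
    by (rule second_isomorphism_grp.normal_set_mult_subgroup)
  moreover have "derived N (carrier N) <#>\<^bsub>N\<^esub> ?P = ?P <#>\<^bsub>N\<^esub> derived N (carrier N)"
    using N.commut_normal[OF P D] by simp
  ultimately show ?thesis unfolding frattini_def using closure_of_subgroup[OF N] by simp
qed

text \<open>The kernel of a character is a closed subgroup containing all p-th powers and
  commutators. Characters of \<open>N\<close> thus descend to the Frattini quotient, which is where
  projectivity is available.\<close>

lemma fp_char_frattini:
  assumes p: "p > 0" and N: "topological_group N T" and e: "e \<in> fp_chars p N T"
    and n: "n \<in> frattini p N T"
  shows "[e n = 0] (mod int p)"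
proof -
  interpret N: group N using topological_groupD[OF N] by simp
  interpret Z: group "integer_mod_group p" by simp
  interpret group_hom N "integer_mod_group p" "\<lambda>n. e n mod int p"
    by unfold_locales (rule fp_char_hom[OF p e])
  let ?K = "{n \<in> carrier N. [e n = 0] (mod int p)}"
  note K = fp_char_kernel[OF p N e]
  have pow: "e (x [^]\<^bsub>N\<^esub> k) mod int p = (int k * e x) mod int p" if x: "x \<in> carrier N" for x and k :: nat
  proof (induct k)
    case 0
    then show ?case using hom_one by (simp)
  next
    case (Suc k)
    have "e (x [^]\<^bsub>N\<^esub> Suc k) mod int p = (e (x [^]\<^bsub>N\<^esub> k) mod int p + e x) mod int p"
      using fp_charsD(1)[OF e, of "x [^]\<^bsub>N\<^esub> k" x] x by (simp add: cong_def mod_simps)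
    also have "\<dots> = (int (Suc k) * e x) mod int p"
      unfolding Suc by (simp add: mod_simps algebra_simps)
    finally show ?case .
  qed
  have "x [^]\<^bsub>N\<^esub> p \<in> ?K" if "x \<in> carrier N" for x using pow[OF that, of p] that by (simp add: cong_def)
  then have 1: "generate N {x [^]\<^bsub>N\<^esub> p | x. x \<in> carrier N} \<subseteq> ?K"
    by (intro N.generate_subgroup_incl K) auto
  have "x \<otimes>\<^bsub>N\<^esub> y \<otimes>\<^bsub>N\<^esub> inv\<^bsub>N\<^esub> x \<otimes>\<^bsub>N\<^esub> inv\<^bsub>N\<^esub> y \<in> ?K" if x: "x \<in> carrier N" and y: "y \<in> carrier N" for x y
  proof -
    have inv: "[e (inv\<^bsub>N\<^esub> z) = - e z] (mod int p)" if "z \<in> carrier N" for z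
    proof -
      have "[e (\<one>\<^bsub>N\<^esub>) = e z + e (inv\<^bsub>N\<^esub> z)] (mod int p)" using fp_charsD(1)[OF e that, of "inv\<^bsub>N\<^esub> z"] that by simp
      moreover have "[e (\<one>\<^bsub>N\<^esub>) = 0] (mod int p)" using hom_one by (simp add: cong_def)
      ultimately have "[e z + e (inv\<^bsub>N\<^esub> z) = 0] (mod int p)" using cong_trans cong_sym by blast
      then show ?thesis by (simp add: cong_iff_dvd_diff add.commute)
    qed
    have "[e (x \<otimes>\<^bsub>N\<^esub> y \<otimes>\<^bsub>N\<^esub> inv\<^bsub>N\<^esub> x \<otimes>\<^bsub>N\<^esub> inv\<^bsub>N\<^esub> y) = e x + e y + - e x + - e y] (mod int p)"
      using x y
      by (intro cong_trans[OF fp_charsD(1)[OF e]] cong_add fp_charsD(1)[OF e] inv) auto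
    then show ?thesis using x y by simp
  qed
  then have "derived N (carrier N) \<subseteq> ?K"
    unfolding derived_def by (intro N.generate_subgroup_incl K) blast
  then have "generate N {x [^]\<^bsub>N\<^esub> p | x. x \<in> carrier N} <#>\<^bsub>N\<^esub> derived N (carrier N) \<subseteq> ?K"
    using 1 subgroup.m_closed[OF K(1)] unfolding set_mult_def by blast
  then have "frattini p N T \<subseteq> ?K" unfolding frattini_def by (rule closure_of_minimal) (rule K)
  then show ?thesis using n by blast
qed

section \<open>Modules of functions on finite quotients\<close>

text \<open>The elements are functions \<open>F\<close> on \<open>Q/W \<times> Q/W\<close> with values modulo p, on which \<open>q\<close> acts by
  \<open>(q F)(y, D) = F(y, D q)\<close>. The encoding places them on a type of test objects.\<close>

definition encode :: "'r \<Rightarrow> ('r + 'm) test" where "encode F = {{Inr (Inl F)}}"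
definition decode :: "('r + 'm) test \<Rightarrow> 'r" where "decode x = (THE F. x = encode F)"

lemma decode_encode [simp]: "decode (encode F) = F"
  by (simp add: decode_def encode_def)

lemma encode_inject [simp]: "encode F = encode G \<longleftrightarrow> F = G"
  by (metis decode_encode)

context pro_p_algebra
begin

text \<open>The action leaves \<open>y\<close> alone. This extra variable lets one function space
  contain both test modules: functions of \<open>D\<close> only, and their differences indexed by
  \<open>y\<close>.\<close>

definition cfun :: "'q set \<Rightarrow> ('q set \<Rightarrow> 'q set \<Rightarrow> int) set" where
  "cfun W = cosets W \<rightarrow>\<^sub>E cosets W \<rightarrow>\<^sub>E {0..<int p}"

definition cadd :: "'q set \<Rightarrow> ('q set \<Rightarrow> 'q set \<Rightarrow> int) \<Rightarrow> ('q set \<Rightarrow> 'q set \<Rightarrow> int) \<Rightarrow> ('q set \<Rightarrow> 'q set \<Rightarrow> int)" where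
  "cadd W F G = (\<lambda>y\<in>cosets W. \<lambda>D\<in>cosets W. (F y D + G y D) mod int p)"

definition cscale :: "'q set \<Rightarrow> ('q set \<Rightarrow> 'q set \<Rightarrow> int) \<Rightarrow> ('q set \<Rightarrow> 'q set \<Rightarrow> int) \<Rightarrow> ('q set \<Rightarrow> 'q set \<Rightarrow> int)" where
  "cscale W r F = (\<lambda>y\<in>cosets W. \<lambda>D\<in>cosets W. (\<Sum>C\<in>cosets W. r W C * F y (D \<otimes>\<^bsub>Q Mod W\<^esub> C)) mod int p)"

definition czero :: "'q set \<Rightarrow> ('q set \<Rightarrow> 'q set \<Rightarrow> int)" where
  "czero W = (\<lambda>y\<in>cosets W. \<lambda>D\<in>cosets W. 0)"

definition csub :: "'q set \<Rightarrow> ('q set \<Rightarrow> 'q set \<Rightarrow> int) set \<Rightarrow> bool" where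
  "csub W K \<longleftrightarrow> K \<subseteq> cfun W \<and> czero W \<in> K \<and> (\<forall>F\<in>K. \<forall>G\<in>K. cadd W F G \<in> K) \<and>
     (\<forall>F\<in>K. \<exists>G\<in>K. cadd W G F = czero W) \<and> (\<forall>r\<in>carrier \<Lambda>. \<forall>F\<in>K. cscale W r F \<in> K)"

definition cmodule :: "'q set \<Rightarrow> ('q set \<Rightarrow> 'q set \<Rightarrow> int) set \<Rightarrow>
    ('q set \<Rightarrow> 'q set \<Rightarrow> int, (('q set \<Rightarrow> 'q set \<Rightarrow> int) + 'm) test) module" where
  "cmodule W K = \<lparr>carrier = encode ` K, monoid.mult = undefined, one = undefined, zero = encode (czero W),
     add = (\<lambda>x y. encode (cadd W (decode x) (decode y))), smult = (\<lambda>r x. encode (cscale W r (decode x)))\<rparr>"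

lemma cmodule_simps [simp]:
  "carrier (cmodule W K) = encode ` K" "\<zero>\<^bsub>cmodule W K\<^esub> = encode (czero W)"
  "encode F \<oplus>\<^bsub>cmodule W K\<^esub> encode G = encode (cadd W F G)"
  "r \<odot>\<^bsub>cmodule W K\<^esub> encode F = encode (cscale W r F)"
  by (simp_all add: cmodule_def)

lemma cfunD:
  assumes "F \<in> cfun W" "y \<in> cosets W" "D \<in> cosets W"
  shows "0 \<le> F y D" "F y D < int p" "F y D mod int p = F y D"
proof -
  have "F y \<in> cosets W \<rightarrow>\<^sub>E {0..<int p}" using assms(1,2) unfolding cfun_def by (rule PiE_mem)
  then have "F y D \<in> {0..<int p}" using assms(3) by (rule PiE_mem)
  then show "0 \<le> F y D" "F y D < int p" "F y D mod int p = F y D" by auto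
qed

lemma cfun_eqI:
  assumes "F \<in> cfun W" "G \<in> cfun W" "\<And>y D. y \<in> cosets W \<Longrightarrow> D \<in> cosets W \<Longrightarrow> F y D = G y D"
  shows "F = G"
proof (rule PiE_ext)
  show F: "F \<in> cosets W \<rightarrow>\<^sub>E cosets W \<rightarrow>\<^sub>E {0..<int p}" and G: "G \<in> cosets W \<rightarrow>\<^sub>E cosets W \<rightarrow>\<^sub>E {0..<int p}"
    using assms by (auto simp: cfun_def)
  fix y assume y: "y \<in> cosets W"
  show "F y = G y" by (rule PiE_ext[OF PiE_mem[OF F y] PiE_mem[OF G y]]) (rule assms(3)[OF y])
qed

lemma cfun_closed:
  "cadd W F G \<in> cfun W" "cscale W r F \<in> cfun W" "czero W \<in> cfun W"
  using p_gt_1 by (auto simp: cfun_def cadd_def cscale_def czero_def)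

lemma cvalues:
  assumes "y \<in> cosets W" "D \<in> cosets W"
  shows "cadd W F G y D = (F y D + G y D) mod int p"
    "cscale W r F y D = (\<Sum>C\<in>cosets W. r W C * F y (D \<otimes>\<^bsub>Q Mod W\<^esub> C)) mod int p"
    "czero W y D = 0"
  using assms by (simp_all add: cadd_def cscale_def czero_def)

lemma coset_op_closed:
  assumes "W \<in> ONS"
  shows "\<And>D C. D \<in> cosets W \<Longrightarrow> C \<in> cosets W \<Longrightarrow> D \<otimes>\<^bsub>Q Mod W\<^esub> C \<in> cosets W"
  by (rule monoid.m_closed[OF group.is_monoid[OF group_quotient[OF assms]]])

lemma cscale_cadd:
  assumes W: "W \<in> ONS"
  shows "cscale W r (cadd W F G) = cadd W (cscale W r F) (cscale W r G)"
proof (rule cfun_eqI[OF cfun_closed(2,1)])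
  fix y D assume y: "y \<in> cosets W" "D \<in> cosets W"
  note cl = coset_op_closed[OF W y(2)]
  have "cscale W r (cadd W F G) y D
      = (\<Sum>C\<in>cosets W. r W C * ((F y (D \<otimes>\<^bsub>Q Mod W\<^esub> C) + G y (D \<otimes>\<^bsub>Q Mod W\<^esub> C)) mod int p)) mod int p"
    unfolding cvalues[OF y] by (intro arg_cong[of _ _ "\<lambda>x. x mod int p"] sum.cong) (simp_all add: cvalues[OF y(1) cl] del: mult_FactGroup)
  also have "\<dots> = (\<Sum>C\<in>cosets W. r W C * (F y (D \<otimes>\<^bsub>Q Mod W\<^esub> C) + G y (D \<otimes>\<^bsub>Q Mod W\<^esub> C))) mod int p"
    unfolding cong_def[symmetric] by (intro cong_sum cong_mult) (auto simp: cong_def)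
  also have "\<dots> = cadd W (cscale W r F) (cscale W r G) y D"
    unfolding cvalues[OF y] by (simp add: sum.distrib algebra_simps mod_add_eq)
  finally show "cscale W r (cadd W F G) y D = cadd W (cscale W r F) (cscale W r G) y D" .
qed

lemma cscale_add:
  assumes W: "W \<in> ONS"
  shows "cscale W (r \<oplus>\<^bsub>\<Lambda>\<^esub> s) F = cadd W (cscale W r F) (cscale W s F)"
proof (rule cfun_eqI[OF cfun_closed(2,1)])
  fix y D assume y: "y \<in> cosets W" "D \<in> cosets W"
  have "cscale W (r \<oplus>\<^bsub>\<Lambda>\<^esub> s) F y D
      = (\<Sum>C\<in>cosets W. ((r W C + s W C) mod int p) * F y (D \<otimes>\<^bsub>Q Mod W\<^esub> C)) mod int p"
    unfolding cvalues[OF y] by (intro arg_cong[of _ _ "\<lambda>x. x mod int p"] sum.cong) (simp_all add: algebra_add[OF W])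
  also have "\<dots> = (\<Sum>C\<in>cosets W. (r W C + s W C) * F y (D \<otimes>\<^bsub>Q Mod W\<^esub> C)) mod int p"
    unfolding cong_def[symmetric] by (intro cong_sum cong_mult) (auto simp: cong_def)
  also have "\<dots> = cadd W (cscale W r F) (cscale W s F) y D"
    unfolding cvalues[OF y] by (simp add: sum.distrib algebra_simps mod_add_eq)
  finally show "cscale W (r \<oplus>\<^bsub>\<Lambda>\<^esub> s) F y D = cadd W (cscale W r F) (cscale W s F) y D" .
qed

lemma cscale_mult:
  assumes W: "W \<in> ONS" and r: "r \<in> carrier \<Lambda>" and s: "s \<in> carrier \<Lambda>"
  shows "cscale W (r \<otimes>\<^bsub>\<Lambda>\<^esub> s) F = cscale W r (cscale W s F)"
proof (rule cfun_eqI[OF cfun_closed(2,2)])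
  fix y D assume y: "y \<in> cosets W" "D \<in> cosets W"
  interpret P: group "Q Mod W" using group_quotient[OF W] .
  let ?f = "\<lambda>C. F y (D \<otimes>\<^bsub>Q Mod W\<^esub> C)"
  have "cscale W (r \<otimes>\<^bsub>\<Lambda>\<^esub> s) F y D = (\<Sum>C\<in>cosets W.
      ((\<Sum>E\<in>cosets W. r W E * s W (inv\<^bsub>Q Mod W\<^esub> E \<otimes>\<^bsub>Q Mod W\<^esub> C)) mod int p) * ?f C) mod int p"
    unfolding cvalues[OF y]
    by (intro arg_cong[of _ _ "\<lambda>x. x mod int p"] sum.cong) (simp_all add: algebra_mult[OF r s W])
  also have "\<dots> = (\<Sum>C\<in>cosets W. (\<Sum>E\<in>cosets W. r W E * s W (inv\<^bsub>Q Mod W\<^esub> E \<otimes>\<^bsub>Q Mod W\<^esub> C)) * ?f C) mod int p"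
    unfolding cong_def[symmetric] by (intro cong_sum cong_mult) (auto simp: cong_def)
  also have "(\<Sum>C\<in>cosets W. (\<Sum>E\<in>cosets W. r W E * s W (inv\<^bsub>Q Mod W\<^esub> E \<otimes>\<^bsub>Q Mod W\<^esub> C)) * ?f C)
      = (\<Sum>E\<in>cosets W. \<Sum>C\<in>cosets W. r W E * s W (inv\<^bsub>Q Mod W\<^esub> E \<otimes>\<^bsub>Q Mod W\<^esub> C) * ?f C)"
    unfolding sum_distrib_right by (rule sum.swap)
  also have "\<dots> = (\<Sum>E\<in>cosets W. r W E * (\<Sum>C\<in>cosets W. s W C * F y ((D \<otimes>\<^bsub>Q Mod W\<^esub> E) \<otimes>\<^bsub>Q Mod W\<^esub> C)))"
  proof (rule sum.cong[OF refl])
    fix E assume E: "E \<in> cosets W"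
    \<comment> \<open>Substituting \<open>E\<close> times \<open>C\<close> for \<open>C\<close>
      turns the convolution into two successive translations.\<close>
    have "(\<Sum>C\<in>cosets W. r W E * s W (inv\<^bsub>Q Mod W\<^esub> E \<otimes>\<^bsub>Q Mod W\<^esub> C) * ?f C)
        = (\<Sum>C\<in>cosets W. r W E * s W C * F y ((D \<otimes>\<^bsub>Q Mod W\<^esub> E) \<otimes>\<^bsub>Q Mod W\<^esub> C))"
    proof (rule sum.reindex_bij_witness[of _ "\<lambda>C. E \<otimes>\<^bsub>Q Mod W\<^esub> C" "\<lambda>C. inv\<^bsub>Q Mod W\<^esub> E \<otimes>\<^bsub>Q Mod W\<^esub> C"])
      fix C assume C: "C \<in> cosets W"
      show 1: "E \<otimes>\<^bsub>Q Mod W\<^esub> (inv\<^bsub>Q Mod W\<^esub> E \<otimes>\<^bsub>Q Mod W\<^esub> C) = C"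
        using E C by (metis P.inv_closed P.l_one P.m_assoc P.r_inv)
      show "inv\<^bsub>Q Mod W\<^esub> E \<otimes>\<^bsub>Q Mod W\<^esub> (E \<otimes>\<^bsub>Q Mod W\<^esub> C) = C"
        using E C by (metis P.inv_closed P.l_one P.m_assoc P.l_inv)
      show "inv\<^bsub>Q Mod W\<^esub> E \<otimes>\<^bsub>Q Mod W\<^esub> C \<in> cosets W" "E \<otimes>\<^bsub>Q Mod W\<^esub> C \<in> cosets W"
        using E C by (meson P.inv_closed P.m_closed)+
      have "(D \<otimes>\<^bsub>Q Mod W\<^esub> E) \<otimes>\<^bsub>Q Mod W\<^esub> (inv\<^bsub>Q Mod W\<^esub> E \<otimes>\<^bsub>Q Mod W\<^esub> C) = D \<otimes>\<^bsub>Q Mod W\<^esub> C"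
        using P.m_assoc[OF y(2) E, of "inv\<^bsub>Q Mod W\<^esub> E \<otimes>\<^bsub>Q Mod W\<^esub> C"] E C 1
        by (metis P.inv_closed P.m_closed)
      then show "r W E * s W (inv\<^bsub>Q Mod W\<^esub> E \<otimes>\<^bsub>Q Mod W\<^esub> C)
          * F y ((D \<otimes>\<^bsub>Q Mod W\<^esub> E) \<otimes>\<^bsub>Q Mod W\<^esub> (inv\<^bsub>Q Mod W\<^esub> E \<otimes>\<^bsub>Q Mod W\<^esub> C))
        = r W E * s W (inv\<^bsub>Q Mod W\<^esub> E \<otimes>\<^bsub>Q Mod W\<^esub> C) * ?f C" by simp
    qed
    then show "(\<Sum>C\<in>cosets W. r W E * s W (inv\<^bsub>Q Mod W\<^esub> E \<otimes>\<^bsub>Q Mod W\<^esub> C) * ?f C)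
        = r W E * (\<Sum>C\<in>cosets W. s W C * F y ((D \<otimes>\<^bsub>Q Mod W\<^esub> E) \<otimes>\<^bsub>Q Mod W\<^esub> C))"
      by (simp add: sum_distrib_left mult.assoc)
  qed
  also have "\<dots> mod int p = (\<Sum>E\<in>cosets W. r W E *
      ((\<Sum>C\<in>cosets W. s W C * F y ((D \<otimes>\<^bsub>Q Mod W\<^esub> E) \<otimes>\<^bsub>Q Mod W\<^esub> C)) mod int p)) mod int p"
    unfolding cong_def[symmetric] by (intro cong_sum cong_mult) (auto simp: cong_def)
  also have "\<dots> = cscale W r (cscale W s F) y D"
    unfolding cvalues[OF y]
    by (intro arg_cong[of _ _ "\<lambda>x. x mod int p"] sum.cong)
      (simp_all add: cvalues[OF y(1) coset_op_closed[OF W y(2)]] del: mult_FactGroup)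
  finally show "cscale W (r \<otimes>\<^bsub>\<Lambda>\<^esub> s) F y D = cscale W r (cscale W s F) y D" .
qed

text \<open>Only the term of the coset of \<open>q\<close> survives, so group-like scalars act by
  pure translation; equivariance under \<open>Q\<close> can be expressed through scalars.\<close>

lemma cscale_group_like:
  assumes W: "W \<in> ONS" and q: "q \<in> carrier Q" and F: "F \<in> cfun W" and y: "y \<in> cosets W" "D \<in> cosets W"
  shows "cscale W (group_like Q TQ q) F y D = F y (D \<otimes>\<^bsub>Q Mod W\<^esub> (W #>\<^bsub>Q\<^esub> q))"
proof -
  have "(\<Sum>C\<in>cosets W. group_like Q TQ q W C * F y (D \<otimes>\<^bsub>Q Mod W\<^esub> C))
      = (\<Sum>C\<in>cosets W. if C = W #>\<^bsub>Q\<^esub> q then F y (D \<otimes>\<^bsub>Q Mod W\<^esub> C) else 0)"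
    by (rule sum.cong) (auto simp: group_like_value[OF W])
  also have "\<dots> = F y (D \<otimes>\<^bsub>Q Mod W\<^esub> (W #>\<^bsub>Q\<^esub> q))"
    using finite_cosets[OF W] coset_in[OF W q] by simp
  finally show ?thesis
    unfolding cvalues[OF y] using cfunD(3)[OF F y(1) coset_op_closed[OF W y(2) coset_in[OF W q]]] by simp
qed

lemma cscale_one:
  assumes W: "W \<in> ONS" and F: "F \<in> cfun W"
  shows "cscale W \<one>\<^bsub>\<Lambda>\<^esub> F = F"
proof (rule cfun_eqI[OF cfun_closed(2) F])
  fix y D assume y: "y \<in> cosets W" "D \<in> cosets W"
  interpret P: group "Q Mod W" using group_quotient[OF W] .
  have "(\<Sum>C\<in>cosets W. \<one>\<^bsub>\<Lambda>\<^esub> W C * F y (D \<otimes>\<^bsub>Q Mod W\<^esub> C))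
      = (\<Sum>C\<in>cosets W. if C = \<one>\<^bsub>Q Mod W\<^esub> then F y (D \<otimes>\<^bsub>Q Mod W\<^esub> C) else 0)"
    by (rule sum.cong) (auto simp: algebra_one[OF W])
  also have "\<dots> = F y D" using finite_cosets[OF W] P.one_closed P.r_one[OF y(2)] by simp
  finally show "cscale W \<one>\<^bsub>\<Lambda>\<^esub> F y D = F y D" unfolding cvalues[OF y] using cfunD(3)[OF F y] by simp
qed

lemma cmodule_left_module:
  assumes ring: "ring \<Lambda>" and W: "W \<in> ONS" and K: "csub W K"
  shows "left_module \<Lambda> (cmodule W K :: ('q set \<Rightarrow> 'q set \<Rightarrow> int, (('q set \<Rightarrow> 'q set \<Rightarrow> int) + 'm) test) module)"
proof -
  let ?M = "cmodule W K :: ('q set \<Rightarrow> 'q set \<Rightarrow> int, (('q set \<Rightarrow> 'q set \<Rightarrow> int) + 'm) test) module"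
  note K' = K[unfolded csub_def]
  have Kc: "F \<in> cfun W" if "F \<in> K" for F using K' that by blast
  have ab: "abelian_group ?M"
  proof (rule abelian_groupI)
    fix a b c assume "a \<in> carrier ?M" "b \<in> carrier ?M" "c \<in> carrier ?M"
    then obtain F G H where F: "a = encode F" "F \<in> K" and G: "b = encode G" "G \<in> K" and H: "c = encode H" "H \<in> K"
      by auto
    have "cadd W (cadd W F G) H = cadd W F (cadd W G H)"
      by (rule cfun_eqI[OF cfun_closed(1,1)]) (simp add: cvalues mod_simps add.assoc)
    then show "a \<oplus>\<^bsub>?M\<^esub> b \<oplus>\<^bsub>?M\<^esub> c = a \<oplus>\<^bsub>?M\<^esub> (b \<oplus>\<^bsub>?M\<^esub> c)"
      by (simp add: F G H)
  next
    fix a b assume "a \<in> carrier ?M" "b \<in> carrier ?M"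
    then obtain F G where F: "a = encode F" "F \<in> K" and G: "b = encode G" "G \<in> K" by auto
    show "a \<oplus>\<^bsub>?M\<^esub> b \<in> carrier ?M" using K' F G by simp
    have "cadd W F G = cadd W G F"
      by (rule cfun_eqI[OF cfun_closed(1,1)]) (simp add: cvalues add.commute)
    then show "a \<oplus>\<^bsub>?M\<^esub> b = b \<oplus>\<^bsub>?M\<^esub> a" by (simp add: F G)
  next
    show "\<zero>\<^bsub>?M\<^esub> \<in> carrier ?M" using K' by simp
    fix a assume "a \<in> carrier ?M"
    then obtain F where F: "a = encode F" "F \<in> K" by auto
    have "cadd W (czero W) F = F"
      by (rule cfun_eqI[OF cfun_closed(1) Kc[OF F(2)]]) (simp add: cvalues cfunD[OF Kc[OF F(2)]])
    then show "\<zero>\<^bsub>?M\<^esub> \<oplus>\<^bsub>?M\<^esub> a = a" by (simp add: F)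
    obtain G where "G \<in> K" "cadd W G F = czero W" using K' F by blast
    then show "\<exists>y\<in>carrier ?M. y \<oplus>\<^bsub>?M\<^esub> a = \<zero>\<^bsub>?M\<^esub>"
      using F by (intro bexI[of _ "encode G"]) auto
  qed
  have axm: "left_module_axioms \<Lambda> ?M"
  proof
    fix a x assume a: "a \<in> carrier \<Lambda>" and "x \<in> carrier ?M"
    then obtain F where F: "x = encode F" "F \<in> K" by auto
    show "a \<odot>\<^bsub>?M\<^esub> x \<in> carrier ?M" using K' F a by simp
    fix b assume b: "b \<in> carrier \<Lambda>"
    show "(a \<oplus>\<^bsub>\<Lambda>\<^esub> b) \<odot>\<^bsub>?M\<^esub> x = a \<odot>\<^bsub>?M\<^esub> x \<oplus>\<^bsub>?M\<^esub> b \<odot>\<^bsub>?M\<^esub> x"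
      by (simp add: F cscale_add[OF W])
    show "(a \<otimes>\<^bsub>\<Lambda>\<^esub> b) \<odot>\<^bsub>?M\<^esub> x = a \<odot>\<^bsub>?M\<^esub> (b \<odot>\<^bsub>?M\<^esub> x)"
      by (simp add: F cscale_mult[OF W a b])
  next
    fix a x y assume a: "a \<in> carrier \<Lambda>" and "x \<in> carrier ?M" "y \<in> carrier ?M"
    then obtain F G where F: "x = encode F" "F \<in> K" and G: "y = encode G" "G \<in> K" by auto
    show "a \<odot>\<^bsub>?M\<^esub> (x \<oplus>\<^bsub>?M\<^esub> y) = a \<odot>\<^bsub>?M\<^esub> x \<oplus>\<^bsub>?M\<^esub> a \<odot>\<^bsub>?M\<^esub> y"
      by (simp add: F G cscale_cadd[OF W])
  next
    fix x assume "x \<in> carrier ?M"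
    then obtain F where F: "x = encode F" "F \<in> K" by auto
    show "\<one>\<^bsub>\<Lambda>\<^esub> \<odot>\<^bsub>?M\<^esub> x = x" by (simp add: F cscale_one[OF W Kc[OF F(2)]])
  qed
  show ?thesis using ring ab axm by (simp add: left_module_def)
qed

lemma cmodule_profinite:
  assumes ring: "ring \<Lambda>" and W: "W \<in> ONS" and K: "csub W K"
  shows "profinite_module \<Lambda> T\<Lambda> (cmodule W K :: ('q set \<Rightarrow> 'q set \<Rightarrow> int, (('q set \<Rightarrow> 'q set \<Rightarrow> int) + 'm) test) module) (discrete_topology (encode ` K))"
proof -
  let ?M = "cmodule W K :: ('q set \<Rightarrow> 'q set \<Rightarrow> int, (('q set \<Rightarrow> 'q set \<Rightarrow> int) + 'm) test) module"
  interpret L: left_module \<Lambda> "?M" by (rule cmodule_left_module[OF assms])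
  have "finite (cfun W)" unfolding cfun_def using finite_cosets[OF W] by (intro finite_PiE) auto
  then have fin: "finite K" using K unfolding csub_def by (meson finite_subset)
  have grp: "group (add_monoid ?M)" using L.a_group by simp
  have top: "discrete_on (add_monoid ?M) = discrete_topology (carrier ?M)" by simp
  have pg: "profinite_group (add_monoid ?M) (discrete_topology (carrier ?M))"
    using finite_discrete_profinite[OF grp] fin top by simp
  let ?X = "prod_topology T\<Lambda> (discrete_topology (carrier ?M))"
  have "continuous_map ?X (discrete_topology (carrier ?M)) (\<lambda>(a, x). a \<odot>\<^bsub>?M\<^esub> x)"
    unfolding continuous_map_def
  proof (intro conjI allI impI)
    show "(\<lambda>(a, x). a \<odot>\<^bsub>?M\<^esub> x) \<in> topspace ?X \<rightarrow> topspace (discrete_topology (carrier ?M))"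
      using K by (auto simp: topspace_algebra csub_def)
    fix U :: "(('q set \<Rightarrow> 'q set \<Rightarrow> int) + 'm) test set" assume "openin (discrete_topology (carrier ?M)) U"
    show "openin ?X {z \<in> topspace ?X. (case z of (a, x) \<Rightarrow> a \<odot>\<^bsub>?M\<^esub> x) \<in> U}"
    proof (subst openin_subopen, intro ballI)
      fix z assume z: "z \<in> {z \<in> topspace ?X. (case z of (a, x) \<Rightarrow> a \<odot>\<^bsub>?M\<^esub> x) \<in> U}"
      obtain r x where rx: "z = (r, x)" by (cases z)
      then obtain F where F: "r \<in> carrier \<Lambda>" "x = encode F" "F \<in> K" "encode (cscale W r F) \<in> U"
        using z by (auto simp: topspace_algebra)
      \<comment> \<open>The action of \<open>r\<close> depends only on its coordinate at
        \<open>W\<close>, and fixing that coordinate is an open condition.\<close>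
      let ?V = "{s \<in> carrier \<Lambda>. s W = r W} \<times> {x}"
      have "openin ?X ?V" using openin_algebra_coordinate[OF W] F by (simp add: openin_prod_Times_iff)
      moreover have "z \<in> ?V" using rx F by simp
      moreover have "?V \<subseteq> {z \<in> topspace ?X. (case z of (a, x) \<Rightarrow> a \<odot>\<^bsub>?M\<^esub> x) \<in> U}"
        using F by (auto simp: topspace_algebra cscale_def)
      ultimately show "\<exists>V. openin ?X V \<and> z \<in> V \<and> V \<subseteq> {z \<in> topspace ?X. (case z of (a, x) \<Rightarrow> a \<odot>\<^bsub>?M\<^esub> x) \<in> U}"
        by blast
    qed
  qed
  then show ?thesis unfolding profinite_module_def using L.left_module_axioms pg by simp
qed

end

section \<open>Vanishing of cocycles\<close>

text \<open>The extension is forgotten here. What is kept is a map \<open>act\<close> that realises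
  the group-like scalars on the Frattini classes of \<open>N\<close>.\<close>

locale projective_frattini_quotient = pro_p_algebra p Q TQ
  for p and Q :: "'q monoid" and TQ +
  fixes N :: "'n monoid" and TN :: "'n topology"
    and act :: "'q \<Rightarrow> 'n \<Rightarrow> 'n" and s :: "('q set \<Rightarrow> 'q set \<Rightarrow> int) \<Rightarrow> 'n set \<Rightarrow> 'n set"
  assumes N: "topological_group N TN"
    and proj: "projective_profinite_module \<Lambda> T\<Lambda> (module_of_group (ab_el p N TN) s) (ab_el_topology p N TN)"
    and act_closed: "\<And>q n. q \<in> carrier Q \<Longrightarrow> n \<in> carrier N \<Longrightarrow> act q n \<in> carrier N"
    and s_act: "\<And>q n. q \<in> carrier Q \<Longrightarrow> n \<in> carrier N \<Longrightarrow>
      s (group_like Q TQ q) (frattini p N TN #>\<^bsub>N\<^esub> n) = frattini p N TN #>\<^bsub>N\<^esub> act q n"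
begin

abbreviation "\<Phi> \<equiv> frattini p N TN"
abbreviation "M \<equiv> module_of_group (ab_el p N TN) s"
abbreviation "TM \<equiv> ab_el_topology p N TN"

section \<open>The Frattini quotient as a module\<close>

lemma p_pos: "p > 0" using p_gt_1 by simp

lemma N_group: "group N" using topological_groupD[OF N] by simp

lemma M_profinite: "profinite_module \<Lambda> T\<Lambda> M TM"
  using proj by (simp add: projective_profinite_module_def)

lemma M_left_module: "left_module \<Lambda> M" using M_profinite by (simp add: profinite_module_def)

lemma algebra_ring: "ring \<Lambda>" using M_left_module by (simp add: left_module_def)

lemma M_carrier: "carrier M = rcosets\<^bsub>N\<^esub> \<Phi>"
  by (simp add: module_of_group_def ab_el_def FactGroup_def)

lemma class_in_M: "n \<in> carrier N \<Longrightarrow> \<Phi> #>\<^bsub>N\<^esub> n \<in> carrier M"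
  unfolding M_carrier by (auto simp: RCOSETS_def)

lemma M_cases:
  assumes "x \<in> carrier M" obtains n where "n \<in> carrier N" "x = \<Phi> #>\<^bsub>N\<^esub> n"
  using assms unfolding M_carrier by (auto simp: RCOSETS_def)

lemma class_self: "n \<in> carrier N \<Longrightarrow> n \<in> \<Phi> #>\<^bsub>N\<^esub> n"
  using group.rcos_self[OF N_group] frattini_subgroup[OF N] by blast

lemma class_eq: "m \<in> carrier N \<Longrightarrow> n \<in> \<Phi> #>\<^bsub>N\<^esub> m \<Longrightarrow> \<Phi> #>\<^bsub>N\<^esub> n = \<Phi> #>\<^bsub>N\<^esub> m"
  using group.repr_independence[OF N_group _ _ frattini_subgroup[OF N]] by metis

text \<open>The module axioms already make the set product of two classes a class; it contains the
  product of \<open>m\<close> and \<open>n\<close>, and classes are determined by any of their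
  members.\<close>

lemma M_add:
  assumes "m \<in> carrier N" "n \<in> carrier N"
  shows "(\<Phi> #>\<^bsub>N\<^esub> m) \<oplus>\<^bsub>M\<^esub> (\<Phi> #>\<^bsub>N\<^esub> n) = \<Phi> #>\<^bsub>N\<^esub> (m \<otimes>\<^bsub>N\<^esub> n)"
proof -
  interpret left_module \<Lambda> M by (rule M_left_module)
  have eq: "(\<Phi> #>\<^bsub>N\<^esub> m) \<oplus>\<^bsub>M\<^esub> (\<Phi> #>\<^bsub>N\<^esub> n) = (\<Phi> #>\<^bsub>N\<^esub> m) <#>\<^bsub>N\<^esub> (\<Phi> #>\<^bsub>N\<^esub> n)"
    by (simp add: module_of_group_def ab_el_def)
  have "(\<Phi> #>\<^bsub>N\<^esub> m) \<oplus>\<^bsub>M\<^esub> (\<Phi> #>\<^bsub>N\<^esub> n) \<in> carrier M"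
    using M.a_closed class_in_M assms by blast
  then obtain k where k: "k \<in> carrier N" "(\<Phi> #>\<^bsub>N\<^esub> m) \<oplus>\<^bsub>M\<^esub> (\<Phi> #>\<^bsub>N\<^esub> n) = \<Phi> #>\<^bsub>N\<^esub> k" by (rule M_cases)
  have "m \<otimes>\<^bsub>N\<^esub> n \<in> (\<Phi> #>\<^bsub>N\<^esub> m) <#>\<^bsub>N\<^esub> (\<Phi> #>\<^bsub>N\<^esub> n)"
    using class_self assms by (auto simp: set_mult_def)
  then show ?thesis using eq k class_eq by metis
qed

lemma TM_openin: "openin TM U \<longleftrightarrow> U \<subseteq> carrier M \<and> openin TN {n \<in> carrier N. \<Phi> #>\<^bsub>N\<^esub> n \<in> U}"
  unfolding ab_el_topology_def openin_quotient_topology M_carrier using topological_groupD(2)[OF N] by simp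

lemma TM_topspace: "topspace TM = carrier M"
proof -
  have "openin TM (carrier M)"
    unfolding TM_openin using class_in_M topological_groupD(2)[OF N] openin_topspace[of TN]
    by (simp add: Collect_conj_eq Int_absorb2 subset_iff)
  moreover have "topspace TM \<subseteq> carrier M" using TM_openin openin_topspace by blast
  ultimately show ?thesis using openin_subset by blast
qed

text \<open>An additive map that is trivial on \<open>\<Phi>\<close> descends to classes, and
  equivariance says that it respects group-like scalars. Continuity extends this to all scalars,
  since the group-like elements span every finite level.\<close>

lemma module_hom_from_equivariant:
  fixes g0 :: "'n \<Rightarrow> 'q set \<Rightarrow> 'q set \<Rightarrow> int"
  assumes W: "W \<in> ONS" and K: "csub W K"
    and g0: "\<And>n. n \<in> carrier N \<Longrightarrow> g0 n \<in> K"
    and add: "\<And>m n. m \<in> carrier N \<Longrightarrow> n \<in> carrier N \<Longrightarrow> g0 (m \<otimes>\<^bsub>N\<^esub> n) = cadd W (g0 m) (g0 n)"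
    and eqv: "\<And>q n. q \<in> carrier Q \<Longrightarrow> n \<in> carrier N \<Longrightarrow> g0 (act q n) = cscale W (group_like Q TQ q) (g0 n)"
    and op: "openin TN {n \<in> carrier N. g0 n = czero W}"
    and triv: "\<And>n. n \<in> \<Phi> \<Longrightarrow> g0 n = czero W"
  obtains g :: "'n set \<Rightarrow> (('q set \<Rightarrow> 'q set \<Rightarrow> int) + 'n set) test"
  where "continuous_module_hom \<Lambda> M TM (cmodule W K) (discrete_topology (encode ` K)) g"
    "\<And>n. n \<in> carrier N \<Longrightarrow> g (\<Phi> #>\<^bsub>N\<^esub> n) = encode (g0 n)"
proof -
  let ?B = "cmodule W K :: ('q set \<Rightarrow> 'q set \<Rightarrow> int, (('q set \<Rightarrow> 'q set \<Rightarrow> int) + 'n set) test) module"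
  interpret M: left_module \<Lambda> M by (rule M_left_module)
  interpret B: left_module \<Lambda> ?B by (rule cmodule_left_module[OF algebra_ring W K])
  interpret NG: group N by (rule N_group)
  have Kc: "F \<in> cfun W" if "F \<in> K" for F using K that unfolding csub_def by blast
  have \<Phi>N: "\<Phi> \<subseteq> carrier N" using subgroup.subset[OF frattini_subgroup[OF N]] .
  have czero_left: "cadd W (czero W) F = F" if "F \<in> K" for F
    by (rule cfun_eqI[OF cfun_closed(1) Kc[OF that]]) (simp add: cvalues cfunD[OF Kc[OF that]])
  have const: "g0 m = g0 n" if n: "n \<in> carrier N" and m: "m \<in> \<Phi> #>\<^bsub>N\<^esub> n" for m n
  proof -
    obtain k where "k \<in> \<Phi>" "m = k \<otimes>\<^bsub>N\<^esub> n" using m by (auto simp: r_coset_def)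
    then show ?thesis using add[of k n] triv[of k] n \<Phi>N czero_left[OF g0[OF n]] by auto
  qed
  \<comment> \<open>Any representative of the class may be chosen, by \<open>const\<close>.\<close>
  define g where "g x = (encode (g0 (SOME n. n \<in> x)) :: (('q set \<Rightarrow> 'q set \<Rightarrow> int) + 'n set) test)" for x
  have gval: "g (\<Phi> #>\<^bsub>N\<^esub> n) = encode (g0 n)" if n: "n \<in> carrier N" for n
    using const[OF n someI[of "\<lambda>m. m \<in> \<Phi> #>\<^bsub>N\<^esub> n", OF class_self[OF n]]] by (simp add: g_def)
  have gK: "g x \<in> encode ` K" if "x \<in> carrier M" for x
    using that by (rule M_cases) (use gval g0 in auto)
  have gadd: "g (x \<oplus>\<^bsub>M\<^esub> y) = encode (cadd W (decode (g x)) (decode (g y)))" if "x \<in> carrier M" "y \<in> carrier M" for x y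
    using that by (elim M_cases) (simp add: M_add gval add)
  have hom: "g \<in> hom (add_monoid M) (add_monoid ?B)"
  proof (rule homI)
    fix x y assume "x \<in> carrier (add_monoid M)" "y \<in> carrier (add_monoid M)"
    then have xy: "x \<in> carrier M" "y \<in> carrier M" by simp_all
    obtain F where F: "g x = encode F" using gK[OF xy(1)] by blast
    obtain G where G: "g y = encode G" using gK[OF xy(2)] by blast
    show "g (x \<otimes>\<^bsub>add_monoid M\<^esub> y) = g x \<otimes>\<^bsub>add_monoid ?B\<^esub> g y" using gadd[OF xy] F G by simp
  qed (use gK in simp)
  have cont: "continuous_map TM (discrete_topology (encode ` K)) g"
    unfolding continuous_map_def
  proof (intro conjI allI impI)
    show "g \<in> topspace TM \<rightarrow> topspace (discrete_topology (encode ` K))" using gK TM_topspace by auto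
    fix U :: "(('q set \<Rightarrow> 'q set \<Rightarrow> int) + 'n set) test set" assume "openin (discrete_topology (encode ` K)) U"
    then have U: "U \<subseteq> encode ` K" by simp
    have h0: "(\<lambda>n. encode (g0 n)) \<in> hom N (add_monoid ?B)"
      by (rule homI) (simp_all add: g0 add)
    have "continuous_map TN (discrete_on (add_monoid ?B)) (\<lambda>n. encode (g0 n))"
      using continuous_map_discrete_hom_iff[OF N B.a_group h0] op by simp
    then have "openin TN {n \<in> topspace TN. encode (g0 n) \<in> U}"
      by (rule openin_continuous_map_preimage) (use U in simp)
    moreover have "{n \<in> carrier N. \<Phi> #>\<^bsub>N\<^esub> n \<in> {x \<in> topspace TM. g x \<in> U}} = {n \<in> topspace TN. encode (g0 n) \<in> U}"
      using gval class_in_M topological_groupD(2)[OF N] by (auto simp: TM_topspace)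
    ultimately show "openin TM {x \<in> topspace TM. g x \<in> U}"
      unfolding TM_openin by (auto simp: TM_topspace)
  qed
  have scal: "g (r \<odot>\<^bsub>M\<^esub> x) = r \<odot>\<^bsub>?B\<^esub> g x" if r: "r \<in> carrier \<Lambda>" and x: "x \<in> carrier M" for r x
  proof -
    obtain n where n: "n \<in> carrier N" "x = \<Phi> #>\<^bsub>N\<^esub> n" using x by (rule M_cases)
    have gx: "g x = encode (g0 n)" using gval n by simp
    have rxM: "r \<odot>\<^bsub>M\<^esub> x \<in> carrier M" if "r \<in> carrier \<Lambda>" for r using M.smult_closed[OF that x] .
    define u where "u r = decode (g (r \<odot>\<^bsub>M\<^esub> x))" for r
    have uK: "u r \<in> K" "g (r \<odot>\<^bsub>M\<^esub> x) = encode (u r)" if rr: "r \<in> carrier \<Lambda>" for r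
    proof -
      obtain F where "F \<in> K" "g (r \<odot>\<^bsub>M\<^esub> x) = encode F" using gK[OF rxM[OF rr]] by blast
      then show "u r \<in> K" "g (r \<odot>\<^bsub>M\<^esub> x) = encode (u r)" by (simp_all add: u_def)
    qed
    have uadd: "u (a \<oplus>\<^bsub>\<Lambda>\<^esub> b) = cadd W (u a) (u b)" if "a \<in> carrier \<Lambda>" "b \<in> carrier \<Lambda>" for a b
      using gadd[OF rxM[OF that(1)] rxM[OF that(2)]] M.smult_l_distr[OF that x] by (simp add: u_def)
    have ugl: "u (group_like Q TQ q) = cscale W (group_like Q TQ q) (g0 n)" if q: "q \<in> carrier Q" for q
    proof -
      have "group_like Q TQ q \<odot>\<^bsub>M\<^esub> x = \<Phi> #>\<^bsub>N\<^esub> act q n"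
        using s_act[OF q n(1)] n(2) by (simp add: module_of_group_def)
      then show ?thesis using gval[OF act_closed[OF q n(1)]] eqv[OF q n(1)] by (simp add: u_def)
    qed
    have uzero: "u \<zero>\<^bsub>\<Lambda>\<^esub> = czero W"
    proof -
      interpret R: ring \<Lambda> by (rule algebra_ring)
      have "u \<zero>\<^bsub>\<Lambda>\<^esub> = cadd W (u \<zero>\<^bsub>\<Lambda>\<^esub>) (u \<zero>\<^bsub>\<Lambda>\<^esub>)" using uadd[of "\<zero>\<^bsub>\<Lambda>\<^esub>" "\<zero>\<^bsub>\<Lambda>\<^esub>"] by simp
      then have eq: "u \<zero>\<^bsub>\<Lambda>\<^esub> y D = (u \<zero>\<^bsub>\<Lambda>\<^esub> y D + u \<zero>\<^bsub>\<Lambda>\<^esub> y D) mod int p" if "y \<in> cosets W" "D \<in> cosets W" for y D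
        using cvalues(1)[OF that] by metis
      have uc: "u \<zero>\<^bsub>\<Lambda>\<^esub> \<in> cfun W" using uK(1) Kc by simp
      show ?thesis
      proof (rule cfun_eqI[OF uc cfun_closed(3)])
        fix y D assume yD: "y \<in> cosets W" "D \<in> cosets W"
        have "[u \<zero>\<^bsub>\<Lambda>\<^esub> y D = u \<zero>\<^bsub>\<Lambda>\<^esub> y D + u \<zero>\<^bsub>\<Lambda>\<^esub> y D] (mod int p)"
          using eq[OF yD] cfunD(3)[OF uc yD] by (simp add: cong_def)
        then have "int p dvd u \<zero>\<^bsub>\<Lambda>\<^esub> y D" by (simp add: cong_iff_dvd_diff)
        then have "u \<zero>\<^bsub>\<Lambda>\<^esub> y D mod int p = 0" by simp
        then show "u \<zero>\<^bsub>\<Lambda>\<^esub> y D = czero W y D" using cfunD(3)[OF uc yD] cvalues(3)[OF yD] by metis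
      qed
    qed
    \<comment> \<open>The scalars that \<open>g\<close> kills when applied to \<open>x\<close> form
      an open set around zero, so they include everything that vanishes at some level
      \<open>V\<close>.\<close>
    have op: "openin T\<Lambda> {r \<in> topspace T\<Lambda>. g (r \<odot>\<^bsub>M\<^esub> x) \<in> {encode (czero W)}}"
    proof (rule openin_continuous_map_preimage)
      have "continuous_map T\<Lambda> (prod_topology T\<Lambda> TM) (\<lambda>r. (r, x))"
        using x by (simp add: continuous_map_pairedI TM_topspace)
      then have "continuous_map T\<Lambda> TM ((\<lambda>(a, x). a \<odot>\<^bsub>M\<^esub> x) \<circ> (\<lambda>r. (r, x)))"
        using M_profinite unfolding profinite_module_def by (blast intro: continuous_map_compose)
      then have "continuous_map T\<Lambda> TM (\<lambda>r. r \<odot>\<^bsub>M\<^esub> x)" by (simp add: comp_def)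
      from continuous_map_compose[OF this cont]
      show "continuous_map T\<Lambda> (discrete_topology (encode ` K)) (\<lambda>r. g (r \<odot>\<^bsub>M\<^esub> x))" by (simp add: comp_def)
      show "openin (discrete_topology (encode ` K)) {encode (czero W)}" using K by (simp add: csub_def)
    qed
    obtain V where V: "V \<in> ONS" "V \<subseteq> W"
      "\<And>r. r \<in> carrier \<Lambda> \<Longrightarrow> (\<And>D. D \<in> cosets V \<Longrightarrow> r V D = 0) \<Longrightarrow>
         r \<in> {r \<in> topspace T\<Lambda>. g (r \<odot>\<^bsub>M\<^esub> x) \<in> {encode (czero W)}}"
    proof (rule open_nhd_zero_algebra[OF op _ W])
      show "\<zero>\<^bsub>\<Lambda>\<^esub> \<in> {r \<in> topspace T\<Lambda>. g (r \<odot>\<^bsub>M\<^esub> x) \<in> {encode (czero W)}}"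
        using uK(2)[of "\<zero>\<^bsub>\<Lambda>\<^esub>"] uzero ring.ring_simprules(2)[OF algebra_ring] by (simp add: topspace_algebra)
    qed blast
    have "u r = cscale W r (g0 n)"
    proof (rule cfun_eqI[OF Kc[OF uK(1)[OF r]] cfun_closed(2)])
      fix y D assume yD: "y \<in> cosets W" "D \<in> cosets W"
      \<comment> \<open>Entry by entry, the defect of linearity is an additive function of the
        scalar that vanishes modulo p on group-like elements and on scalars vanishing at level
        \<open>V\<close>.\<close>
      have "[u r y D - cscale W r (g0 n) y D = 0] (mod int p)"
      proof (rule additive_vanishes[OF algebra_ring V(1) _ _ _ r, where v = "\<lambda>r. u r y D - cscale W r (g0 n) y D"])
        fix a b assume ab: "a \<in> carrier \<Lambda>" "b \<in> carrier \<Lambda>"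
        show "[u (a \<oplus>\<^bsub>\<Lambda>\<^esub> b) y D - cscale W (a \<oplus>\<^bsub>\<Lambda>\<^esub> b) (g0 n) y D =
            u a y D - cscale W a (g0 n) y D + (u b y D - cscale W b (g0 n) y D)] (mod int p)"
          unfolding uadd[OF ab] cscale_add[OF W] cvalues(1)[OF yD]
          by (simp add: cong_def mod_simps algebra_simps)
      next
        fix a assume a: "a \<in> carrier \<Lambda>" "\<And>D. D \<in> cosets V \<Longrightarrow> a V D = 0"
        have "u a = czero W" using V(3)[OF a] by (simp add: u_def)
        moreover have "cscale W a (g0 n) y D = 0"
          unfolding cvalues[OF yD] using algebra_zero_above[OF a(1) V(1) W V(2) a(2)] by simp
        ultimately show "[u a y D - cscale W a (g0 n) y D = 0] (mod int p)" using cvalues(3)[OF yD] by simp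
      next
        fix q assume "q \<in> carrier Q"
        then show "[u (group_like Q TQ q) y D - cscale W (group_like Q TQ q) (g0 n) y D = 0] (mod int p)"
          using ugl by simp
      qed
      then have "u r y D mod int p = cscale W r (g0 n) y D mod int p"
        by (simp add: cong_iff_dvd_diff mod_eq_dvd_iff)
      then show "u r y D = cscale W r (g0 n) y D"
        using cfunD(3)[OF Kc[OF uK(1)[OF r]] yD] cfunD(3)[OF cfun_closed(2) yD] by simp
    qed
    then show ?thesis using uK(2)[OF r] gx by simp
  qed
  have "continuous_module_hom \<Lambda> M TM ?B (discrete_topology (encode ` K)) g"
    unfolding continuous_module_hom_def continuous_hom_def using hom cont scal by blast
  then show thesis using that gval by blast
qed

text \<open>The test modules are the functions on \<open>Q/W\<close> (embedded by \<open>con\<close>) and their quotient by the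
  constants (embedded by \<open>dif\<close>). The map \<open>n \<mapsto> (y, D) \<mapsto> b(y D, n) - b(D, n)\<close> into the quotient is
  linear; its lift, evaluated at the identity coset, trivializes \<open>b\<close>.\<close>

lemma cocycle_vanishes:
  fixes b :: "'q \<Rightarrow> 'n \<Rightarrow> int"
  assumes W: "W \<in> ONS"
    and b: "\<And>q. q \<in> carrier Q \<Longrightarrow> b q \<in> fp_chars p N TN"
    and coc: "\<And>q q' n. q \<in> carrier Q \<Longrightarrow> q' \<in> carrier Q \<Longrightarrow> n \<in> carrier N \<Longrightarrow>
      [b (q \<otimes>\<^bsub>Q\<^esub> q') n = b q (act q' n) + b q' n] (mod int p)"
    and bW: "\<And>w n. w \<in> W \<Longrightarrow> n \<in> carrier N \<Longrightarrow> [b w n = 0] (mod int p)"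
  shows "\<exists>e \<in> fp_chars p N TN. \<forall>q\<in>carrier Q. \<forall>n\<in>carrier N. [e (act q n) = e n + b q n] (mod int p)"
proof -
  interpret NG: group N by (rule N_group)
  interpret QG: group Q by (rule pgroups(3))
  interpret P: group "Q Mod W" by (rule group_quotient[OF W])
  have Wsub: "subgroup W Q" using open_normal_subgroupD(3)[OF W] .
  note fin = finite_cosets[OF W]
  define rep where "rep C = (SOME q. q \<in> carrier Q \<and> C = W #>\<^bsub>Q\<^esub> q)" for C
  have rep: "rep C \<in> carrier Q" "C = W #>\<^bsub>Q\<^esub> rep C" if "C \<in> cosets W" for C
    using someI_ex[of "\<lambda>q. q \<in> carrier Q \<and> C = W #>\<^bsub>Q\<^esub> q"] coset_cases[OF that] unfolding rep_def by blast+
  define \<beta> where "\<beta> n C = b (rep C) n" for n C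
  \<comment> \<open>As \<open>b\<close> vanishes on \<open>W\<close>, the cocycle identity for
    \<open>w\<close> times \<open>q\<close> shows that \<open>b q\<close> depends, modulo p, only on
    the coset of \<open>q\<close>.\<close>
  have \<beta>: "[\<beta> n (W #>\<^bsub>Q\<^esub> q) = b q n] (mod int p)" if q: "q \<in> carrier Q" and n: "n \<in> carrier N" for q n
  proof -
    let ?r = "rep (W #>\<^bsub>Q\<^esub> q)"
    have r: "?r \<in> carrier Q" "W #>\<^bsub>Q\<^esub> q = W #>\<^bsub>Q\<^esub> ?r" using rep[OF coset_in[OF W q]] by auto
    then have "?r \<in> W #>\<^bsub>Q\<^esub> q" using QG.rcos_self[OF r(1) Wsub] by simp
    then obtain w where w: "w \<in> W" "?r = w \<otimes>\<^bsub>Q\<^esub> q" by (auto simp: r_coset_def)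
    have wc: "w \<in> carrier Q" using w(1) subgroup.mem_carrier[OF Wsub] by blast
    have "[b w (act q n) + b q n = 0 + b q n] (mod int p)"
      using bW[OF w(1) act_closed[OF q n]] by (intro cong_add) auto
    from cong_trans[OF coc[OF wc q n] this] show ?thesis by (simp add: \<beta>_def w(2))
  qed
  have \<beta>_act: "[\<beta> (act q n) C = \<beta> n (C \<otimes>\<^bsub>Q Mod W\<^esub> (W #>\<^bsub>Q\<^esub> q)) - b q n] (mod int p)"
    if C: "C \<in> cosets W" and q: "q \<in> carrier Q" and n: "n \<in> carrier N" for C q n
  proof -
    have r: "rep C \<in> carrier Q" using rep(1)[OF C] .
    have "C \<otimes>\<^bsub>Q Mod W\<^esub> (W #>\<^bsub>Q\<^esub> q) = W #>\<^bsub>Q\<^esub> (rep C \<otimes>\<^bsub>Q\<^esub> q)"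
      using coset_mult[OF W r q] rep(2)[OF C] by simp
    then have "[\<beta> n (C \<otimes>\<^bsub>Q Mod W\<^esub> (W #>\<^bsub>Q\<^esub> q)) = b (rep C \<otimes>\<^bsub>Q\<^esub> q) n] (mod int p)"
      using \<beta>[of "rep C \<otimes>\<^bsub>Q\<^esub> q" n] r q n by simp
    from cong_trans[OF this coc[OF r q n]]
    have "[\<beta> n (C \<otimes>\<^bsub>Q Mod W\<^esub> (W #>\<^bsub>Q\<^esub> q)) - b q n = b (rep C) (act q n) + b q n - b q n] (mod int p)"
      by (intro cong_diff) auto
    then show ?thesis unfolding \<beta>_def by (simp add: cong_sym_eq)
  qed
  have \<beta>_add: "[\<beta> (m \<otimes>\<^bsub>N\<^esub> n) C = \<beta> m C + \<beta> n C] (mod int p)"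
    if "C \<in> cosets W" "m \<in> carrier N" "n \<in> carrier N" for C m n
    unfolding \<beta>_def using fp_charsD(1)[OF b[OF rep(1)[OF that(1)]] that(2,3)] .

  \<comment> \<open>\<open>con\<close> makes a function of \<open>D\<close> constant in
    \<open>y\<close>. \<open>dif\<close> subtracts \<open>F\<close> from its left translate by
    \<open>y\<close>; among functions of \<open>D\<close> alone with values from 0 to p - 1, it
    kills exactly the constants.\<close>
  define con where "con f = (\<lambda>y\<in>cosets W. \<lambda>D\<in>cosets W. f D)" for f :: "'q set \<Rightarrow> int"
  define dif where "dif F = (\<lambda>y\<in>cosets W. \<lambda>D\<in>cosets W. (F y (y \<otimes>\<^bsub>Q Mod W\<^esub> D) - F y D) mod int p)"
    for F :: "'q set \<Rightarrow> 'q set \<Rightarrow> int"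
  define K1 where "K1 = con ` (cosets W \<rightarrow>\<^sub>E {0..<int p})"
  define K2 where "K2 = dif ` K1"
  have dif_val: "dif F y D = (F y (y \<otimes>\<^bsub>Q Mod W\<^esub> D) - F y D) mod int p" if "y \<in> cosets W" "D \<in> cosets W" for F y D
    using that by (simp add: dif_def)
  have con_val: "con f y D = f D" if "y \<in> cosets W" "D \<in> cosets W" for f y D using that by (simp add: con_def)
  have dif_cfun: "dif F \<in> cfun W" for F using p_gt_1 by (auto simp: cfun_def dif_def)
  have con_cfun: "con f \<in> cfun W" if "f \<in> cosets W \<rightarrow>\<^sub>E {0..<int p}" for f
    using that by (auto simp: cfun_def con_def)
  have cl: "y \<otimes>\<^bsub>Q Mod W\<^esub> D \<in> cosets W" if "y \<in> cosets W" "D \<in> cosets W" for y D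
    using coset_op_closed[OF W that] .
  have dif_cadd: "dif (cadd W F G) = cadd W (dif F) (dif G)" for F G
  proof (rule cfun_eqI[OF dif_cfun cfun_closed(1)])
    fix y D assume y: "y \<in> cosets W" "D \<in> cosets W"
    show "dif (cadd W F G) y D = cadd W (dif F) (dif G) y D"
      unfolding dif_val[OF y] cvalues(1)[OF y] cvalues(1)[OF y(1) cl[OF y]]
      by (simp only: mod_diff_eq mod_add_eq) (simp add: algebra_simps del: mult_FactGroup)
  qed
  \<comment> \<open>Left translation by \<open>y\<close> commutes with the right translations of the
    action, by associativity in \<open>Q/W\<close>.\<close>
  have dif_cscale: "dif (cscale W r F) = cscale W r (dif F)" for r F
  proof (rule cfun_eqI[OF dif_cfun cfun_closed(2)])
    fix y D assume y: "y \<in> cosets W" "D \<in> cosets W"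
    have "cscale W r (dif F) y D = (\<Sum>C\<in>cosets W. r W C *
        ((F y (y \<otimes>\<^bsub>Q Mod W\<^esub> (D \<otimes>\<^bsub>Q Mod W\<^esub> C)) - F y (D \<otimes>\<^bsub>Q Mod W\<^esub> C)) mod int p)) mod int p"
      unfolding cvalues(2)[OF y] by (intro arg_cong[of _ _ "\<lambda>x. x mod int p"] sum.cong)
        (simp_all add: dif_val[OF y(1) cl[OF y(2)]] del: mult_FactGroup)
    also have "\<dots> = (\<Sum>C\<in>cosets W. r W C *
        (F y (y \<otimes>\<^bsub>Q Mod W\<^esub> (D \<otimes>\<^bsub>Q Mod W\<^esub> C)) - F y (D \<otimes>\<^bsub>Q Mod W\<^esub> C))) mod int p"
      unfolding cong_def[symmetric] by (intro cong_sum cong_mult) (auto simp: cong_def)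
    also have "(\<Sum>C\<in>cosets W. r W C *
        (F y (y \<otimes>\<^bsub>Q Mod W\<^esub> (D \<otimes>\<^bsub>Q Mod W\<^esub> C)) - F y (D \<otimes>\<^bsub>Q Mod W\<^esub> C)))
      = (\<Sum>C\<in>cosets W. r W C * F y ((y \<otimes>\<^bsub>Q Mod W\<^esub> D) \<otimes>\<^bsub>Q Mod W\<^esub> C))
        - (\<Sum>C\<in>cosets W. r W C * F y (D \<otimes>\<^bsub>Q Mod W\<^esub> C))"
      unfolding sum_subtractf[symmetric]
      by (rule sum.cong) (simp_all add: P.m_assoc[OF y] right_diff_distrib del: mult_FactGroup)
    finally show "dif (cscale W r F) y D = cscale W r (dif F) y D"
      unfolding dif_val[OF y] cvalues(2)[OF y] cvalues(2)[OF y(1) cl[OF y]] by (simp only: mod_diff_eq)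
  qed
  have dif_czero: "dif (czero W) = czero W"
    by (rule cfun_eqI[OF dif_cfun cfun_closed(3)]) (simp add: dif_val cvalues cl del: mult_FactGroup)
  have K1: "csub W K1"
    unfolding csub_def
  proof (intro conjI ballI)
    show "K1 \<subseteq> cfun W" using con_cfun by (auto simp: K1_def)
    have "czero W = con (\<lambda>D\<in>cosets W. 0)" by (auto simp: czero_def con_def intro!: restrict_ext)
    then show "czero W \<in> K1" unfolding K1_def using p_gt_1 by auto
    fix F assume "F \<in> K1"
    then obtain f where f: "F = con f" "f \<in> cosets W \<rightarrow>\<^sub>E {0..<int p}" by (auto simp: K1_def)
    have "cadd W (con (\<lambda>D\<in>cosets W. (- f D) mod int p)) F = czero W"
      by (rule cfun_eqI[OF cfun_closed(1,3)]) (simp add: cvalues con_val f(1) mod_simps)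
    moreover have "con (\<lambda>D\<in>cosets W. (- f D) mod int p) \<in> K1" unfolding K1_def using p_gt_1 by auto
    ultimately show "\<exists>G\<in>K1. cadd W G F = czero W" by blast
    { fix G assume "G \<in> K1"
      then obtain g where g: "G = con g" "g \<in> cosets W \<rightarrow>\<^sub>E {0..<int p}" by (auto simp: K1_def)
      have h: "(\<lambda>D\<in>cosets W. (f D + g D) mod int p) \<in> cosets W \<rightarrow>\<^sub>E {0..<int p}" using p_gt_1 by auto
      have "cadd W F G = con (\<lambda>D\<in>cosets W. (f D + g D) mod int p)"
        by (rule cfun_eqI[OF cfun_closed(1) con_cfun[OF h]]) (simp add: cvalues con_val f g)
      then show "cadd W F G \<in> K1" unfolding K1_def using h by blast }
    { fix r assume "r \<in> carrier \<Lambda>"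
      let ?h = "\<lambda>D\<in>cosets W. (\<Sum>C\<in>cosets W. r W C * f (D \<otimes>\<^bsub>Q Mod W\<^esub> C)) mod int p"
      have h: "?h \<in> cosets W \<rightarrow>\<^sub>E {0..<int p}" using p_gt_1 by auto
      have "cscale W r F = con ?h"
      proof (rule cfun_eqI[OF cfun_closed(2) con_cfun[OF h]])
        fix y D assume y: "y \<in> cosets W" "D \<in> cosets W"
        have "(\<Sum>C\<in>cosets W. r W C * con f y (D \<otimes>\<^bsub>Q Mod W\<^esub> C)) = (\<Sum>C\<in>cosets W. r W C * f (D \<otimes>\<^bsub>Q Mod W\<^esub> C))"
          by (rule sum.cong) (simp_all add: con_val[OF y(1) cl[OF y(2)]] del: mult_FactGroup)
        then show "cscale W r F y D = con ?h y D"
          unfolding cvalues[OF y] con_val[OF y] f(1) using y by simp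
      qed
      then show "cscale W r F \<in> K1" unfolding K1_def using h by blast }
  qed
  have K2: "csub W K2"
    unfolding csub_def
  proof (intro conjI ballI)
    show "K2 \<subseteq> cfun W" using dif_cfun by (auto simp: K2_def)
    show "czero W \<in> K2" unfolding K2_def using dif_czero K1 by (metis csub_def imageI)
    fix F assume "F \<in> K2"
    then obtain F' where F': "F' \<in> K1" "F = dif F'" by (auto simp: K2_def)
    then obtain G' where "G' \<in> K1" "cadd W G' F' = czero W" using K1 unfolding csub_def by blast
    then show "\<exists>G\<in>K2. cadd W G F = czero W"
      unfolding K2_def F' using dif_cadd dif_czero by (metis imageI)
    { fix G assume "G \<in> K2"
      then obtain G' where G': "G' \<in> K1" "G = dif G'" by (auto simp: K2_def)
      then have "cadd W F' G' \<in> K1" using F' K1 unfolding csub_def by blast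
      then show "cadd W F G \<in> K2" unfolding K2_def F' G' using dif_cadd by (metis imageI) }
    { fix r assume "r \<in> carrier \<Lambda>"
      then have "cscale W r F' \<in> K1" using F' K1 unfolding csub_def by blast
      then show "cscale W r F \<in> K2" unfolding K2_def F' using dif_cscale by (metis imageI) }
  qed

  \<comment> \<open>By \<open>\<beta>_act\<close>, \<open>c\<close> fails to be equivariant only by
    the constant function \<open>b q n\<close>, which \<open>dif\<close> removes.\<close>
  define c where "c n = con (\<lambda>D\<in>cosets W. \<beta> n D mod int p)" for n
  have c: "c n \<in> K1" for n unfolding c_def K1_def using p_gt_1 by auto
  define g0 where "g0 n = dif (c n)" for n
  have g0K: "g0 n \<in> K2" for n unfolding g0_def K2_def using c by blast
  have g0_cfun: "g0 n \<in> cfun W" for n unfolding g0_def by (rule dif_cfun)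
  have g0_val: "g0 n y D = (\<beta> n (y \<otimes>\<^bsub>Q Mod W\<^esub> D) - \<beta> n D) mod int p" if y: "y \<in> cosets W" "D \<in> cosets W" for n y D
    unfolding g0_def dif_val[OF y] c_def con_val[OF y] con_val[OF y(1) cl[OF y]] using y cl[OF y] by (simp add: mod_simps)
  have c_zero: "c n = czero W" if "\<And>C. C \<in> cosets W \<Longrightarrow> [b (rep C) n = 0] (mod int p)" for n
    unfolding c_def con_def czero_def \<beta>_def by (intro restrict_ext) (use that in \<open>simp add: cong_def\<close>)
  have zero_g0: "g0 n = czero W" if "\<And>C. C \<in> cosets W \<Longrightarrow> [b (rep C) n = 0] (mod int p)" for n
    using c_zero[OF that] dif_czero by (simp add: g0_def)
  have g0_add: "g0 (m \<otimes>\<^bsub>N\<^esub> n) = cadd W (g0 m) (g0 n)" if mn: "m \<in> carrier N" "n \<in> carrier N" for m n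
  proof (rule cfun_eqI[OF g0_cfun cfun_closed(1)])
    fix y D assume y: "y \<in> cosets W" "D \<in> cosets W"
    have "[\<beta> (m \<otimes>\<^bsub>N\<^esub> n) (y \<otimes>\<^bsub>Q Mod W\<^esub> D) - \<beta> (m \<otimes>\<^bsub>N\<^esub> n) D
        = (\<beta> m (y \<otimes>\<^bsub>Q Mod W\<^esub> D) + \<beta> n (y \<otimes>\<^bsub>Q Mod W\<^esub> D)) - (\<beta> m D + \<beta> n D)] (mod int p)"
      by (intro cong_diff \<beta>_add y cl mn)
    then show "g0 (m \<otimes>\<^bsub>N\<^esub> n) y D = cadd W (g0 m) (g0 n) y D"
      unfolding cvalues[OF y] g0_val[OF y] mod_add_eq by (simp add: cong_def algebra_simps del: mult_FactGroup)
  qed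
  have g0_act: "g0 (act q n) = cscale W (group_like Q TQ q) (g0 n)" if q: "q \<in> carrier Q" and n: "n \<in> carrier N" for q n
  proof (rule cfun_eqI[OF g0_cfun cfun_closed(2)])
    fix y D assume y: "y \<in> cosets W" "D \<in> cosets W"
    let ?q = "W #>\<^bsub>Q\<^esub> q"
    note Dq = cl[OF y(2) coset_in[OF W q]]
    have "[\<beta> (act q n) (y \<otimes>\<^bsub>Q Mod W\<^esub> D) - \<beta> (act q n) D
        = (\<beta> n (y \<otimes>\<^bsub>Q Mod W\<^esub> D \<otimes>\<^bsub>Q Mod W\<^esub> ?q) - b q n) - (\<beta> n (D \<otimes>\<^bsub>Q Mod W\<^esub> ?q) - b q n)] (mod int p)"
      by (intro cong_diff \<beta>_act y cl q n)
    then show "g0 (act q n) y D = cscale W (group_like Q TQ q) (g0 n) y D"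
      unfolding cscale_group_like[OF W q g0_cfun y] g0_val[OF y] g0_val[OF y(1) Dq]
        P.m_assoc[OF y coset_in[OF W q]] by (simp add: cong_def del: mult_FactGroup)
  qed
  \<comment> \<open>The common kernel of the finitely many characters \<open>b (rep C)\<close> is
    open, and \<open>g0\<close> is trivial on it.\<close>
  have b_open: "openin TN {n \<in> carrier N. \<forall>C\<in>cosets W. [b (rep C) n = 0] (mod int p)}"
  proof -
    have "{n \<in> carrier N. \<forall>C\<in>cosets W. [b (rep C) n = 0] (mod int p)}
        = (\<Inter>C\<in>cosets W. {n \<in> carrier N. [b (rep C) n = 0] (mod int p)})"
      using P.one_closed by blast
    moreover have "openin TN (\<Inter>C\<in>cosets W. {n \<in> carrier N. [b (rep C) n = 0] (mod int p)})"
      using fin P.one_closed fp_charsD(2)[OF b[OF rep(1)]] by (intro openin_INT2) auto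
    ultimately show ?thesis by simp
  qed
  have g0_open: "openin TN {n \<in> carrier N. g0 n = czero W}"
  proof -
    let ?H = "cmodule W K2 :: ('q set \<Rightarrow> 'q set \<Rightarrow> int, (('q set \<Rightarrow> 'q set \<Rightarrow> int) + 'n set) test) module"
    interpret B: left_module \<Lambda> ?H by (rule cmodule_left_module[OF algebra_ring W K2])
    interpret A: group "add_monoid ?H" by (rule B.a_group)
    have h: "(\<lambda>n. encode (g0 n)) \<in> hom N (add_monoid ?H)"
      by (rule homI) (simp_all add: g0K g0_add)
    have "\<one>\<^bsub>N\<^esub> \<in> {n \<in> carrier N. \<forall>C\<in>cosets W. [b (rep C) n = 0] (mod int p)}"
      using subgroup.one_closed[OF fp_char_kernel(1)[OF p_pos N b[OF rep(1)]]] by blast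
    then have "continuous_hom N TN (add_monoid ?H) (discrete_on (add_monoid ?H)) (\<lambda>n. encode (g0 n))"
      by (rule continuous_hom_kernel_superset[OF N B.a_group h b_open]) (use zero_g0 in simp)
    from continuous_hom_discreteD(2)[OF N B.a_group this] show ?thesis by simp
  qed
  have g0_\<Phi>: "g0 n = czero W" if "n \<in> \<Phi>" for n
    by (rule zero_g0) (use fp_char_frattini[OF p_pos N b[OF rep(1)] that] in blast)
  obtain g :: "'n set \<Rightarrow> (('q set \<Rightarrow> 'q set \<Rightarrow> int) + 'n set) test"
    where g: "continuous_module_hom \<Lambda> M TM (cmodule W K2) (discrete_topology (encode ` K2)) g"
    "\<And>n. n \<in> carrier N \<Longrightarrow> g (\<Phi> #>\<^bsub>N\<^esub> n) = encode (g0 n)"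
    using module_hom_from_equivariant[OF W K2 g0K g0_add g0_act g0_open g0_\<Phi>] by blast

  let ?A = "cmodule W K1 :: ('q set \<Rightarrow> 'q set \<Rightarrow> int, (('q set \<Rightarrow> 'q set \<Rightarrow> int) + 'n set) test) module"
  let ?B = "cmodule W K2 :: ('q set \<Rightarrow> 'q set \<Rightarrow> int, (('q set \<Rightarrow> 'q set \<Rightarrow> int) + 'n set) test) module"
  let ?TA = "discrete_topology (carrier ?A)" and ?TB = "discrete_topology (carrier ?B)"
  \<comment> \<open>\<open>f\<close> is \<open>dif\<close> on encoded functions, the surjection
    between the two test modules along which projectivity lifts \<open>g\<close>.\<close>
  define f where "f x = (encode (dif (decode x)) :: (('q set \<Rightarrow> 'q set \<Rightarrow> int) + 'n set) test)"
    for x :: "(('q set \<Rightarrow> 'q set \<Rightarrow> int) + 'n set) test"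
  have f: "continuous_module_hom \<Lambda> ?A ?TA ?B ?TB f" "f ` carrier ?A = carrier ?B"
    unfolding continuous_module_hom_def continuous_hom_def
    by (auto simp: f_def K2_def dif_cadd dif_cscale image_image hom_def)
  have AB: "profinite_module \<Lambda> T\<Lambda> ?A ?TA" "profinite_module \<Lambda> T\<Lambda> ?B ?TB"
    using cmodule_profinite[OF algebra_ring W K1] cmodule_profinite[OF algebra_ring W K2] by simp_all
  have g': "continuous_module_hom \<Lambda> M TM ?B ?TB g" using g(1) by simp
  have "\<exists>h. continuous_module_hom \<Lambda> M TM ?A ?TA h \<and> (\<forall>x\<in>carrier M. f (h x) = g x)"
    using proj f AB g' unfolding projective_profinite_module_def by blast
  then obtain h where h: "continuous_module_hom \<Lambda> M TM ?A ?TA h" "\<And>x. x \<in> carrier M \<Longrightarrow> f (h x) = g x"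
    by blast
  have h_hom: "h \<in> hom (add_monoid M) (add_monoid ?A)" and h_cont: "continuous_map TM ?TA h"
    and h_scal: "\<And>r x. r \<in> carrier \<Lambda> \<Longrightarrow> x \<in> carrier M \<Longrightarrow> h (r \<odot>\<^bsub>M\<^esub> x) = r \<odot>\<^bsub>?A\<^esub> h x"
    using h(1) unfolding continuous_module_hom_def continuous_hom_def by auto
  define k where "k n = decode (h (\<Phi> #>\<^bsub>N\<^esub> n))" for n
  have k: "k n \<in> K1" "h (\<Phi> #>\<^bsub>N\<^esub> n) = encode (k n)" if n: "n \<in> carrier N" for n
  proof -
    have "h (\<Phi> #>\<^bsub>N\<^esub> n) \<in> encode ` K1" using hom_in_carrier[OF h_hom] class_in_M[OF n] by simp
    then obtain F where "F \<in> K1" "h (\<Phi> #>\<^bsub>N\<^esub> n) = encode F" by blast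
    then show "k n \<in> K1" "h (\<Phi> #>\<^bsub>N\<^esub> n) = encode (k n)" by (simp_all add: k_def)
  qed
  have k_con: "\<exists>f. k n = con f" if "n \<in> carrier N" for n using k(1)[OF that] by (auto simp: K1_def)
  have k_add: "k (m \<otimes>\<^bsub>N\<^esub> n) = cadd W (k m) (k n)" if mn: "m \<in> carrier N" "n \<in> carrier N" for m n
  proof -
    have "h ((\<Phi> #>\<^bsub>N\<^esub> m) \<oplus>\<^bsub>M\<^esub> (\<Phi> #>\<^bsub>N\<^esub> n)) = h (\<Phi> #>\<^bsub>N\<^esub> m) \<oplus>\<^bsub>?A\<^esub> h (\<Phi> #>\<^bsub>N\<^esub> n)"
      using hom_mult[OF h_hom] class_in_M mn by simp
    then show ?thesis using k(2)[OF mn(1)] k(2)[OF mn(2)] k(2)[OF NG.m_closed[OF mn]] by (simp add: M_add[OF mn])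
  qed
  have k_act: "k (act q n) = cscale W (group_like Q TQ q) (k n)" if q: "q \<in> carrier Q" and n: "n \<in> carrier N" for q n
  proof -
    have "group_like Q TQ q \<odot>\<^bsub>M\<^esub> (\<Phi> #>\<^bsub>N\<^esub> n) = \<Phi> #>\<^bsub>N\<^esub> act q n"
      using s_act[OF q n] by (simp add: module_of_group_def)
    then have "h (\<Phi> #>\<^bsub>N\<^esub> act q n) = encode (cscale W (group_like Q TQ q) (k n))"
      using h_scal[OF group_like_closed[OF q] class_in_M[OF n]] k(2)[OF n] by simp
    then show ?thesis by (simp add: k_def)
  qed
  have k_dif: "dif (k n) = g0 n" if n: "n \<in> carrier N" for n
    using h(2)[OF class_in_M[OF n]] g(2)[OF n] k(2)[OF n] by (simp add: f_def)
  define one where "one = \<one>\<^bsub>Q Mod W\<^esub>"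
  have one: "one \<in> cosets W" "\<And>C. C \<in> cosets W \<Longrightarrow> C \<otimes>\<^bsub>Q Mod W\<^esub> one = C" "\<And>C. C \<in> cosets W \<Longrightarrow> one \<otimes>\<^bsub>Q Mod W\<^esub> C = C"
    using P.one_closed P.r_one P.l_one unfolding one_def by blast+
  have K1c: "F \<in> cfun W" if "F \<in> K1" for F using K1 that unfolding csub_def by blast
  define e where "e n = k n one one" for n
  have e_add: "[e (m \<otimes>\<^bsub>N\<^esub> n) = e m + e n] (mod int p)" if "m \<in> carrier N" "n \<in> carrier N" for m n
    unfolding e_def k_add[OF that] cvalues[OF one(1,1)] by (simp add: cong_def)
  have e_open: "openin TN {n \<in> carrier N. [e n = 0] (mod int p)}"
  proof -
    let ?U = "{x \<in> encode ` K1. decode x one one = 0} :: (('q set \<Rightarrow> 'q set \<Rightarrow> int) + 'n set) test set"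
    have "openin TM {x \<in> topspace TM. h x \<in> ?U}"
      by (rule openin_continuous_map_preimage[OF h_cont]) auto
    then have "openin TN {n \<in> carrier N. \<Phi> #>\<^bsub>N\<^esub> n \<in> {x \<in> topspace TM. h x \<in> ?U}}"
      unfolding TM_openin by blast
    moreover have eqv: "\<Phi> #>\<^bsub>N\<^esub> n \<in> {x \<in> topspace TM. h x \<in> ?U} \<longleftrightarrow> [e n = 0] (mod int p)" if n: "n \<in> carrier N" for n
      using k[OF n] class_in_M[OF n] cfunD(3)[OF K1c[OF k(1)[OF n]] one(1,1)]
      by (auto simp: TM_topspace e_def cong_def)
    moreover have "{n \<in> carrier N. \<Phi> #>\<^bsub>N\<^esub> n \<in> {x \<in> topspace TM. h x \<in> ?U}} = {n \<in> carrier N. [e n = 0] (mod int p)}"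
      using eqv by blast
    ultimately show ?thesis by simp
  qed
  have e_act: "[e (act q n) = e n + b q n] (mod int p)" if q: "q \<in> carrier Q" and n: "n \<in> carrier N" for q n
  proof -
    let ?q = "W #>\<^bsub>Q\<^esub> q"
    have qc: "?q \<in> cosets W" using coset_in[OF W q] .
    obtain \<phi> where \<phi>: "k n = con \<phi>" using k_con[OF n] by blast
    have "e (act q n) = k n one ?q"
      unfolding e_def k_act[OF q n] cscale_group_like[OF W q K1c[OF k(1)[OF n]] one(1,1)] one(3)[OF qc] ..
    then have 1: "e (act q n) = \<phi> ?q" unfolding \<phi> con_val[OF one(1) qc] .
    have 2: "e n = \<phi> one" unfolding e_def \<phi> con_val[OF one(1,1)] ..
    \<comment> \<open>At the pair of the coset of \<open>q\<close> and \<open>one\<close>, the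
      lifting equation compares \<open>\<phi> ?q - \<phi> one\<close>, which is
      \<open>e (act q n) - e n\<close>, with the difference of the values of
      \<open>\<beta> n\<close>, which is \<open>b q n\<close> modulo p.\<close>
    have "dif (k n) ?q one = g0 n ?q one" using k_dif[OF n] by simp
    then have "[\<phi> ?q - \<phi> one = \<beta> n ?q - \<beta> n one] (mod int p)"
      unfolding dif_val[OF qc one(1)] g0_val[OF qc one(1)] one(2)[OF qc] \<phi> con_val[OF qc qc] con_val[OF qc one(1)]
      by (simp add: cong_def)
    moreover have "[\<beta> n ?q - \<beta> n one = b q n - 0] (mod int p)"
    proof (rule cong_diff[OF \<beta>[OF q n]])
      have "one = W #>\<^bsub>Q\<^esub> \<one>\<^bsub>Q\<^esub>" using QG.coset_mult_one[OF subgroup.subset[OF Wsub]] by (simp add: one_def)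
      then have "[\<beta> n one = b \<one>\<^bsub>Q\<^esub> n] (mod int p)" using \<beta>[OF QG.one_closed n] by simp
      then show "[\<beta> n one = 0] (mod int p)" using bW[OF subgroup.one_closed[OF Wsub] n] cong_trans by blast
    qed
    ultimately have "[\<phi> ?q - \<phi> one = b q n - 0] (mod int p)" by (rule cong_trans)
    then have "[\<phi> one + (\<phi> ?q - \<phi> one) = \<phi> one + (b q n - 0)] (mod int p)" by (intro cong_add) auto
    then show ?thesis unfolding 1 2 by simp
  qed
  have "e \<in> fp_chars p N TN" using e_add e_open by (simp add: fp_chars_def)
  then show ?thesis using e_act by blast
qed

end

section \<open>Equivariant homomorphisms into finite p-groups\<close>

lemma fp_charsI:
  assumes p: "p > 0" and N: "topological_group N T"
    and add: "\<And>m n. m \<in> carrier N \<Longrightarrow> n \<in> carrier N \<Longrightarrow> [e (m \<otimes>\<^bsub>N\<^esub> n) = e m + e n] (mod int p)"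
    and V: "openin T V" "\<one>\<^bsub>N\<^esub> \<in> V" "\<And>n. n \<in> V \<Longrightarrow> [e n = 0] (mod int p)"
  shows "e \<in> fp_chars p N T"
proof -
  have "(\<lambda>n. e n mod int p) \<in> hom N (integer_mod_group p)"
    using add p by (auto simp: hom_def carrier_integer_mod_group cong_def mod_add_eq)
  then have "continuous_hom N T (integer_mod_group p) (discrete_on (integer_mod_group p)) (\<lambda>n. e n mod int p)"
    using V by (intro continuous_hom_kernel_superset[OF N _ _ V(1,2)]) (auto simp: cong_def)
  then show ?thesis using add continuous_hom_discreteD(2)[OF N group_integer_mod_group]
    by (force simp: fp_chars_def cong_def)
qed

lemma fp_chars_linear:
  assumes p: "p > 0" and N: "topological_group N T" and d: "d \<in> fp_chars p N T" and e: "e \<in> fp_chars p N T"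
  shows "(\<lambda>n. d n + k * e n) \<in> fp_chars p N T"
proof (rule fp_charsI[OF p N])
  let ?V = "{n \<in> carrier N. [d n = 0] (mod int p)} \<inter> {n \<in> carrier N. [e n = 0] (mod int p)}"
  show "openin T ?V" using fp_charsD(2)[OF d] fp_charsD(2)[OF e] by blast
  show "\<one>\<^bsub>N\<^esub> \<in> ?V"
    using subgroup.one_closed[OF fp_char_kernel(1)[OF p N d]] subgroup.one_closed[OF fp_char_kernel(1)[OF p N e]] by blast
  show "[d n + k * e n = 0] (mod int p)" if "n \<in> ?V" for n
    using cong_add[of "d n" 0 "int p" "k * e n" "k * 0"] cong_mult[of k k "int p" "e n" 0] that by simp
  show "[d (m \<otimes>\<^bsub>N\<^esub> n) + k * e (m \<otimes>\<^bsub>N\<^esub> n) = d m + k * e m + (d n + k * e n)] (mod int p)"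
    if "m \<in> carrier N" "n \<in> carrier N" for m n
  proof -
    have "[d (m \<otimes>\<^bsub>N\<^esub> n) + k * e (m \<otimes>\<^bsub>N\<^esub> n) = (d m + d n) + k * (e m + e n)] (mod int p)"
      by (intro cong_add cong_mult fp_charsD(1)[OF d that] fp_charsD(1)[OF e that] cong_refl)
    then show ?thesis by (simp add: algebra_simps)
  qed
qed

lemma fp_chars_zero: "topological_group N T \<Longrightarrow> (\<lambda>_. 0) \<in> fp_chars p N T"
  using topological_groupD(2)[of N T] openin_topspace[of T] by (simp add: fp_chars_def)

section \<open>Lifts along a central subgroup of order p\<close>

locale central_p_element = group K for K (structure) +
  fixes p :: nat and c
  assumes c: "prime p" "c \<in> carrier K" "c \<noteq> \<one>" "c [^] p = \<one>"
    and central: "\<And>x. x \<in> carrier K \<Longrightarrow> x \<otimes> c = c \<otimes> x"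
begin

lemmas pow_eq = int_pow_eq_iff_cong_prime[OF c]

lemma pow_closed: "c [^] (i :: int) \<in> carrier K" using c by simp

lemma pow_central: "x \<in> carrier K \<Longrightarrow> x \<otimes> c [^] (i :: int) = c [^] i \<otimes> x"
  by (rule int_pow_central[OF c(2) central])

lemma pow_add: "c [^] (i + j :: int) = c [^] i \<otimes> c [^] j" using int_pow_mult[OF c(2)] .

lemma mult_pow:
  assumes "x \<in> carrier K" "y \<in> carrier K"
  shows "(x \<otimes> c [^] (i :: int)) \<otimes> (y \<otimes> c [^] (j :: int)) = (x \<otimes> y) \<otimes> c [^] (i + j)"
proof -
  have "(x \<otimes> c [^] i) \<otimes> (y \<otimes> c [^] j) = x \<otimes> (c [^] i \<otimes> y) \<otimes> c [^] j"
    using assms pow_closed by (simp add: m_assoc)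
  also have "\<dots> = x \<otimes> (y \<otimes> c [^] i) \<otimes> c [^] j" using pow_central[OF assms(2), of i] by simp
  also have "\<dots> = (x \<otimes> y) \<otimes> c [^] (i + j)"
    using assms pow_closed by (simp add: pow_add m_assoc)
  finally show ?thesis .
qed

lemma conj_pow:
  assumes "x \<in> carrier K" "y \<in> carrier K"
  shows "y \<otimes> (x \<otimes> c [^] (i :: int)) \<otimes> inv y = (y \<otimes> x \<otimes> inv y) \<otimes> c [^] i"
  using assms pow_closed by (simp add: m_assoc pow_central[of "inv y"])

lemma pow_cancel:
  assumes "x \<in> carrier K" "x \<otimes> c [^] (i :: int) = x \<otimes> c [^] (j :: int)"
  shows "[i = j] (mod int p)"
  using assms pow_closed by (simp add: pow_eq)

text \<open>Because \<open>c\<close> is central, the exponent by which two homomorphisms differ is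
  additive. With the converse \<open>twist_continuous_hom\<close>, the lifts of a fixed map form a
  torsor under the characters.\<close>

lemma difference_char:
  assumes N: "topological_group N T"
    and f: "continuous_hom N T K (discrete_on K) f" and g: "continuous_hom N T K (discrete_on K) g"
    and ex: "\<And>n. n \<in> carrier N \<Longrightarrow> \<exists>i :: int. f n = g n \<otimes> c [^] i"
  obtains e where "e \<in> fp_chars p N T" "\<And>n. n \<in> carrier N \<Longrightarrow> f n = g n \<otimes> c [^] (e n :: int)"
proof -
  interpret N: group N using topological_groupD[OF N] by simp
  note F = continuous_hom_discreteD[OF N is_group f] and G = continuous_hom_discreteD[OF N is_group g]
  obtain e where e: "\<And>n. n \<in> carrier N \<Longrightarrow> f n = g n \<otimes> c [^] (e n :: int)" using ex by metis
  have "e \<in> fp_chars p N T"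
  proof (rule fp_charsI[OF _ N])
    show "p > 0" using c(1) by (rule prime_gt_0_nat)
    show "openin T ({n \<in> carrier N. f n = \<one>} \<inter> {n \<in> carrier N. g n = \<one>})" using F(2) G(2) by blast
    show "\<one>\<^bsub>N\<^esub> \<in> {n \<in> carrier N. f n = \<one>} \<inter> {n \<in> carrier N. g n = \<one>}" using F(5) G(5) by simp
    show "[e n = 0] (mod int p)" if n: "n \<in> {n \<in> carrier N. f n = \<one>} \<inter> {n \<in> carrier N. g n = \<one>}" for n
      by (rule pow_cancel[of "g n"]) (use e[of n] n in auto)
    fix m n assume mn: "m \<in> carrier N" "n \<in> carrier N"
    have "g (m \<otimes>\<^bsub>N\<^esub> n) \<otimes> c [^] e (m \<otimes>\<^bsub>N\<^esub> n) = (g m \<otimes> c [^] e m) \<otimes> (g n \<otimes> c [^] e n)"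
      using e mn F(4) by (metis N.m_closed)
    also have "\<dots> = g (m \<otimes>\<^bsub>N\<^esub> n) \<otimes> c [^] (e m + e n)" using mult_pow G(3,4) mn by simp
    finally show "[e (m \<otimes>\<^bsub>N\<^esub> n) = e m + e n] (mod int p)" using pow_cancel G(3) mn by blast
  qed
  then show thesis using that e by blast
qed

lemma twist_continuous_hom:
  assumes N: "topological_group N T"
    and f: "continuous_hom N T K (discrete_on K) f" and e: "e \<in> fp_chars p N T"
  shows "continuous_hom N T K (discrete_on K) (\<lambda>n. f n \<otimes> c [^] (e n :: int))"
proof (rule continuous_hom_kernel_superset[OF N is_group])
  interpret N: group N using topological_groupD[OF N] by simp
  note F = continuous_hom_discreteD[OF N is_group f]
  have p: "p > 0" using c(1) by (rule prime_gt_0_nat)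
  show "(\<lambda>n. f n \<otimes> c [^] e n) \<in> hom N K"
  proof (rule homI)
    fix m n assume mn: "m \<in> carrier N" "n \<in> carrier N"
    have "c [^] e (m \<otimes>\<^bsub>N\<^esub> n) = c [^] (e m + e n)" using pow_eq fp_charsD(1)[OF e mn] by blast
    then show "f (m \<otimes>\<^bsub>N\<^esub> n) \<otimes> c [^] e (m \<otimes>\<^bsub>N\<^esub> n) = (f m \<otimes> c [^] e m) \<otimes> (f n \<otimes> c [^] e n)"
      using F(3,4) mn mult_pow by simp
  qed (use F(3) pow_closed in simp)
  let ?V = "{n \<in> carrier N. f n = \<one>} \<inter> {n \<in> carrier N. [e n = 0] (mod int p)}"
  show "openin T ?V" using F(2) fp_charsD(2)[OF e] by blast
  show "\<one>\<^bsub>N\<^esub> \<in> ?V" using F(5) subgroup.one_closed[OF fp_char_kernel(1)[OF p N e]] by simp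
  show "f n \<otimes> c [^] e n = \<one>" if "n \<in> ?V" for n
  proof -
    have "c [^] e n = c [^] (0 :: int)" unfolding pow_eq using that by simp
    then show ?thesis using that by simp
  qed
qed

end

lemma infinite_test: "infinite (UNIV :: 'a test set)"
proof -
  have "inj (\<lambda>n. {{Inl n}} :: 'a test)" by (rule injI) simp
  then have "infinite (range (\<lambda>n. {{Inl n}} :: 'a test))" by (rule range_inj_infinite)
  then show ?thesis by (rule infinite_super[OF subset_UNIV])
qed

text \<open>\<open>act_small\<close> expresses continuity of the action in \<open>q\<close> at 1,
  uniformly in \<open>n\<close>. The uniformity is what lets the obstruction cocycle come from a
  finite quotient of \<open>Q\<close>.\<close>

locale equivariant_free = projective_frattini_quotient p Q TQ N TN act s
  for p and Q :: "'q monoid" and TQ and N :: "'n monoid" and TN and act s +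
  fixes S :: "'n set"
  assumes free: "free_pro_p_on p N TN S"
    and act_hom: "\<And>q. q \<in> carrier Q \<Longrightarrow> act q \<in> hom N N"
    and act_mult: "\<And>q q' n. q \<in> carrier Q \<Longrightarrow> q' \<in> carrier Q \<Longrightarrow> n \<in> carrier N \<Longrightarrow>
      act (q \<otimes>\<^bsub>Q\<^esub> q') n = act q (act q' n)"
    and act_continuous: "\<And>q. q \<in> carrier Q \<Longrightarrow> continuous_map TN TN (act q)"
    and act_small: "\<And>U. openin TN U \<Longrightarrow> \<one>\<^bsub>N\<^esub> \<in> U \<Longrightarrow>
      \<exists>W\<in>ONS. \<forall>w\<in>W. \<forall>n\<in>carrier N. act w n \<otimes>\<^bsub>N\<^esub> inv\<^bsub>N\<^esub> n \<in> U"
begin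

lemma S_converges: "converges_to_one N TN S (\<lambda>x. x)"
  using free by (simp add: free_pro_p_on_def)

lemma S_subset: "S \<subseteq> carrier N"
  using S_converges by (auto simp: converges_to_one_def)

lemma finite_outside: "subgroup U N \<Longrightarrow> openin TN U \<Longrightarrow> finite {x \<in> S. x \<notin> U}"
  using S_converges by (auto simp: converges_to_one_def)

lemma free_test:
  fixes H :: "'n test monoid"
  assumes "pro_p_group p H TH" "converges_to_one H TH S \<phi>"
  shows "\<exists>!h. h \<in> extensional (carrier N) \<and> continuous_hom N TN H TH h \<and> (\<forall>x\<in>S. h x = \<phi> x)"
  using free assms unfolding free_pro_p_on_def by blast

text \<open>Freeness is tested on \<open>'n test\<close> only, so a finite target is replaced by a
  copy on that type and homomorphisms are carried back along \<open>g\<close>.\<close>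

lemma finite_test_copy:
  assumes K: "group K" "order K = p ^ k"
  obtains K' :: "'n test monoid" and f g where "group K'" "pro_p_group p K' (discrete_on K')"
    "f \<in> hom K K'" "g \<in> hom K' K" "\<And>x. x \<in> carrier K \<Longrightarrow> g (f x) = x" "\<And>x. x \<in> carrier K' \<Longrightarrow> f (g x) = x"
proof -
  have "finite (carrier K)" using prime_power_order_finite[OF prime K(2)] .
  then obtain K' :: "'n test monoid" and f where K': "group K'" "f \<in> iso K K'" "finite (carrier K')"
    using finite_group_isomorphic_copy[OF K(1) _ infinite_test] by blast
  have "order K' = p ^ k" using iso_same_card K'(2) K(2) unfolding is_iso_def order_def by (metis empty_iff)
  then have pp: "pro_p_group p K' (discrete_on K')" by (rule prime_power_order_discrete_pro_p[OF prime K'(1)])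
  have "inv_into (carrier K) f \<in> iso K' K" using group.iso_set_sym[OF K(1) K'(2)] .
  then show thesis
    using that[OF K'(1) pp, of f "inv_into (carrier K) f"] K'(2)
    by (auto simp: iso_def bij_betw_def f_inv_into_f)
qed

lemma discrete_continuous_hom_compose:
  assumes "continuous_hom N TN K (discrete_on K) h" "f \<in> hom K K'"
  shows "continuous_hom N TN K' (discrete_on K') (\<lambda>x. f (h x))"
  by (rule continuous_hom_compose[OF assms(1)]) (use assms(2) in \<open>auto simp: continuous_hom_def hom_def\<close>)

lemma free_hom_exists:
  assumes K: "group K" "order K = p ^ k" and \<phi>: "\<phi> \<in> S \<rightarrow> carrier K" "finite {x \<in> S. \<phi> x \<noteq> \<one>\<^bsub>K\<^esub>}"
  obtains h where "continuous_hom N TN K (discrete_on K) h" "\<And>x. x \<in> S \<Longrightarrow> h x = \<phi> x"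
proof -
  obtain K' :: "'n test monoid" and f g where K': "group K'" "pro_p_group p K' (discrete_on K')"
    and fg: "f \<in> hom K K'" "g \<in> hom K' K" "\<And>x. x \<in> carrier K \<Longrightarrow> g (f x) = x" "\<And>x. x \<in> carrier K' \<Longrightarrow> f (g x) = x"
    using finite_test_copy[OF K] by metis
  have conv: "converges_to_one K' (discrete_on K') S (\<lambda>x. f (\<phi> x))"
  proof (rule converges_to_one_discrete)
    show "(\<lambda>x. f (\<phi> x)) \<in> S \<rightarrow> carrier K'" using \<phi>(1) hom_in_carrier[OF fg(1)] by auto
    have f1: "f \<one>\<^bsub>K\<^esub> = \<one>\<^bsub>K'\<^esub>" using hom_one[OF fg(1) K(1) K'(1)] .
    have "f (\<phi> x) \<noteq> \<one>\<^bsub>K'\<^esub> \<Longrightarrow> \<phi> x \<noteq> \<one>\<^bsub>K\<^esub>" for x using f1 by metis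
    then show "finite {x \<in> S. f (\<phi> x) \<noteq> \<one>\<^bsub>K'\<^esub>}" by (intro rev_finite_subset[OF \<phi>(2)]) blast
  qed
  obtain h where h: "continuous_hom N TN K' (discrete_on K') h" "\<forall>x\<in>S. h x = f (\<phi> x)"
    using ex1_implies_ex[OF free_test[OF K'(2) conv]] by blast
  show thesis
    using that[OF discrete_continuous_hom_compose[OF h(1) fg(2)]] h(2) fg(3) \<phi>(1) by auto
qed

lemma free_hom_unique:
  assumes K: "group K" "order K = p ^ k"
    and h: "continuous_hom N TN K (discrete_on K) h1" "continuous_hom N TN K (discrete_on K) h2"
    and eq: "\<And>x. x \<in> S \<Longrightarrow> h1 x = h2 x" and n: "n \<in> carrier N"
  shows "h1 n = h2 n"
proof -
  obtain K' :: "'n test monoid" and f g where K': "group K'" "pro_p_group p K' (discrete_on K')"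
    and fg: "f \<in> hom K K'" "g \<in> hom K' K" "\<And>x. x \<in> carrier K \<Longrightarrow> g (f x) = x" "\<And>x. x \<in> carrier K' \<Longrightarrow> f (g x) = x"
    using finite_test_copy[OF K] by metis
  \<comment> \<open>Uniqueness in the universal property concerns extensional functions, hence the
    restriction to the carrier.\<close>
  let ?r = "\<lambda>h. restrict (\<lambda>x. f (h x)) (carrier N)"
  have r: "continuous_hom N TN K' (discrete_on K') (?r h)" if "continuous_hom N TN K (discrete_on K) h" for h
    by (rule continuous_hom_restrict[OF discrete_continuous_hom_compose[OF that fg(1)] N])
  have conv: "converges_to_one K' (discrete_on K') S (\<lambda>x. f (h1 x))"
    by (rule converges_to_one_hom[OF N K'(1) discrete_continuous_hom_compose[OF h(1) fg(1)] S_converges])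
  define P where "P h \<longleftrightarrow> h \<in> extensional (carrier N) \<and> continuous_hom N TN K' (discrete_on K') h
      \<and> (\<forall>x\<in>S. h x = f (h1 x))" for h
  have "\<exists>!h. P h" unfolding P_def by (rule free_test[OF K'(2) conv])
  moreover have "P (?r h1)" using r[OF h(1)] S_subset by (auto simp: P_def)
  moreover have "P (?r h2)" using r[OF h(2)] S_subset eq by (auto simp: P_def)
  ultimately have "?r h1 = ?r h2" by blast
  then have "?r h1 n = ?r h2 n" by simp
  then have "g (f (h1 n)) = g (f (h2 n))" using n by simp
  then show ?thesis
    using fg(3) continuous_hom_discreteD(3)[OF N K(1) h(1) n] continuous_hom_discreteD(3)[OF N K(1) h(2) n] by simp
qed

text \<open>Modulo p, such a character and zero are homomorphisms to Z/p agreeing on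
  \<open>S\<close>, so freeness identifies them.\<close>

lemma char_zero_on_basis:
  assumes e: "e \<in> fp_chars p N TN" and z: "\<And>x. x \<in> S \<Longrightarrow> [e x = 0] (mod int p)" and n: "n \<in> carrier N"
  shows "[e n = 0] (mod int p)"
proof -
  have "order (integer_mod_group p) = p ^ 1" using p_pos by (simp add: order_def carrier_integer_mod_group)
  moreover have "continuous_hom N TN (integer_mod_group p) (discrete_on (integer_mod_group p)) (\<lambda>_. 0)"
    using p_pos by (auto simp: continuous_hom_def hom_def carrier_integer_mod_group)
  ultimately have "e n mod int p = 0"
    using free_hom_unique[OF group_integer_mod_group _ fp_char_continuous[OF p_pos N e], of 1 "\<lambda>_. 0"] z n
    by (simp add: cong_def)
  then show ?thesis by (simp add: cong_def)
qed

section \<open>Invariant characters and the set \<open>X\<close>\<close>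

definition invariant_chars :: "('n \<Rightarrow> int) set" where
  "invariant_chars = {e \<in> fp_chars p N TN. \<forall>q\<in>carrier Q. \<forall>n\<in>carrier N. [e (act q n) = e n] (mod int p)}"

lemma char_finite_support:
  assumes "e \<in> fp_chars p N TN" shows "finite {x \<in> S. \<not> [e x = 0] (mod int p)}"
proof -
  have "finite {x \<in> S. x \<notin> {n \<in> carrier N. [e n = 0] (mod int p)}}"
    using finite_outside fp_char_kernel(1)[OF p_pos N assms] fp_charsD(2)[OF assms] by blast
  then show ?thesis by (rule rev_finite_subset) auto
qed

text \<open>Convergence of \<open>S\<close> to 1 gives characters the finite support that the
  echelon argument needs. Since characters are determined by their values on \<open>S\<close>,
  injectivity of restriction to \<open>X\<close> carries over from \<open>S\<close> to all of
  \<open>N\<close>.\<close>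

lemma dual_basis_subset:
  "\<exists>X\<subseteq>S. (\<forall>e\<in>invariant_chars. (\<forall>x\<in>X. [e x = 0] (mod int p)) \<longrightarrow> (\<forall>n\<in>carrier N. [e n = 0] (mod int p))) \<and>
     (\<forall>f. finite {x \<in> X. \<not> [f x = 0] (mod int p)} \<longrightarrow> (\<exists>e\<in>invariant_chars. \<forall>x\<in>X. [e x = f x] (mod int p)))"
proof (rule echelon_positions[OF prime, of invariant_chars S])
  show "(\<lambda>_. 0) \<in> invariant_chars" unfolding invariant_chars_def using fp_chars_zero[OF N] by simp
  show "(\<lambda>n. d n + k * e n) \<in> invariant_chars" if de: "d \<in> invariant_chars" "e \<in> invariant_chars" for d e k
    unfolding invariant_chars_def
  proof (intro CollectI conjI ballI)
    show "(\<lambda>n. d n + k * e n) \<in> fp_chars p N TN"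
      using fp_chars_linear[OF p_pos N] de unfolding invariant_chars_def by blast
    fix q n assume "q \<in> carrier Q" "n \<in> carrier N"
    then show "[d (act q n) + k * e (act q n) = d n + k * e n] (mod int p)"
      using de unfolding invariant_chars_def by (intro cong_add cong_mult cong_refl) blast+
  qed
  show "finite {x \<in> S. \<not> [d x = 0] (mod int p)}" if "d \<in> invariant_chars" for d
    using char_finite_support that unfolding invariant_chars_def by blast
  fix X assume X: "X \<subseteq> S"
    "\<And>d s. d \<in> invariant_chars \<Longrightarrow> (\<And>x. x \<in> X \<Longrightarrow> [d x = 0] (mod int p)) \<Longrightarrow> s \<in> S \<Longrightarrow> [d s = 0] (mod int p)"
    "\<And>f. finite {x \<in> X. \<not> [f x = 0] (mod int p)} \<Longrightarrow> \<exists>d\<in>invariant_chars. \<forall>x\<in>X. [d x = f x] (mod int p)"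
  show ?thesis
  proof (intro exI[of _ X] conjI X(1) ballI allI impI)
    fix e n assume e: "e \<in> invariant_chars" "\<forall>x\<in>X. [e x = 0] (mod int p)" "n \<in> carrier N"
    have "[e s = 0] (mod int p)" if "s \<in> S" for s by (rule X(2)[OF e(1) _ that]) (use e(2) in blast)
    then show "[e n = 0] (mod int p)"
      using char_zero_on_basis[OF _ _ e(3)] e(1) by (simp add: invariant_chars_def)
  qed (rule X(3))
qed

text \<open>The condition under which homomorphisms \<open>f\<close> on \<open>N\<close> and
  \<open>\<beta>\<close> on \<open>Q\<close> combine to one on the semidirect product.\<close>

definition equivariant :: "('b, 'm) monoid_scheme \<Rightarrow> ('q \<Rightarrow> 'b) \<Rightarrow> ('n \<Rightarrow> 'b) \<Rightarrow> bool" where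
  "equivariant K \<beta> f \<longleftrightarrow>
     (\<forall>q\<in>carrier Q. \<forall>n\<in>carrier N. f (act q n) = \<beta> q \<otimes>\<^bsub>K\<^esub> f n \<otimes>\<^bsub>K\<^esub> inv\<^bsub>K\<^esub> \<beta> q)"

lemma equivariantD:
  "equivariant K \<beta> f \<Longrightarrow> q \<in> carrier Q \<Longrightarrow> n \<in> carrier N \<Longrightarrow>
    f (act q n) = \<beta> q \<otimes>\<^bsub>K\<^esub> f n \<otimes>\<^bsub>K\<^esub> inv\<^bsub>K\<^esub> \<beta> q"
  by (simp add: equivariant_def)

lemma equivariant_compose:
  assumes "group K" "group K'" "\<kappa> \<in> hom K K'" "equivariant K \<beta> f"
    and "\<And>q. q \<in> carrier Q \<Longrightarrow> \<beta> q \<in> carrier K" "\<And>n. n \<in> carrier N \<Longrightarrow> f n \<in> carrier K"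
  shows "equivariant K' (\<lambda>q. \<kappa> (\<beta> q)) (\<lambda>n. \<kappa> (f n))"
proof -
  interpret group_hom K K' \<kappa> using assms by (simp add: group_hom_def group_hom_axioms_def)
  show ?thesis using assms(4-6) by (simp add: equivariant_def)
qed

end

locale equivariant_free_basis = equivariant_free p Q TQ N TN act s S
  for p and Q :: "'q monoid" and TQ and N :: "'n monoid" and TN and act s S +
  fixes X
  assumes X_subset: "X \<subseteq> S"
    and X_inj: "\<And>e n. e \<in> invariant_chars \<Longrightarrow> (\<And>x. x \<in> X \<Longrightarrow> [e x = 0] (mod int p)) \<Longrightarrow> n \<in> carrier N \<Longrightarrow> [e n = 0] (mod int p)"
    and X_surj: "\<And>f. finite {x \<in> X. \<not> [f x = 0] (mod int p)} \<Longrightarrow> \<exists>e\<in>invariant_chars. \<forall>x\<in>X. [e x = f x] (mod int p)"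
begin

text \<open>By induction the two maps agree modulo the powers of \<open>c\<close>, so they differ by
  a character. Conjugation does not see a central factor, which makes this character invariant; it
  vanishes on \<open>X\<close>, hence everywhere. With \<open>K\<close> on the fixed type
  \<open>nat\<close>, the induction hypothesis applies to the central quotient.\<close>

lemma finite_equivariant_unique:
  fixes K :: "nat monoid"
  assumes "group K" "order K = p ^ k" "\<beta> \<in> hom Q K"
    and "continuous_hom N TN K (discrete_on K) f" "continuous_hom N TN K (discrete_on K) g"
    and "equivariant K \<beta> f" "equivariant K \<beta> g" "\<And>x. x \<in> X \<Longrightarrow> f x = g x" and "n \<in> carrier N"
  shows "f n = g n"
  using assms
proof (induct "order K" arbitrary: K k \<beta> f g n rule: less_induct)
  case less
  note K = less.prems(1,2)
  interpret K: group K by (rule K)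
  note F = continuous_hom_discreteD[OF N K(1) less.prems(4)] and G = continuous_hom_discreteD[OF N K(1) less.prems(5)]
  have \<beta>c: "\<And>q. q \<in> carrier Q \<Longrightarrow> \<beta> q \<in> carrier K" using hom_in_carrier[OF less.prems(3)] .
  show ?case
  proof (cases "k = 0")
    case True
    then have "order K = 1" using K(2) by simp
    then obtain a where "carrier K = {a}" unfolding order_def by (rule card_1_singletonE)
    then show ?thesis using F(3)[OF less.prems(9)] G(3)[OF less.prems(9)] by simp
  next
    case False
    then have k0: "k > 0" by simp
    obtain c and K' :: "nat monoid" and \<kappa> j where
      c: "c \<in> carrier K" "c \<noteq> \<one>\<^bsub>K\<^esub>" "c [^]\<^bsub>K\<^esub> p = \<one>\<^bsub>K\<^esub>" "\<And>x. x \<in> carrier K \<Longrightarrow> x \<otimes>\<^bsub>K\<^esub> c = c \<otimes>\<^bsub>K\<^esub> x"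
      and K': "group K'" "order K' = p ^ j" "order K' < order K" and \<kappa>: "\<kappa> \<in> hom K K'" "\<kappa> ` carrier K = carrier K'"
      and ker: "\<And>x y. x \<in> carrier K \<Longrightarrow> y \<in> carrier K \<Longrightarrow> \<kappa> x = \<kappa> y \<longleftrightarrow> (\<exists>i::int. x = y \<otimes>\<^bsub>K\<^esub> c [^]\<^bsub>K\<^esub> i)"
      by (rule K.prime_power_order_central_quotient[OF prime K(2) k0]) (rule that)
    interpret C: central_p_element K p c by unfold_locales (use prime c in auto)
    have same: "\<kappa> (f n) = \<kappa> (g n)" if "n \<in> carrier N" for n
    proof (rule less.hyps[OF K'(3,1,2)])
      show "(\<lambda>q. \<kappa> (\<beta> q)) \<in> hom Q K'" using Group.hom_compose[OF less.prems(3) \<kappa>(1)] by (simp add: comp_def)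
      show "continuous_hom N TN K' (discrete_on K') (\<lambda>n. \<kappa> (f n))"
        by (rule discrete_continuous_hom_compose[OF less.prems(4) \<kappa>(1)])
      show "continuous_hom N TN K' (discrete_on K') (\<lambda>n. \<kappa> (g n))"
        by (rule discrete_continuous_hom_compose[OF less.prems(5) \<kappa>(1)])
      show "equivariant K' (\<lambda>q. \<kappa> (\<beta> q)) (\<lambda>n. \<kappa> (f n))" "equivariant K' (\<lambda>q. \<kappa> (\<beta> q)) (\<lambda>n. \<kappa> (g n))"
        by (intro equivariant_compose[OF K(1) K'(1) \<kappa>(1)] less.prems \<beta>c F G; assumption)+
      show "\<And>x. x \<in> X \<Longrightarrow> \<kappa> (f x) = \<kappa> (g x)" using less.prems(8) by simp
    qed (rule that)
    have ex: "\<exists>i::int. f n = g n \<otimes>\<^bsub>K\<^esub> c [^]\<^bsub>K\<^esub> i" if "n \<in> carrier N" for n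
      using ker[OF F(3)[OF that] G(3)[OF that]] same[OF that] by blast
    obtain e where e: "e \<in> fp_chars p N TN" "\<And>n. n \<in> carrier N \<Longrightarrow> f n = g n \<otimes>\<^bsub>K\<^esub> c [^]\<^bsub>K\<^esub> (e n :: int)"
      using C.difference_char[OF N less.prems(4,5) ex] by blast
    have "[e (act q n) = e n] (mod int p)" if q: "q \<in> carrier Q" and n: "n \<in> carrier N" for q n
    proof -
      have an: "act q n \<in> carrier N" using act_closed[OF q n] .
      have "g (act q n) \<otimes>\<^bsub>K\<^esub> c [^]\<^bsub>K\<^esub> e (act q n) = \<beta> q \<otimes>\<^bsub>K\<^esub> (g n \<otimes>\<^bsub>K\<^esub> c [^]\<^bsub>K\<^esub> e n) \<otimes>\<^bsub>K\<^esub> inv\<^bsub>K\<^esub> \<beta> q"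
        using e(2)[OF an] e(2)[OF n] equivariantD[OF less.prems(6) q n] by simp
      also have "\<dots> = g (act q n) \<otimes>\<^bsub>K\<^esub> c [^]\<^bsub>K\<^esub> e n"
        unfolding C.conj_pow[OF G(3)[OF n] \<beta>c[OF q]] equivariantD[OF less.prems(7) q n] ..
      finally show ?thesis by (rule C.pow_cancel[OF G(3)[OF an]])
    qed
    then have inv: "e \<in> invariant_chars" using e(1) by (simp add: invariant_chars_def)
    have "[e x = 0] (mod int p)" if "x \<in> X" for x
    proof -
      have xN: "x \<in> carrier N" using that X_subset S_subset by blast
      show ?thesis
        by (rule C.pow_cancel[OF G(3)[OF xN]]) (use e(2)[OF xN] less.prems(8)[OF that] G(3)[OF xN] in simp)
    qed
    then have "[e n = 0] (mod int p)" using X_inj[OF inv] less.prems(9) by blast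
    then have "c [^]\<^bsub>K\<^esub> e n = c [^]\<^bsub>K\<^esub> (0::int)" using C.pow_eq by blast
    then show ?thesis using e(2)[OF less.prems(9)] G(3)[OF less.prems(9)] by simp
  qed
qed

text \<open>The induction lifts along a central extension by a group of order p: a lift on the free
  group \<open>N\<close> is made equivariant by the vanishing of cocycles and then adjusted on \<open>X\<close> by an
  invariant character.\<close>

lemma finite_equivariant_exists:
  fixes K :: "nat monoid"
  assumes "group K" "order K = p ^ k" "continuous_hom Q TQ K (discrete_on K) \<beta>"
    and "\<phi> \<in> X \<rightarrow> carrier K" "finite {x \<in> X. \<phi> x \<noteq> \<one>\<^bsub>K\<^esub>}"
  shows "\<exists>f. continuous_hom N TN K (discrete_on K) f \<and> equivariant K \<beta> f \<and> (\<forall>x\<in>X. f x = \<phi> x)"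
  using assms
proof (induct "order K" arbitrary: K k \<beta> \<phi> rule: less_induct)
  case less
  note K = less.prems(1,2) and \<phi> = less.prems(4,5)
  interpret K: group K by (rule K)
  interpret NG: group N by (rule N_group)
  note B = continuous_hom_discreteD[OF pgroups(2) K(1) less.prems(3)]
  have XN: "\<And>x. x \<in> X \<Longrightarrow> x \<in> carrier N" using X_subset S_subset by blast
  show ?case
  proof (cases "k = 0")
    case True
    then have "order K = 1" using K(2) by simp
    then obtain a where a: "carrier K = {a}" unfolding order_def by (rule card_1_singletonE)
    have "continuous_hom N TN K (discrete_on K) (\<lambda>_. \<one>\<^bsub>K\<^esub>)" by (simp add: continuous_hom_def hom_def)
    moreover have "equivariant K \<beta> (\<lambda>_. \<one>\<^bsub>K\<^esub>)" using B(3) by (simp add: equivariant_def)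
    moreover have "\<phi> x = \<one>\<^bsub>K\<^esub>" if "x \<in> X" for x using \<phi>(1) that a K.one_closed by (metis Pi_mem singletonD)
    ultimately show ?thesis by auto
  next
    case False
    then have k0: "k > 0" by simp
    obtain c and K' :: "nat monoid" and \<kappa> j where
      c: "c \<in> carrier K" "c \<noteq> \<one>\<^bsub>K\<^esub>" "c [^]\<^bsub>K\<^esub> p = \<one>\<^bsub>K\<^esub>" "\<And>x. x \<in> carrier K \<Longrightarrow> x \<otimes>\<^bsub>K\<^esub> c = c \<otimes>\<^bsub>K\<^esub> x"
      and K': "group K'" "order K' = p ^ j" "order K' < order K" and \<kappa>: "\<kappa> \<in> hom K K'" "\<kappa> ` carrier K = carrier K'"
      and ker: "\<And>x y. x \<in> carrier K \<Longrightarrow> y \<in> carrier K \<Longrightarrow> \<kappa> x = \<kappa> y \<longleftrightarrow> (\<exists>i::int. x = y \<otimes>\<^bsub>K\<^esub> c [^]\<^bsub>K\<^esub> i)"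
      by (rule K.prime_power_order_central_quotient[OF prime K(2) k0]) (rule that)
    interpret C: central_p_element K p c by unfold_locales (use prime c in auto)
    interpret \<kappa>: group_hom K K' \<kappa> using K K' \<kappa> by (simp add: group_hom_def group_hom_axioms_def)
    have "\<exists>f. continuous_hom N TN K' (discrete_on K') f \<and> equivariant K' (\<lambda>q. \<kappa> (\<beta> q)) f \<and> (\<forall>x\<in>X. f x = \<kappa> (\<phi> x))"
    proof (rule less.hyps[OF K'(3,1,2)])
      show "continuous_hom Q TQ K' (discrete_on K') (\<lambda>q. \<kappa> (\<beta> q))"
        by (rule continuous_hom_compose[OF less.prems(3)]) (use \<kappa> in \<open>auto simp: continuous_hom_def hom_def\<close>)
      show "(\<lambda>x. \<kappa> (\<phi> x)) \<in> X \<rightarrow> carrier K'" using Pi_mem[OF \<phi>(1)] by auto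
      show "finite {x \<in> X. \<kappa> (\<phi> x) \<noteq> \<one>\<^bsub>K'\<^esub>}" by (rule finite_subset[OF _ \<phi>(2)]) auto
    qed
    then obtain f where f: "continuous_hom N TN K' (discrete_on K') f"
      "equivariant K' (\<lambda>q. \<kappa> (\<beta> q)) f" "\<And>x. x \<in> X \<Longrightarrow> f x = \<kappa> (\<phi> x)" by blast
    note F = continuous_hom_discreteD[OF N K'(1) f(1)]
    \<comment> \<open>Lifts of the values of \<open>f\<close>, taken to be 1 wherever
      \<open>f\<close> is trivial: the support on \<open>S\<close> stays finite, so freeness
      applies.\<close>
    define \<psi> where "\<psi> x = (if f x = \<one>\<^bsub>K'\<^esub> then \<one>\<^bsub>K\<^esub> else (SOME y. y \<in> carrier K \<and> \<kappa> y = f x))" for x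
    have \<psi>: "\<psi> x \<in> carrier K" "\<kappa> (\<psi> x) = f x" if "x \<in> carrier N" for x
    proof -
      have "\<exists>y. y \<in> carrier K \<and> \<kappa> y = f x" using F(3)[OF that] \<kappa>(2) by (metis imageE)
      from someI_ex[OF this] show "\<psi> x \<in> carrier K" "\<kappa> (\<psi> x) = f x" by (auto simp: \<psi>_def)
    qed
    have fin_hom: "finite {x \<in> S. h x \<noteq> \<one>\<^bsub>H\<^esub>}"
      if H: "group H" and h: "continuous_hom N TN H (discrete_on H) h" for H :: "nat monoid" and h
      by (rule finite_support_discrete[OF H converges_to_one_hom[OF N H h S_converges]])
    have "finite {x \<in> S. \<psi> x \<noteq> \<one>\<^bsub>K\<^esub>}"
      by (rule finite_subset[OF _ fin_hom[OF K'(1) f(1)]]) (auto simp: \<psi>_def)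
    then obtain h where h: "continuous_hom N TN K (discrete_on K) h" "\<And>x. x \<in> S \<Longrightarrow> h x = \<psi> x"
      using free_hom_exists[OF K, of \<psi>] \<psi>(1) S_subset by blast
    note Hh = continuous_hom_discreteD[OF N K(1) h(1)]
    have \<kappa>h: "\<kappa> (h n) = f n" if "n \<in> carrier N" for n
      by (rule free_hom_unique[OF K'(1,2) discrete_continuous_hom_compose[OF h(1) \<kappa>(1)] f(1) _ that])
        (use h(2) \<psi>(2) S_subset in auto)
    \<comment> \<open>Conjugating \<open>h\<close> by \<open>\<beta> q\<close> and precomposing
      \<open>h\<close> with the action of \<open>q\<close> give two lifts of the same map, by
      equivariance of \<open>f\<close>. Their difference is the obstruction at
      \<open>q\<close>.\<close>
    have "\<exists>e. e \<in> fp_chars p N TN \<and> (\<forall>n\<in>carrier N. \<beta> q \<otimes>\<^bsub>K\<^esub> h n \<otimes>\<^bsub>K\<^esub> inv\<^bsub>K\<^esub> \<beta> q = h (act q n) \<otimes>\<^bsub>K\<^esub> c [^]\<^bsub>K\<^esub> (e n :: int))"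
      if q: "q \<in> carrier Q" for q
    proof -
      note Bq = B(3)[OF q]
      have conj: "(\<lambda>x. \<beta> q \<otimes>\<^bsub>K\<^esub> x \<otimes>\<^bsub>K\<^esub> inv\<^bsub>K\<^esub> \<beta> q) \<in> hom K K"
      proof (rule homI)
        fix x y assume xy: "x \<in> carrier K" "y \<in> carrier K"
        have "inv\<^bsub>K\<^esub> \<beta> q \<otimes>\<^bsub>K\<^esub> (\<beta> q \<otimes>\<^bsub>K\<^esub> z) = z" if "z \<in> carrier K" for z
          using that Bq by (simp add: K.m_assoc[symmetric])
        then show "\<beta> q \<otimes>\<^bsub>K\<^esub> (x \<otimes>\<^bsub>K\<^esub> y) \<otimes>\<^bsub>K\<^esub> inv\<^bsub>K\<^esub> \<beta> q
            = \<beta> q \<otimes>\<^bsub>K\<^esub> x \<otimes>\<^bsub>K\<^esub> inv\<^bsub>K\<^esub> \<beta> q \<otimes>\<^bsub>K\<^esub> (\<beta> q \<otimes>\<^bsub>K\<^esub> y \<otimes>\<^bsub>K\<^esub> inv\<^bsub>K\<^esub> \<beta> q)"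
          using xy Bq by (simp add: K.m_assoc)
      qed (use Bq in simp)
      have 1: "continuous_hom N TN K (discrete_on K) (\<lambda>n. \<beta> q \<otimes>\<^bsub>K\<^esub> h n \<otimes>\<^bsub>K\<^esub> inv\<^bsub>K\<^esub> \<beta> q)"
        by (rule discrete_continuous_hom_compose[OF h(1) conj])
      have 2: "continuous_hom N TN K (discrete_on K) (\<lambda>n. h (act q n))"
        by (rule continuous_hom_compose[OF _ h(1)]) (use act_hom[OF q] act_continuous[OF q] in \<open>simp add: continuous_hom_def\<close>)
      have ex: "\<exists>i::int. \<beta> q \<otimes>\<^bsub>K\<^esub> h n \<otimes>\<^bsub>K\<^esub> inv\<^bsub>K\<^esub> \<beta> q = h (act q n) \<otimes>\<^bsub>K\<^esub> c [^]\<^bsub>K\<^esub> i" if n: "n \<in> carrier N" for n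
      proof -
        have "\<kappa> (\<beta> q \<otimes>\<^bsub>K\<^esub> h n \<otimes>\<^bsub>K\<^esub> inv\<^bsub>K\<^esub> \<beta> q) = \<kappa> (h (act q n))"
          using equivariantD[OF f(2) q n] \<kappa>h[OF n] \<kappa>h[OF act_closed[OF q n]] Bq Hh(3)[OF n] by simp
        moreover have "\<beta> q \<otimes>\<^bsub>K\<^esub> h n \<otimes>\<^bsub>K\<^esub> inv\<^bsub>K\<^esub> \<beta> q \<in> carrier K" using Bq Hh(3)[OF n] by simp
        ultimately show ?thesis using ker[OF _ Hh(3)[OF act_closed[OF q n]]] by blast
      qed
      show ?thesis by (rule C.difference_char[OF N 1 2 ex]) blast+
    qed
    then obtain b where b: "\<And>q. q \<in> carrier Q \<Longrightarrow> b q \<in> fp_chars p N TN"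
      "\<And>q n. q \<in> carrier Q \<Longrightarrow> n \<in> carrier N \<Longrightarrow>
        \<beta> q \<otimes>\<^bsub>K\<^esub> h n \<otimes>\<^bsub>K\<^esub> inv\<^bsub>K\<^esub> \<beta> q = h (act q n) \<otimes>\<^bsub>K\<^esub> c [^]\<^bsub>K\<^esub> (b q n :: int)" by metis
    \<comment> \<open>Using the defining relation of \<open>b\<close> once for the product, or for
      \<open>q'\<close> and then for \<open>q\<close>, must give the same exponent of
      \<open>c\<close>.\<close>
    have coc: "[b (q \<otimes>\<^bsub>Q\<^esub> q') n = b q (act q' n) + b q' n] (mod int p)"
      if q: "q \<in> carrier Q" "q' \<in> carrier Q" and n: "n \<in> carrier N" for q q' n
    proof -
      have qq: "q \<otimes>\<^bsub>Q\<^esub> q' \<in> carrier Q" using q group.is_monoid[OF pgroups(3)] monoid.m_closed by fast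
      note an = act_closed[OF q(2) n] and Bq = B(3)[OF q(1)] B(3)[OF q(2)]
      have haa: "h (act q (act q' n)) \<in> carrier K" using Hh(3)[OF act_closed[OF q(1) an]] .
      have "h (act q (act q' n)) \<otimes>\<^bsub>K\<^esub> c [^]\<^bsub>K\<^esub> b (q \<otimes>\<^bsub>Q\<^esub> q') n
          = \<beta> (q \<otimes>\<^bsub>Q\<^esub> q') \<otimes>\<^bsub>K\<^esub> h n \<otimes>\<^bsub>K\<^esub> inv\<^bsub>K\<^esub> \<beta> (q \<otimes>\<^bsub>Q\<^esub> q')"
        using b(2)[OF qq n] act_mult[OF q n] by simp
      also have "\<dots> = \<beta> q \<otimes>\<^bsub>K\<^esub> (\<beta> q' \<otimes>\<^bsub>K\<^esub> h n \<otimes>\<^bsub>K\<^esub> inv\<^bsub>K\<^esub> \<beta> q') \<otimes>\<^bsub>K\<^esub> inv\<^bsub>K\<^esub> \<beta> q"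
        using B(4)[OF q] Bq Hh(3)[OF n] by (simp add: K.m_assoc K.inv_mult_group)
      also have "\<dots> = \<beta> q \<otimes>\<^bsub>K\<^esub> (h (act q' n) \<otimes>\<^bsub>K\<^esub> c [^]\<^bsub>K\<^esub> b q' n) \<otimes>\<^bsub>K\<^esub> inv\<^bsub>K\<^esub> \<beta> q"
        using b(2)[OF q(2) n] by simp
      also have "\<dots> = (h (act q (act q' n)) \<otimes>\<^bsub>K\<^esub> c [^]\<^bsub>K\<^esub> b q (act q' n)) \<otimes>\<^bsub>K\<^esub> c [^]\<^bsub>K\<^esub> b q' n"
        unfolding C.conj_pow[OF Hh(3)[OF an] Bq(1)] b(2)[OF q(1) an] ..
      also have "\<dots> = h (act q (act q' n)) \<otimes>\<^bsub>K\<^esub> c [^]\<^bsub>K\<^esub> (b q (act q' n) + b q' n)"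
        using haa C.pow_closed by (simp add: C.pow_add K.m_assoc)
      finally show ?thesis by (rule C.pow_cancel[OF haa])
    qed
    \<comment> \<open>For \<open>w\<close> near 1, \<open>\<beta> w\<close> is trivial and the
      action of \<open>w\<close> is invisible to \<open>h\<close>, so the defining relation of
      \<open>b w\<close> has exponent 0.\<close>
    have "\<exists>W\<in>ONS. \<forall>w\<in>W. \<forall>n\<in>carrier N. [b w n = 0] (mod int p)"
    proof -
      have one: "\<one>\<^bsub>N\<^esub> \<in> {n \<in> carrier N. h n = \<one>\<^bsub>K\<^esub>}" using Hh(5) by simp
      obtain W where W: "W \<in> ONS" "\<And>w n. w \<in> W \<Longrightarrow> n \<in> carrier N \<Longrightarrow> h (act w n \<otimes>\<^bsub>N\<^esub> inv\<^bsub>N\<^esub> n) = \<one>\<^bsub>K\<^esub>"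
        using act_small[OF Hh(2) one] by blast
      have "group_hom Q K \<beta>" using pgroups(3) K(1) B(1) by (simp add: group_hom_def group_hom_axioms_def)
      then have "kernel Q K \<beta> \<in> ONS"
        unfolding open_normal_subgroups_def using group_hom.normal_kernel B(2) by (force simp: kernel_def)
      then have V: "W \<inter> kernel Q K \<beta> \<in> ONS" using open_normal_Int[OF pgroups(2) W(1)] by blast
      have "[b w n = 0] (mod int p)" if w: "w \<in> W \<inter> kernel Q K \<beta>" and n: "n \<in> carrier N" for w n
      proof -
        have wc: "w \<in> carrier Q" "\<beta> w = \<one>\<^bsub>K\<^esub>" using w by (auto simp: kernel_def)
        note aw = act_closed[OF wc(1) n]
        have "h (act w n) = h (act w n \<otimes>\<^bsub>N\<^esub> inv\<^bsub>N\<^esub> n \<otimes>\<^bsub>N\<^esub> n)" using aw n by (simp add: NG.m_assoc)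
        also have "\<dots> = h n" using Hh(4)[of "act w n \<otimes>\<^bsub>N\<^esub> inv\<^bsub>N\<^esub> n" n] W(2)[of w n] w aw n Hh(3)[OF n] by simp
        finally have eq: "h (act w n) = h n" .
        show ?thesis
          by (rule C.pow_cancel[OF Hh(3)[OF n]]) (use b(2)[OF wc(1) n] eq wc Hh(3)[OF n] in simp)
      qed
      then show ?thesis using V by blast
    qed
    then obtain W where W: "W \<in> ONS" "\<And>w n. w \<in> W \<Longrightarrow> n \<in> carrier N \<Longrightarrow> [b w n = 0] (mod int p)" by blast
    obtain e where e: "e \<in> fp_chars p N TN"
      "\<And>q n. q \<in> carrier Q \<Longrightarrow> n \<in> carrier N \<Longrightarrow> [e (act q n) = e n + b q n] (mod int p)"
      using cocycle_vanishes[OF W(1) b(1) coc W(2)] by blast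
    \<comment> \<open>The twist by \<open>e\<close> absorbs the obstruction and makes the lift
      equivariant.\<close>
    define h' where "h' n = h n \<otimes>\<^bsub>K\<^esub> c [^]\<^bsub>K\<^esub> (e n :: int)" for n
    have h': "continuous_hom N TN K (discrete_on K) h'"
      unfolding h'_def by (rule C.twist_continuous_hom[OF N h(1) e(1)])
    note Hh' = continuous_hom_discreteD[OF N K(1) h']
    have h'_eqv: "h' (act q n) = \<beta> q \<otimes>\<^bsub>K\<^esub> h' n \<otimes>\<^bsub>K\<^esub> inv\<^bsub>K\<^esub> \<beta> q" if q: "q \<in> carrier Q" and n: "n \<in> carrier N" for q n
    proof -
      note an = act_closed[OF q n]
      have "[e (act q n) = b q n + e n] (mod int p)" using e(2)[OF q n] by (simp add: add.commute)
      then have "h' (act q n) = h (act q n) \<otimes>\<^bsub>K\<^esub> c [^]\<^bsub>K\<^esub> (b q n + e n)"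
        unfolding h'_def using C.pow_eq by metis
      also have "\<dots> = (h (act q n) \<otimes>\<^bsub>K\<^esub> c [^]\<^bsub>K\<^esub> b q n) \<otimes>\<^bsub>K\<^esub> c [^]\<^bsub>K\<^esub> e n"
        using Hh(3)[OF an] C.pow_closed by (simp add: C.pow_add K.m_assoc)
      also have "\<dots> = \<beta> q \<otimes>\<^bsub>K\<^esub> h' n \<otimes>\<^bsub>K\<^esub> inv\<^bsub>K\<^esub> \<beta> q"
        unfolding b(2)[OF q n, symmetric] h'_def C.conj_pow[OF Hh(3)[OF n] B(3)[OF q]] ..
      finally show ?thesis .
    qed
    \<comment> \<open>On \<open>X\<close> the prescribed values and \<open>h'\<close> have the same
      image in \<open>K'\<close>; the exponents \<open>d\<close> measure what is left to
      correct.\<close>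
    have "\<exists>i::int. \<phi> x = h' x \<otimes>\<^bsub>K\<^esub> c [^]\<^bsub>K\<^esub> i" if x: "x \<in> X" for x
    proof -
      have \<phi>x: "\<phi> x \<in> carrier K" using \<phi>(1) x by blast
      have "\<kappa> (h' x) = \<kappa> (h x)" using ker[OF Hh'(3)[OF XN[OF x]] Hh(3)[OF XN[OF x]]] by (auto simp: h'_def)
      then have "\<kappa> (\<phi> x) = \<kappa> (h' x)" using f(3)[OF x] \<kappa>h[OF XN[OF x]] by simp
      then show ?thesis using ker[OF \<phi>x Hh'(3)[OF XN[OF x]]] by blast
    qed
    then obtain d where d: "\<And>x. x \<in> X \<Longrightarrow> \<phi> x = h' x \<otimes>\<^bsub>K\<^esub> c [^]\<^bsub>K\<^esub> (d x :: int)" by metis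
    \<comment> \<open>Both \<open>\<phi>\<close> and \<open>h'\<close> are trivial at all but
      finitely many points of \<open>X\<close>, and so is the correction, as \<open>X_surj\<close>
      requires.\<close>
    have "finite {x \<in> X. \<not> [d x = 0] (mod int p)}"
    proof (rule finite_subset)
      show "{x \<in> X. \<not> [d x = 0] (mod int p)} \<subseteq> {x \<in> X. \<phi> x \<noteq> \<one>\<^bsub>K\<^esub>} \<union> {x \<in> S. h' x \<noteq> \<one>\<^bsub>K\<^esub>}"
      proof
        fix x assume x: "x \<in> {x \<in> X. \<not> [d x = 0] (mod int p)}"
        show "x \<in> {x \<in> X. \<phi> x \<noteq> \<one>\<^bsub>K\<^esub>} \<union> {x \<in> S. h' x \<noteq> \<one>\<^bsub>K\<^esub>}"
        proof (rule ccontr)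
          assume "x \<notin> {x \<in> X. \<phi> x \<noteq> \<one>\<^bsub>K\<^esub>} \<union> {x \<in> S. h' x \<noteq> \<one>\<^bsub>K\<^esub>}"
          then have "\<phi> x = \<one>\<^bsub>K\<^esub>" "h' x = \<one>\<^bsub>K\<^esub>" using x X_subset by auto
          then have "\<one>\<^bsub>K\<^esub> \<otimes>\<^bsub>K\<^esub> c [^]\<^bsub>K\<^esub> d x = \<one>\<^bsub>K\<^esub> \<otimes>\<^bsub>K\<^esub> c [^]\<^bsub>K\<^esub> (0::int)" using d[of x] x by simp
          then show False using C.pow_cancel[OF K.one_closed] x by blast
        qed
      qed
      show "finite ({x \<in> X. \<phi> x \<noteq> \<one>\<^bsub>K\<^esub>} \<union> {x \<in> S. h' x \<noteq> \<one>\<^bsub>K\<^esub>})" using \<phi>(2) fin_hom[OF K(1) h'] by blast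
    qed
    then obtain e' where e': "e' \<in> invariant_chars" "\<And>x. x \<in> X \<Longrightarrow> [e' x = d x] (mod int p)"
      using X_surj by blast
    have e'c: "e' \<in> fp_chars p N TN" using e'(1) by (simp add: invariant_chars_def)
    \<comment> \<open>Twisting by an invariant character corrects the values on \<open>X\<close>
      without disturbing equivariance.\<close>
    let ?f = "\<lambda>n. h' n \<otimes>\<^bsub>K\<^esub> c [^]\<^bsub>K\<^esub> (e' n :: int)"
    have "continuous_hom N TN K (discrete_on K) ?f" by (rule C.twist_continuous_hom[OF N h' e'c])
    moreover have "equivariant K \<beta> ?f"
      unfolding equivariant_def
    proof (intro ballI)
      fix q n assume q: "q \<in> carrier Q" and n: "n \<in> carrier N"
      have "c [^]\<^bsub>K\<^esub> e' (act q n) = c [^]\<^bsub>K\<^esub> e' n"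
        unfolding C.pow_eq using e'(1) q n by (simp add: invariant_chars_def)
      then show "?f (act q n) = \<beta> q \<otimes>\<^bsub>K\<^esub> ?f n \<otimes>\<^bsub>K\<^esub> inv\<^bsub>K\<^esub> \<beta> q"
        unfolding C.conj_pow[OF Hh'(3)[OF n] B(3)[OF q]] h'_eqv[OF q n, symmetric] by simp
    qed
    moreover have "?f x = \<phi> x" if "x \<in> X" for x
      using d[OF that] e'(2)[OF that] C.pow_eq by metis
    ultimately show ?thesis by blast
  qed
qed

end

section \<open>Closed subgroups and maps into pro-p groups\<close>

lemma topological_group_subgroup:
  assumes G: "topological_group G T" and F: "subgroup F G"
  shows "topological_group (G\<lparr>carrier := F\<rparr>) (subtopology T F)"
proof -
  interpret G: group G using topological_groupD[OF G] by simp
  have FG: "F \<subseteq> carrier G" by (rule subgroup.subset[OF F])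
  note top = topological_groupD(2)[OF G]
  have "continuous_map (prod_topology (subtopology T F) (subtopology T F)) T (\<lambda>(x, y). x \<otimes>\<^bsub>G\<^esub> y)"
    unfolding subtopology_Times[symmetric] by (rule continuous_map_from_subtopology[OF topological_groupD(3)[OF G]])
  then have 1: "continuous_map (prod_topology (subtopology T F) (subtopology T F)) (subtopology T F) (\<lambda>(x, y). x \<otimes>\<^bsub>G\<^esub> y)"
    by (rule continuous_map_into_subtopology) (use subgroup.m_closed[OF F] in auto)
  have "continuous_map (subtopology T F) T (\<lambda>x. inv\<^bsub>G\<^esub> x)"
    by (rule continuous_map_from_subtopology[OF topological_groupD(4)[OF G]])
  then have "continuous_map (subtopology T F) (subtopology T F) (\<lambda>x. inv\<^bsub>G\<^esub> x)"
    by (rule continuous_map_into_subtopology) (use subgroup.m_inv_closed[OF F] in auto)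
  then have 2: "continuous_map (subtopology T F) (subtopology T F) (\<lambda>x. inv\<^bsub>G\<lparr>carrier := F\<rparr>\<^esub> x)"
    by (rule continuous_map_eq) (simp add: top G.m_inv_consistent[OF F])
  show ?thesis
    unfolding topological_group_def using G.subgroup_imp_group[OF F] FG 1 2 by (simp add: top inf.absorb2)
qed

text \<open>The orders of the finite quotients are the point. An open normal \<open>W\<close> of
  \<open>F\<close> contains the trace on \<open>F\<close> of an open normal subgroup
  \<open>U\<close> of \<open>G\<close>. The quotient of \<open>F\<close> by this trace embeds in
  \<open>G/U\<close>, and \<open>F/W\<close> is a quotient of it.\<close>

lemma pro_p_closed_subgroup:
  assumes p: "prime p" and G: "pro_p_group p G T" and F: "subgroup F G" "closedin T F"
  shows "pro_p_group p (G\<lparr>carrier := F\<rparr>) (subtopology T F)"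
proof -
  note D = pro_p_groupD[OF G]
  interpret G: group G by (rule D(3))
  let ?F = "G\<lparr>carrier := F\<rparr>" and ?T = "subtopology T F"
  have FG: "F \<subseteq> carrier G" by (rule subgroup.subset[OF F(1)])
  have tg: "topological_group ?F ?T" by (rule topological_group_subgroup[OF D(2) F(1)])
  interpret F: group ?F using topological_groupD[OF tg] by simp
  have "compact_space ?T"
    using closedin_compact_space[OF D(5) F(2)] by (rule compact_space_subtopology)
  moreover have "Hausdorff_space ?T" using D(6) by (rule Hausdorff_space_subtopology)
  moreover have "totally_disconnected_space ?T"
    using D(7) unfolding totally_disconnected_space_def by (simp add: connectedin_subtopology)
  moreover have "\<exists>k. order (?F Mod W) = p ^ k" if W: "W \<in> open_normal_subgroups ?F ?T" for W
  proof -
    interpret W: normal W ?F using open_normal_subgroupD(1)[OF W] .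
    obtain O' where O': "openin T O'" "W = O' \<inter> F"
      using open_normal_subgroupD(2)[OF W] unfolding openin_subtopology by blast
    have "\<one>\<^bsub>G\<^esub> \<in> O'" using W.one_closed O' by simp
    then obtain U where U: "U \<in> open_normal_subgroups G T" "U \<subseteq> O'"
      using profinite_open_normal_base[OF D(1) O'(1)] by blast
    interpret U: normal U G using open_normal_subgroupD(1)[OF U(1)] .
    interpret GU: group "G Mod U" by (rule U.factorgroup_is_group)
    obtain k where k: "order (G Mod U) = p ^ k" using pro_p_quotient_order[OF G U(1)] .
    let ?q = "\<lambda>x. U #>\<^bsub>G\<^esub> x"
    have q: "?q \<in> hom ?F (G Mod U)"
      by (rule homI) (simp_all add: subsetD[OF FG] hom_in_carrier[OF U.r_coset_hom_Mod] hom_mult[OF U.r_coset_hom_Mod] del: mult_FactGroup)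
    interpret q: group_hom ?F "G Mod U" ?q by unfold_locales (rule q)
    have sub: "subgroup (?q ` F) (G Mod U)" using q.img_is_subgroup by simp
    let ?I = "(G Mod U)\<lparr>carrier := ?q ` F\<rparr>"
    interpret I: group ?I by (rule GU.subgroup_imp_group[OF sub])
    have "order ?I dvd p ^ k"
      using GU.lagrange[OF sub] k by (simp add: order_def) (metis dvd_triv_right)
    then obtain j where j: "order ?I = p ^ j" using p divides_primepow_nat by blast
    have q': "?q \<in> hom ?F ?I" using q by (auto simp: hom_def)
    interpret q': group_hom ?F ?I ?q by unfold_locales (rule q')
    let ?K = "kernel ?F ?I ?q"
    have "card (carrier (?F Mod ?K)) = card (carrier ?I)"
      using q'.FactGroup_iso_set by (auto simp: iso_def intro: bij_betw_same_card)
    then have oK: "order (?F Mod ?K) = p ^ j" using j by (simp add: order_def)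
    have "?K \<subseteq> W"
    proof
      fix x assume "x \<in> ?K"
      then have x: "x \<in> F" "U #>\<^bsub>G\<^esub> x = U" by (auto simp: kernel_def FactGroup_def)
      then have "x \<in> U" using G.rcos_self[OF _ U.is_subgroup] FG by blast
      then show "x \<in> W" using x U(2) O'(2) by blast
    qed
    then have KW: "?K \<subseteq> kernel ?F (?F Mod W) (\<lambda>x. W #>\<^bsub>?F\<^esub> x)"
      using W.subset W.rcos_const by (auto simp: kernel_def FactGroup_def)
    interpret w: group_hom ?F "?F Mod W" "\<lambda>x. W #>\<^bsub>?F\<^esub> x"
      using W.factorgroup_is_group W.r_coset_hom_Mod F.is_group by (simp add: group_hom_def group_hom_axioms_def)
    obtain g where g: "g \<in> hom (?F Mod ?K) (?F Mod W)"
      "\<And>x. x \<in> carrier ?F \<Longrightarrow> g (?K #>\<^bsub>?F\<^esub> x) = W #>\<^bsub>?F\<^esub> x"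
      by (rule w.FactGroup_universal_kernel[OF q'.normal_kernel KW]) (rule that)
    have "g ` carrier (?F Mod ?K) = carrier (?F Mod W)"
      using g(2) by (auto simp: FactGroup_def RCOSETS_def image_UN)
    then show ?thesis
      using order_surj_hom_prime_power[OF normal.factorgroup_is_group[OF q'.normal_kernel]
          W.factorgroup_is_group g(1) _ p oK] by blast
  qed
  ultimately show ?thesis using tg by (simp add: pro_p_group_def profinite_group_def)
qed

text \<open>The set where \<open>f\<close> and \<open>g\<close> agree is a subgroup, closed because
  \<open>TH\<close> is Hausdorff, and it contains \<open>X\<close>.\<close>

lemma hom_eq_on_closure_generate:
  assumes G: "topological_group G T" and X: "X \<subseteq> carrier G" and H: "group H" "Hausdorff_space TH"
    and F_def: "F = T closure_of (generate G X)"
    and f: "continuous_hom (G\<lparr>carrier := F\<rparr>) (subtopology T F) H TH f"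
    and g: "continuous_hom (G\<lparr>carrier := F\<rparr>) (subtopology T F) H TH g"
    and eq: "\<And>x. x \<in> X \<Longrightarrow> f x = g x" and x: "x \<in> F"
  shows "f x = g x"
proof -
  interpret G: group G using topological_groupD[OF G] by simp
  have gen: "subgroup (generate G X) G" using X by (rule G.generate_is_subgroup)
  have F: "subgroup F G" unfolding F_def by (rule closure_of_subgroup[OF G gen])
  have FG: "F \<subseteq> carrier G" by (rule subgroup.subset[OF F])
  interpret F: group "G\<lparr>carrier := F\<rparr>" by (rule G.subgroup_imp_group[OF F])
  interpret f: group_hom "G\<lparr>carrier := F\<rparr>" H f
    using f H F.is_group by (simp add: group_hom_def group_hom_axioms_def continuous_hom_def)
  interpret g: group_hom "G\<lparr>carrier := F\<rparr>" H g
    using g H F.is_group by (simp add: group_hom_def group_hom_axioms_def continuous_hom_def)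
  let ?E = "{x \<in> F. f x = g x}"
  have "subgroup ?E G"
  proof (rule G.subgroupI)
    show "?E \<subseteq> carrier G" using FG by blast
    have "\<one>\<^bsub>G\<^esub> \<in> ?E" using subgroup.one_closed[OF F] f.hom_one g.hom_one by simp
    then show "?E \<noteq> {}" by blast
    fix a assume a: "a \<in> ?E"
    then show "inv\<^bsub>G\<^esub> a \<in> ?E"
      using f.hom_inv[of a] g.hom_inv[of a] subgroup.m_inv_closed[OF F] G.m_inv_consistent[OF F] by simp
    fix b assume "b \<in> ?E"
    then show "a \<otimes>\<^bsub>G\<^esub> b \<in> ?E" using a f.hom_mult[of a b] g.hom_mult[of a b] subgroup.m_closed[OF F] by simp
  qed
  moreover have "generate G X \<subseteq> F"
    unfolding F_def using closure_of_subset subgroup.subset[OF gen] topological_groupD(2)[OF G] by metis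
  then have "X \<subseteq> ?E" using eq generate.incl[of _ X G] by blast
  ultimately have sub: "generate G X \<subseteq> ?E" by (rule G.generate_subgroup_incl[rotated])
  have "closedin (subtopology T F) {x \<in> topspace (subtopology T F). f x = g x}"
    by (rule closedin_continuous_maps_eq[OF H(2)]) (use f g in \<open>simp_all add: continuous_hom_def\<close>)
  moreover have "topspace (subtopology T F) = F"
    using FG topological_groupD(2)[OF G] by auto
  moreover have "closedin T F" unfolding F_def by simp
  ultimately have "closedin T ?E" using closedin_trans_full by fastforce
  then have "F \<subseteq> ?E" unfolding F_def by (intro closure_of_minimal) (use sub F_def in auto)
  then show ?thesis using x by blast
qed

lemma closed_coset:
  assumes G: "topological_group G T" and W: "W \<in> open_normal_subgroups G T"
    and C: "C \<in> carrier (G Mod W)"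
  shows "closedin T C"
proof -
  interpret G: group G using topological_groupD[OF G] by simp
  note Ws = open_normal_subgroupD(3)[OF W]
  obtain a where a: "a \<in> carrier G" "C = W #>\<^bsub>G\<^esub> a" using C by (auto simp: FactGroup_def RCOSETS_def)
  have "continuous_map T (discrete_on (G Mod W)) (\<lambda>x. W #>\<^bsub>G\<^esub> x)"
    using continuous_hom_quotient[OF G W] by (simp add: continuous_hom_def)
  from closedin_continuous_map_preimage[OF this, of "{C}"]
  have "closedin T {x \<in> carrier G. W #>\<^bsub>G\<^esub> x = C}" using C topological_groupD(2)[OF G] by simp
  moreover have "{x \<in> carrier G. W #>\<^bsub>G\<^esub> x = C} = C"
    unfolding a(2) using G.repr_independence[OF _ a(1) Ws] G.rcos_self[OF _ Ws]
      G.r_coset_subset_G[OF subgroup.subset[OF Ws] a(1)] by blast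
  ultimately show ?thesis by simp
qed

section \<open>Passage from finite p-groups to pro-p groups\<close>

context equivariant_free_basis
begin

lemma X_in_N: "X \<subseteq> carrier N" using X_subset S_subset by blast

text \<open>The finite quotients of a pro-p group live on a type of sets. This lemma and its
  existence counterpart move them to \<open>nat\<close>, where the induction was done.\<close>

lemma prime_power_equivariant_unique:
  assumes K: "group K" "order K = p ^ k" and \<beta>: "\<beta> \<in> hom Q K"
    and f: "continuous_hom N TN K (discrete_on K) f" "equivariant K \<beta> f"
    and g: "continuous_hom N TN K (discrete_on K) g" "equivariant K \<beta> g"
    and eq: "\<And>x. x \<in> X \<Longrightarrow> f x = g x" and n: "n \<in> carrier N"
  shows "f n = g n"
proof -
  obtain K' :: "nat monoid" and i where K': "group K'" and i: "i \<in> iso K K'"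
    using finite_group_isomorphic_copy[OF K(1) prime_power_order_finite[OF prime K(2)] infinite_UNIV_nat] by blast
  have ih: "i \<in> hom K K'" and inj: "inj_on i (carrier K)" and surj: "i ` carrier K = carrier K'"
    using i by (auto simp: iso_def bij_betw_def)
  have oK': "order K' = p ^ k" using card_image[OF inj] surj K(2) by (simp add: order_def)
  note \<beta>c = hom_in_carrier[OF \<beta>]
  note F = continuous_hom_discreteD(3)[OF N K(1) f(1)] and G = continuous_hom_discreteD(3)[OF N K(1) g(1)]
  have "i (f n) = i (g n)"
  proof (rule finite_equivariant_unique[OF K'(1) oK'])
    show "(\<lambda>q. i (\<beta> q)) \<in> hom Q K'" using Group.hom_compose[OF \<beta> ih] by (simp add: comp_def)
    show "continuous_hom N TN K' (discrete_on K') (\<lambda>n. i (f n))" by (rule discrete_continuous_hom_compose[OF f(1) ih])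
    show "continuous_hom N TN K' (discrete_on K') (\<lambda>n. i (g n))" by (rule discrete_continuous_hom_compose[OF g(1) ih])
    show "equivariant K' (\<lambda>q. i (\<beta> q)) (\<lambda>n. i (f n))" by (rule equivariant_compose[OF K(1) K' ih f(2) \<beta>c F])
    show "equivariant K' (\<lambda>q. i (\<beta> q)) (\<lambda>n. i (g n))" by (rule equivariant_compose[OF K(1) K' ih g(2) \<beta>c G])
  qed (use eq n in auto)
  then show ?thesis using inj F[OF n] G[OF n] by (simp add: inj_on_eq_iff)
qed

lemma prime_power_equivariant_exists:
  assumes K: "group K" "order K = p ^ k" and \<beta>: "continuous_hom Q TQ K (discrete_on K) \<beta>"
    and \<phi>: "converges_to_one K (discrete_on K) X \<phi>"
  shows "\<exists>f. continuous_hom N TN K (discrete_on K) f \<and> equivariant K \<beta> f \<and> (\<forall>x\<in>X. f x = \<phi> x)"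
proof -
  obtain K' :: "nat monoid" and i where K': "group K'" and i: "i \<in> iso K K'"
    using finite_group_isomorphic_copy[OF K(1) prime_power_order_finite[OF prime K(2)] infinite_UNIV_nat] by blast
  have ih: "i \<in> hom K K'" and inj: "inj_on i (carrier K)" and surj: "i ` carrier K = carrier K'"
    using i by (auto simp: iso_def bij_betw_def)
  define j where "j = inv_into (carrier K) i"
  have "j \<in> iso K' K" unfolding j_def by (rule group.iso_set_sym[OF K(1) i])
  then have jh: "j \<in> hom K' K" by (simp add: iso_def)
  have ji: "j (i x) = x" if "x \<in> carrier K" for x using inj that by (simp add: j_def)
  have oK': "order K' = p ^ k" using card_image[OF inj] surj K(2) by (simp add: order_def)
  have ic: "continuous_hom K (discrete_on K) K' (discrete_on K') i"
    using ih by (auto simp: continuous_hom_def hom_def)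
  have tK: "topological_group K (discrete_on K)"
    using pro_p_groupD(2)[OF prime_power_order_discrete_pro_p[OF prime K]] .
  have conv: "converges_to_one K' (discrete_on K') X (\<lambda>x. i (\<phi> x))"
    by (rule converges_to_one_hom[OF tK K' ic \<phi>])
  note B = continuous_hom_discreteD[OF pgroups(2) K(1) \<beta>]
  obtain f where f: "continuous_hom N TN K' (discrete_on K') f" "equivariant K' (\<lambda>q. i (\<beta> q)) f"
    "\<And>x. x \<in> X \<Longrightarrow> f x = i (\<phi> x)"
    using finite_equivariant_exists[OF K' oK' continuous_hom_compose[OF \<beta> ic] _ finite_support_discrete[OF K' conv]]
      conv by (auto simp: converges_to_one_def)
  note F = continuous_hom_discreteD[OF N K' f(1)]
  have "equivariant K (\<lambda>q. j (i (\<beta> q))) (\<lambda>n. j (f n))"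
    by (rule equivariant_compose[OF K' K(1) jh f(2)]) (use hom_in_carrier[OF ih] B(3) F(3) in auto)
  then have "equivariant K \<beta> (\<lambda>n. j (f n))" using B(3) by (simp add: equivariant_def ji)
  moreover have "continuous_hom N TN K (discrete_on K) (\<lambda>n. j (f n))"
    by (rule discrete_continuous_hom_compose[OF f(1) jh])
  moreover have "j (f x) = \<phi> x" if "x \<in> X" for x
    using f(3)[OF that] ji \<phi> that by (auto simp: converges_to_one_def)
  ultimately show ?thesis by blast
qed

lemma equivariant_quotient:
  assumes H: "group H" and W: "W \<lhd> H" and f: "equivariant H \<beta> f"
    and "\<And>q. q \<in> carrier Q \<Longrightarrow> \<beta> q \<in> carrier H" "\<And>n. n \<in> carrier N \<Longrightarrow> f n \<in> carrier H"
  shows "equivariant (H Mod W) (\<lambda>q. W #>\<^bsub>H\<^esub> \<beta> q) (\<lambda>n. W #>\<^bsub>H\<^esub> f n)"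
  by (rule equivariant_compose[OF H normal.factorgroup_is_group[OF W] normal.r_coset_hom_Mod[OF W] f assms(4,5)])

text \<open>Equality is tested modulo every open normal subgroup, where the finite case
  applies.\<close>

lemma equivariant_unique:
  assumes H: "pro_p_group p H TH" and \<beta>: "\<beta> \<in> hom Q H"
    and f: "continuous_hom N TN H TH f" "equivariant H \<beta> f"
    and g: "continuous_hom N TN H TH g" "equivariant H \<beta> g"
    and eq: "\<And>x. x \<in> X \<Longrightarrow> f x = g x" and n: "n \<in> carrier N"
  shows "f n = g n"
proof (rule profinite_eq_if_all_cosets_eq[OF pro_p_groupD(1)[OF H]])
  have fc: "f n \<in> carrier H" if "n \<in> carrier N" for n using f(1) that by (auto simp: continuous_hom_def hom_def)
  have gc: "g n \<in> carrier H" if "n \<in> carrier N" for n using g(1) that by (auto simp: continuous_hom_def hom_def)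
  show "f n \<in> carrier H" "g n \<in> carrier H" using fc gc n by auto
  fix W assume W: "W \<in> open_normal_subgroups H TH"
  note Wn = open_normal_subgroupD(1)[OF W]
  obtain k where k: "order (H Mod W) = p ^ k" using pro_p_quotient_order[OF H W] .
  note q = continuous_hom_quotient[OF pro_p_groupD(2)[OF H] W]
  note Hg = pro_p_groupD(3)[OF H]
  show "W #>\<^bsub>H\<^esub> f n = W #>\<^bsub>H\<^esub> g n"
  proof (rule prime_power_equivariant_unique[OF normal.factorgroup_is_group[OF Wn] k])
    show "(\<lambda>q. W #>\<^bsub>H\<^esub> \<beta> q) \<in> hom Q (H Mod W)"
      using Group.hom_compose[OF \<beta> normal.r_coset_hom_Mod[OF Wn]] by (simp add: comp_def)
    show "continuous_hom N TN (H Mod W) (discrete_on (H Mod W)) (\<lambda>n. W #>\<^bsub>H\<^esub> f n)"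
      by (rule continuous_hom_compose[OF f(1) q])
    show "continuous_hom N TN (H Mod W) (discrete_on (H Mod W)) (\<lambda>n. W #>\<^bsub>H\<^esub> g n)"
      by (rule continuous_hom_compose[OF g(1) q])
    show "equivariant (H Mod W) (\<lambda>q. W #>\<^bsub>H\<^esub> \<beta> q) (\<lambda>n. W #>\<^bsub>H\<^esub> f n)"
      by (rule equivariant_quotient[OF Hg Wn f(2) hom_in_carrier[OF \<beta>] fc])
    show "equivariant (H Mod W) (\<lambda>q. W #>\<^bsub>H\<^esub> \<beta> q) (\<lambda>n. W #>\<^bsub>H\<^esub> g n)"
      by (rule equivariant_quotient[OF Hg Wn g(2) hom_in_carrier[OF \<beta>] gc])
  qed (use eq n in auto)
qed

text \<open>Over each finite quotient a solution \<open>f W\<close> exists, and its value at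
  \<open>n\<close> is a coset of \<open>W\<close>. Uniqueness nests these cosets; compactness yields
  a common element \<open>h n\<close>, for which the algebraic identities can be checked coset by
  coset.\<close>

lemma equivariant_exists:
  assumes H: "pro_p_group p H TH" and \<beta>: "continuous_hom Q TQ H TH \<beta>"
    and \<phi>: "converges_to_one H TH X \<phi>"
  shows "\<exists>f. continuous_hom N TN H TH f \<and> equivariant H \<beta> f \<and> (\<forall>x\<in>X. f x = \<phi> x)"
proof -
  note D = pro_p_groupD[OF H]
  interpret H: group H by (rule D(3))
  interpret NG: group N by (rule N_group)
  let ?I = "open_normal_subgroups H TH"
  let ?D = "\<lambda>W. discrete_on (H Mod W)"
  have Wn: "W \<lhd> H" "subgroup W H" "group (H Mod W)" if "W \<in> ?I" for W
    using open_normal_subgroupD[OF that] normal.factorgroup_is_group by auto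
  have \<beta>c: "\<beta> q \<in> carrier H" if "q \<in> carrier Q" for q using \<beta> that by (auto simp: continuous_hom_def hom_def)
  have \<phi>c: "\<phi> x \<in> carrier H" if "x \<in> X" for x using \<phi> that by (auto simp: converges_to_one_def)
  have "\<exists>f. continuous_hom N TN (H Mod W) (?D W) f \<and> equivariant (H Mod W) (\<lambda>q. W #>\<^bsub>H\<^esub> \<beta> q) f
      \<and> (\<forall>x\<in>X. f x = W #>\<^bsub>H\<^esub> \<phi> x)" if W: "W \<in> ?I" for W
  proof -
    obtain k where k: "order (H Mod W) = p ^ k" using pro_p_quotient_order[OF H W] .
    note q = continuous_hom_quotient[OF D(2) W]
    show ?thesis
      by (rule prime_power_equivariant_exists[OF Wn(3)[OF W] k continuous_hom_compose[OF \<beta> q]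
            converges_to_one_hom[OF D(2) Wn(3)[OF W] q \<phi>]])
  qed
  then obtain f where f: "\<And>W. W \<in> ?I \<Longrightarrow> continuous_hom N TN (H Mod W) (?D W) (f W)"
    "\<And>W. W \<in> ?I \<Longrightarrow> equivariant (H Mod W) (\<lambda>q. W #>\<^bsub>H\<^esub> \<beta> q) (f W)"
    "\<And>W x. W \<in> ?I \<Longrightarrow> x \<in> X \<Longrightarrow> f W x = W #>\<^bsub>H\<^esub> \<phi> x" by metis
  note fD = continuous_hom_discreteD[OF N Wn(3) f(1)]
  have coset: "\<exists>x\<in>carrier H. f W n = W #>\<^bsub>H\<^esub> x" if "W \<in> ?I" "n \<in> carrier N" for W n
    using fD(3)[OF that(1) that(1) that(2)] by (auto simp: FactGroup_def RCOSETS_def)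
  \<comment> \<open>Pushing \<open>f V\<close> forward to the quotient by \<open>W\<close> gives
    another solution there, which uniqueness identifies with \<open>f W\<close>.\<close>
  have mono: "f V n \<subseteq> f W n" if V: "V \<in> ?I" and W: "W \<in> ?I" and VW: "V \<subseteq> W" and n: "n \<in> carrier N" for V W n
  proof -
    interpret W: normal W H using Wn(1)[OF W] .
    interpret w: group_hom H "H Mod W" "\<lambda>x. W #>\<^bsub>H\<^esub> x"
      using W.factorgroup_is_group W.r_coset_hom_Mod H.is_group by (simp add: group_hom_def group_hom_axioms_def)
    have "V \<subseteq> kernel H (H Mod W) (\<lambda>x. W #>\<^bsub>H\<^esub> x)"
      using VW W.subset W.rcos_const by (auto simp: kernel_def FactGroup_def)
    then obtain g where g: "g \<in> hom (H Mod V) (H Mod W)" "\<And>x. x \<in> carrier H \<Longrightarrow> g (V #>\<^bsub>H\<^esub> x) = W #>\<^bsub>H\<^esub> x"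
      using w.FactGroup_universal_kernel[OF Wn(1)[OF V]] by metis
    obtain k where k: "order (H Mod W) = p ^ k" using pro_p_quotient_order[OF H W] .
    have "g (f V n) = f W n"
    proof (rule prime_power_equivariant_unique[OF Wn(3)[OF W] k _ _ _ f(1,2)[OF W] _ n])
      show "(\<lambda>q. W #>\<^bsub>H\<^esub> \<beta> q) \<in> hom Q (H Mod W)"
        using Group.hom_compose[of \<beta> Q H, OF _ W.r_coset_hom_Mod] \<beta> by (simp add: comp_def continuous_hom_def)
      show "continuous_hom N TN (H Mod W) (?D W) (\<lambda>n. g (f V n))"
        by (rule discrete_continuous_hom_compose[OF f(1)[OF V] g(1)])
      have "equivariant (H Mod W) (\<lambda>q. g (V #>\<^bsub>H\<^esub> \<beta> q)) (\<lambda>n. g (f V n))"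
        by (rule equivariant_compose[OF Wn(3)[OF V] Wn(3)[OF W] g(1) f(2)[OF V]])
          (use \<beta>c fD(3)[OF V V] in \<open>auto simp: FactGroup_def RCOSETS_def\<close>)
      then show "equivariant (H Mod W) (\<lambda>q. W #>\<^bsub>H\<^esub> \<beta> q) (\<lambda>n. g (f V n))"
        using g(2) \<beta>c by (simp add: equivariant_def)
      show "g (f V x) = f W x" if "x \<in> X" for x using f(3)[OF V that] f(3)[OF W that] g(2) \<phi>c[OF that] by simp
    qed
    moreover obtain x where x: "x \<in> carrier H" "f V n = V #>\<^bsub>H\<^esub> x" using coset[OF V n] by blast
    ultimately have "f W n = W #>\<^bsub>H\<^esub> x" using g(2) by simp
    then show ?thesis using x(2) VW by (auto simp: r_coset_def)
  qed
  have "\<exists>x\<in>carrier H. \<forall>W\<in>?I. W #>\<^bsub>H\<^esub> x = f W n" if n: "n \<in> carrier N" for n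
  proof -
    \<comment> \<open>Finitely many of these closed cosets all contain the non-empty
      \<open>f V n\<close> for a common smaller \<open>V\<close>; this is the finite intersection
      property.\<close>
    have "\<Inter>((\<lambda>W. f W n) ` ?I) \<noteq> {}"
    proof (rule D(5)[unfolded compact_space_fip, rule_format])
      show "(\<forall>C\<in>(\<lambda>W. f W n) ` ?I. closedin TH C) \<and> (\<forall>\<F>. finite \<F> \<and> \<F> \<subseteq> (\<lambda>W. f W n) ` ?I \<longrightarrow> \<Inter>\<F> \<noteq> {})"
      proof (intro conjI ballI allI impI)
        show "closedin TH C" if "C \<in> (\<lambda>W. f W n) ` ?I" for C
          using that closed_coset[OF D(2)] fD(3)[OF _ _ n] by blast
        fix \<F> assume "finite \<F> \<and> \<F> \<subseteq> (\<lambda>W. f W n) ` ?I"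
        then obtain \<V> where \<V>: "finite \<V>" "\<V> \<subseteq> ?I" "\<F> = (\<lambda>W. f W n) ` \<V>"
          by (metis finite_subset_image)
        obtain V where V: "V \<in> ?I" "\<forall>W\<in>\<V>. V \<subseteq> W" using open_normal_Inter[OF D(2) \<V>(1,2)] by blast
        obtain x where x: "x \<in> carrier H" "f V n = V #>\<^bsub>H\<^esub> x" using coset[OF V(1) n] by blast
        have "x \<in> f V n" using H.rcos_self[OF x(1) Wn(2)[OF V(1)]] x(2) by simp
        then have "x \<in> \<Inter>\<F>" using \<V> V mono[OF V(1) _ _ n] by blast
        then show "\<Inter>\<F> \<noteq> {}" by blast
      qed
    qed
    then obtain x where x: "\<And>W. W \<in> ?I \<Longrightarrow> x \<in> f W n" by blast
    have "W #>\<^bsub>H\<^esub> x = f W n \<and> x \<in> carrier H" if W: "W \<in> ?I" for W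
    proof -
      obtain y where y: "y \<in> carrier H" "f W n = W #>\<^bsub>H\<^esub> y" using coset[OF W n] by blast
      then have xy: "x \<in> W #>\<^bsub>H\<^esub> y" using x[OF W] by simp
      then have "x \<in> carrier H" using H.r_coset_subset_G[OF subgroup.subset[OF Wn(2)[OF W]] y(1)] by blast
      then show ?thesis using H.repr_independence[OF xy y(1) Wn(2)[OF W]] y(2) by simp
    qed
    then show ?thesis using carrier_open_normal[OF D(2)] by blast
  qed
  then obtain h where h: "\<And>n. n \<in> carrier N \<Longrightarrow> h n \<in> carrier H"
    "\<And>n W. n \<in> carrier N \<Longrightarrow> W \<in> ?I \<Longrightarrow> W #>\<^bsub>H\<^esub> h n = f W n" by metis
  note eqI = profinite_eq_if_all_cosets_eq[OF D(1)]
  have Wmult: "W #>\<^bsub>H\<^esub> (x \<otimes>\<^bsub>H\<^esub> y) = (W #>\<^bsub>H\<^esub> x) \<otimes>\<^bsub>H Mod W\<^esub> (W #>\<^bsub>H\<^esub> y)"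
    if "W \<in> ?I" "x \<in> carrier H" "y \<in> carrier H" for W x y
    using normal.rcos_sum[OF Wn(1)[OF that(1)] that(2,3)] by simp
  have "h \<in> hom N H"
  proof (rule homI)
    fix m n assume mn: "m \<in> carrier N" "n \<in> carrier N"
    show "h (m \<otimes>\<^bsub>N\<^esub> n) = h m \<otimes>\<^bsub>H\<^esub> h n"
    proof (rule eqI)
      fix W assume W: "W \<in> ?I"
      show "W #>\<^bsub>H\<^esub> h (m \<otimes>\<^bsub>N\<^esub> n) = W #>\<^bsub>H\<^esub> (h m \<otimes>\<^bsub>H\<^esub> h n)"
        using fD(4)[OF W W mn] h mn W by (simp add: Wmult del: mult_FactGroup)
    qed (use h mn in auto)
  qed (rule h)
  moreover have "continuous_map TN TH h"
    unfolding continuous_map_def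
  proof (intro conjI allI impI)
    note topN = topological_groupD(2)[OF N]
    show "h \<in> topspace TN \<rightarrow> topspace TH" using h(1) topN D(4) by auto
    fix U assume U: "openin TH U"
    show "openin TN {n \<in> topspace TN. h n \<in> U}"
    proof (subst openin_subopen, intro ballI)
      fix n assume n: "n \<in> {n \<in> topspace TN. h n \<in> U}"
      then have nN: "n \<in> carrier N" "h n \<in> U" by (auto simp: topN)
      let ?V = "{x \<in> topspace TH. x \<otimes>\<^bsub>H\<^esub> h n \<in> U}"
      have "openin TH ?V"
        by (rule openin_continuous_map_preimage[OF continuous_map_translate(1)[OF D(2) h(1)[OF nN(1)]] U])
      moreover have "\<one>\<^bsub>H\<^esub> \<in> ?V" using D(4) h(1)[OF nN(1)] nN(2) by simp
      ultimately obtain W where W: "W \<in> ?I" "W \<subseteq> ?V" using profinite_open_normal_base[OF D(1)] by blast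
      have cW: "continuous_map TN (?D W) (f W)" using f(1)[OF W(1)] by (simp add: continuous_hom_def)
      \<comment> \<open>Where \<open>f W\<close> keeps the value \<open>f W n\<close>, the map
        \<open>h\<close> stays in the \<open>W\<close>-coset of \<open>h n\<close>, which lies in
        \<open>U\<close> by the choice of \<open>W\<close>.\<close>
      let ?A = "{m \<in> topspace TN. f W m \<in> {f W n}}"
      have "openin TN ?A"
        by (rule openin_continuous_map_preimage[OF cW]) (use fD(3)[OF W(1) W(1) nN(1)] in simp)
      moreover have "n \<in> ?A" using n by simp
      moreover have "?A \<subseteq> {n \<in> topspace TN. h n \<in> U}"
      proof
        fix m assume m: "m \<in> ?A"
        then have mN: "m \<in> carrier N" by (simp add: topN)
        have "h m \<in> W #>\<^bsub>H\<^esub> h m" by (rule H.rcos_self[OF h(1)[OF mN] Wn(2)[OF W(1)]])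
        then have "h m \<in> W #>\<^bsub>H\<^esub> h n" using h(2)[OF mN W(1)] h(2)[OF nN(1) W(1)] m by simp
        then obtain w where "w \<in> W" "h m = w \<otimes>\<^bsub>H\<^esub> h n" by (auto simp: r_coset_def)
        then have "h m \<in> U" using W(2) by auto
        then show "m \<in> {n \<in> topspace TN. h n \<in> U}" using m by simp
      qed
      ultimately show "\<exists>A. openin TN A \<and> n \<in> A \<and> A \<subseteq> {n \<in> topspace TN. h n \<in> U}" by blast
    qed
  qed
  moreover have "equivariant H \<beta> h"
    unfolding equivariant_def
  proof (intro ballI eqI)
    fix q n assume q: "q \<in> carrier Q" and n: "n \<in> carrier N"
    show "h (act q n) \<in> carrier H" "\<beta> q \<otimes>\<^bsub>H\<^esub> h n \<otimes>\<^bsub>H\<^esub> inv\<^bsub>H\<^esub> \<beta> q \<in> carrier H"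
      using h(1) act_closed[OF q n] n \<beta>c[OF q] by auto
    fix W assume W: "W \<in> ?I"
    have "W #>\<^bsub>H\<^esub> inv\<^bsub>H\<^esub> \<beta> q = inv\<^bsub>H Mod W\<^esub> (W #>\<^bsub>H\<^esub> \<beta> q)"
      using group_hom.hom_inv[of H "H Mod W" "\<lambda>x. W #>\<^bsub>H\<^esub> x" "\<beta> q"] H.is_group Wn[OF W] \<beta>c[OF q]
        normal.r_coset_hom_Mod[OF Wn(1)[OF W]] by (simp add: group_hom_def group_hom_axioms_def)
    then show "W #>\<^bsub>H\<^esub> h (act q n) = W #>\<^bsub>H\<^esub> (\<beta> q \<otimes>\<^bsub>H\<^esub> h n \<otimes>\<^bsub>H\<^esub> inv\<^bsub>H\<^esub> \<beta> q)"
      using equivariantD[OF f(2)[OF W] q n] h act_closed[OF q n] n \<beta>c[OF q] W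
      by (simp add: Wmult del: mult_FactGroup)
  qed
  moreover have "h x = \<phi> x" if x: "x \<in> X" for x
    by (rule eqI) (use h[of x] \<phi>c[OF x] f(3)[OF _ x] x X_in_N in auto)
  ultimately show ?thesis unfolding continuous_hom_def by blast
qed

section \<open>The closed subgroup generated by \<open>X\<close>\<close>

definition "F = TN closure_of (generate N X)"

abbreviation "FN \<equiv> N\<lparr>carrier := F\<rparr>"
abbreviation "TF \<equiv> subtopology TN F"

lemma F_subgroup: "subgroup F N"
  unfolding F_def by (rule closure_of_subgroup[OF N group.generate_is_subgroup[OF N_group X_in_N]])

lemma F_closed: "closedin TN F" by (simp add: F_def)

lemma N_pro_p: "pro_p_group p N TN" using free by (simp add: free_pro_p_on_def)

lemma F_pro_p: "pro_p_group p FN TF"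
  by (rule pro_p_closed_subgroup[OF prime N_pro_p F_subgroup F_closed])

lemma X_in_F: "X \<subseteq> F"
proof -
  have "X \<subseteq> generate N X" using generate.incl[of _ X N] by blast
  also have "\<dots> \<subseteq> F"
    unfolding F_def using closure_of_subset topological_groupD(2)[OF N]
      group.generate_incl[OF N_group X_in_N] by metis
  finally show ?thesis .
qed

lemma X_converges_N: "converges_to_one N TN X (\<lambda>x. x)"
  unfolding converges_to_one_def
proof (intro conjI allI impI)
  show "(\<lambda>x. x) \<in> X \<rightarrow> carrier N" using X_in_N by blast
  fix U assume "subgroup U N \<and> openin TN U"
  then have "finite {x \<in> S. x \<notin> U}" using finite_outside by blast
  then show "finite {x \<in> X. x \<notin> U}" by (rule rev_finite_subset) (use X_subset in blast)
qed

text \<open>An open subgroup of \<open>F\<close> is the trace of an open set of \<open>N\<close>,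
  not obviously of a subgroup. An open normal subgroup of \<open>N\<close> inside that set reduces
  the claim to convergence in \<open>N\<close>.\<close>

lemma X_converges_F: "converges_to_one FN TF X (\<lambda>x. x)"
  unfolding converges_to_one_def
proof (intro conjI allI impI)
  show "(\<lambda>x. x) \<in> X \<rightarrow> carrier FN" using X_in_F by auto
  fix U assume U: "subgroup U FN \<and> openin TF U"
  then obtain A where A: "openin TN A" "U = A \<inter> F" unfolding openin_subtopology by blast
  have "\<one>\<^bsub>N\<^esub> \<in> A" using U A subgroup.one_closed[of U FN] by simp
  then obtain V where V: "V \<in> open_normal_subgroups N TN" "V \<subseteq> A"
    using profinite_open_normal_base[OF pro_p_groupD(1)[OF N_pro_p] A(1)] by blast
  have "finite {x \<in> X. x \<notin> V}"
    using X_converges_N open_normal_subgroupD(2,3)[OF V(1)] by (simp add: converges_to_one_def)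
  then show "finite {x \<in> X. x \<notin> U}" by (rule rev_finite_subset) (use X_in_F V A in blast)
qed

lemma restrict_to_F:
  assumes "continuous_hom N TN H TH h"
  shows "continuous_hom FN TF H TH h"
  using assms subgroup.subset[OF F_subgroup] by (auto simp: continuous_hom_def hom_def continuous_map_from_subtopology)

lemma hom_eq_on_F:
  assumes "group H" "Hausdorff_space TH" "continuous_hom FN TF H TH f" "continuous_hom FN TF H TH g"
    and "\<And>x. x \<in> X \<Longrightarrow> f x = g x" "x \<in> F"
  shows "f x = g x"
  by (rule hom_eq_on_closure_generate[OF N X_in_N assms(1,2) F_def assms(3-6)])

text \<open>A map on \<open>X\<close> is extended by 1 to \<open>S\<close>, then to \<open>N\<close>
  by freeness, and finally restricted to \<open>F\<close>. Uniqueness holds because \<open>X\<close>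
  generates \<open>F\<close> topologically.\<close>

lemma F_free: "free_pro_p_on p FN TF X"
  unfolding free_pro_p_on_def
proof (intro conjI allI impI F_pro_p X_converges_F)
  fix H :: "'n test monoid" and TH \<phi>
  assume a: "pro_p_group p H TH \<and> converges_to_one H TH X \<phi>"
  then have H: "pro_p_group p H TH" and \<phi>: "converges_to_one H TH X \<phi>" by auto
  note D = pro_p_groupD[OF H]
  let ?\<psi> = "\<lambda>x. if x \<in> X then \<phi> x else \<one>\<^bsub>H\<^esub>"
  have conv: "converges_to_one H TH S ?\<psi>"
    unfolding converges_to_one_def
  proof (intro conjI allI impI)
    show "?\<psi> \<in> S \<rightarrow> carrier H"
      using \<phi> monoid.one_closed[OF group.is_monoid[OF D(3)]] by (auto simp: converges_to_one_def)
    fix U assume U: "subgroup U H \<and> openin TH U"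
    then have "finite {x \<in> X. \<phi> x \<notin> U}" using \<phi> by (simp add: converges_to_one_def)
    then show "finite {x \<in> S. ?\<psi> x \<notin> U}" by (rule rev_finite_subset) (use U subgroup.one_closed in auto)
  qed
  obtain h where h: "continuous_hom N TN H TH h" "\<forall>x\<in>S. h x = ?\<psi> x"
    using ex1_implies_ex[OF free_test[OF H conv]] by blast
  have hX: "h x = \<phi> x" if "x \<in> X" for x using h(2) X_subset that by auto
  note tF = pro_p_groupD(2)[OF F_pro_p]
  show "\<exists>!h. h \<in> extensional (carrier FN) \<and> continuous_hom FN TF H TH h \<and> (\<forall>x\<in>X. h x = \<phi> x)"
  proof (rule ex1I[of _ "restrict h F"])
    show "restrict h F \<in> extensional (carrier FN) \<and> continuous_hom FN TF H TH (restrict h F)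
        \<and> (\<forall>x\<in>X. restrict h F x = \<phi> x)"
      using continuous_hom_restrict[OF restrict_to_F[OF h(1)] tF] hX X_in_F by auto
    fix g assume g: "g \<in> extensional (carrier FN) \<and> continuous_hom FN TF H TH g \<and> (\<forall>x\<in>X. g x = \<phi> x)"
    show "g = restrict h F"
    proof (rule extensionalityI[of _ F])
      fix x assume x: "x \<in> F"
      have "g x = h x"
        by (rule hom_eq_on_F[OF D(3,6) _ restrict_to_F[OF h(1)] _ x]) (use g hX in auto)
      then show "g x = restrict h F x" using x by simp
    qed (use g in auto)
  qed
qed

end

section \<open>Split special extensions\<close>

text \<open>A continuous map from a compact space to a Hausdorff space is closed, so an injective
  one is an embedding. Continuity of maps into \<open>N\<close> can then be checked in
  \<open>G\<close>, where they are given by formulas.\<close>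

lemma continuous_map_lift_injective:
  assumes \<iota>: "continuous_map T U \<iota>" "inj_on \<iota> (topspace T)" and T: "compact_space T" and U: "Hausdorff_space U"
    and f: "f \<in> topspace Y \<rightarrow> topspace T" and c: "continuous_map Y U (\<lambda>y. \<iota> (f y))"
  shows "continuous_map Y T f"
  unfolding continuous_map_closedin
proof (intro conjI ballI allI impI)
  show "f \<in> topspace Y \<rightarrow> topspace T" by (rule f)
  fix C assume C: "closedin T C"
  have "closedin U (\<iota> ` C)"
    using T1_Spaces.continuous_imp_closed_map[OF \<iota>(1) T U] C by (simp add: closed_map_def)
  then have "closedin Y {y \<in> topspace Y. \<iota> (f y) \<in> \<iota> ` C}" by (rule closedin_continuous_map_preimage[OF c])
  moreover have "{y \<in> topspace Y. \<iota> (f y) \<in> \<iota> ` C} = {y \<in> topspace Y. f y \<in> C}"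
    using \<iota>(2) f closedin_subset[OF C] by (auto dest: inj_onD)
  ultimately show "closedin Y {y \<in> topspace Y. f y \<in> C}" by simp
qed

locale split_extension =
  fixes p :: nat and N :: "'n monoid" and TN and \<iota> :: "'n \<Rightarrow> 'g" and G :: "'g monoid" and TG
    and \<pi> :: "'g \<Rightarrow> 'q" and Q :: "'q monoid" and TQ and \<theta> :: "'q \<Rightarrow> 'g"
  assumes ext: "pro_p_extension p N TN \<iota> G TG \<pi> Q TQ"
    and \<theta>: "continuous_hom Q TQ G TG \<theta>" "\<And>q. q \<in> carrier Q \<Longrightarrow> \<pi> (\<theta> q) = q"
begin

lemma ext_pro_p: "pro_p_group p N TN" "pro_p_group p G TG" "pro_p_group p Q TQ"
  using ext by (auto simp: pro_p_extension_def)

lemmas Nd = pro_p_groupD[OF ext_pro_p(1)]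
lemmas Gd = pro_p_groupD[OF ext_pro_p(2)]
lemmas Qd = pro_p_groupD[OF ext_pro_p(3)]

sublocale N: group N by (rule Nd)
sublocale G: group G by (rule Gd)
sublocale Q: group Q by (rule Qd)

lemma cont: "continuous_map TN TG \<iota>" "continuous_map TG TQ \<pi>" "continuous_map TQ TG \<theta>"
  and homs: "\<iota> \<in> hom N G" "\<pi> \<in> hom G Q" "\<theta> \<in> hom Q G"
  and inj: "inj_on \<iota> (carrier N)"
  and image: "\<iota> ` carrier N = kernel G Q \<pi>"
  using ext \<theta> by (auto simp: pro_p_extension_def continuous_hom_def)

sublocale \<iota>: group_hom N G \<iota> by unfold_locales (rule homs)
sublocale \<pi>: group_hom G Q \<pi> by unfold_locales (rule homs)
sublocale \<theta>: group_hom Q G \<theta> by unfold_locales (rule homs)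

definition lift :: "'g \<Rightarrow> 'n" where "lift x = inv_into (carrier N) \<iota> x"

lemma lift:
  assumes "x \<in> carrier G" "\<pi> x = \<one>\<^bsub>Q\<^esub>"
  shows "lift x \<in> carrier N" "\<iota> (lift x) = x"
proof -
  have "x \<in> \<iota> ` carrier N" using assms unfolding image by (simp add: kernel_def)
  then show "lift x \<in> carrier N" "\<iota> (lift x) = x"
    unfolding lift_def by (auto simp: inv_into_into f_inv_into_f)
qed

lemma \<iota>_eqD: "m \<in> carrier N \<Longrightarrow> n \<in> carrier N \<Longrightarrow> \<iota> m = \<iota> n \<Longrightarrow> m = n"
  using inj by (auto dest: inj_onD)

lemma \<pi>_\<iota>: "n \<in> carrier N \<Longrightarrow> \<pi> (\<iota> n) = \<one>\<^bsub>Q\<^esub>"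
  using image by (auto simp: kernel_def)

lemma continuous_lift:
  assumes "f \<in> topspace Y \<rightarrow> carrier N" "continuous_map Y TG (\<lambda>y. \<iota> (f y))"
  shows "continuous_map Y TN f"
  using continuous_map_lift_injective[OF cont(1) _ Nd(5) Gd(6) _ assms(2)] inj assms(1) Nd(4) by simp

definition act :: "'q \<Rightarrow> 'n \<Rightarrow> 'n" where
  "act q n = lift (\<theta> q \<otimes>\<^bsub>G\<^esub> \<iota> n \<otimes>\<^bsub>G\<^esub> inv\<^bsub>G\<^esub> \<theta> q)"

lemma act:
  assumes "q \<in> carrier Q" "n \<in> carrier N"
  shows "act q n \<in> carrier N" "\<iota> (act q n) = \<theta> q \<otimes>\<^bsub>G\<^esub> \<iota> n \<otimes>\<^bsub>G\<^esub> inv\<^bsub>G\<^esub> \<theta> q"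
  unfolding act_def using assms \<theta>(2) by (auto intro!: lift simp: \<pi>_\<iota>)

text \<open>The \<open>N\<close>-component of \<open>g\<close> when \<open>G\<close> is written as
  the semidirect product of \<open>N\<close> and the image of \<open>\<theta>\<close>.\<close>

definition npart :: "'g \<Rightarrow> 'n" where
  "npart g = lift (g \<otimes>\<^bsub>G\<^esub> inv\<^bsub>G\<^esub> \<theta> (\<pi> g))"

lemma npart:
  assumes "g \<in> carrier G"
  shows "npart g \<in> carrier N" "\<iota> (npart g) = g \<otimes>\<^bsub>G\<^esub> inv\<^bsub>G\<^esub> \<theta> (\<pi> g)"
  unfolding npart_def using assms \<theta>(2) by (auto intro!: lift)

lemma decompose: "g \<in> carrier G \<Longrightarrow> \<iota> (npart g) \<otimes>\<^bsub>G\<^esub> \<theta> (\<pi> g) = g"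
  by (simp add: npart G.m_assoc)

lemma npart_mult:
  assumes "g \<in> carrier G" "h \<in> carrier G"
  shows "npart (g \<otimes>\<^bsub>G\<^esub> h) = npart g \<otimes>\<^bsub>N\<^esub> act (\<pi> g) (npart h)"
proof (rule \<iota>_eqD)
  have c: "x \<otimes>\<^bsub>G\<^esub> (inv\<^bsub>G\<^esub> x \<otimes>\<^bsub>G\<^esub> y) = y" "inv\<^bsub>G\<^esub> x \<otimes>\<^bsub>G\<^esub> (x \<otimes>\<^bsub>G\<^esub> y) = y" if "x \<in> carrier G" "y \<in> carrier G" for x y
    using that by (simp_all add: G.m_assoc[symmetric])
  show "\<iota> (npart (g \<otimes>\<^bsub>G\<^esub> h)) = \<iota> (npart g \<otimes>\<^bsub>N\<^esub> act (\<pi> g) (npart h))"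
    using assms by (simp add: npart act G.m_assoc G.inv_mult_group c)
qed (use assms npart act in auto)

lemma npart_\<iota>: "n \<in> carrier N \<Longrightarrow> npart (\<iota> n) = n"
  by (rule \<iota>_eqD) (simp_all add: npart \<pi>_\<iota>)

lemma npart_\<theta>: "q \<in> carrier Q \<Longrightarrow> npart (\<theta> q) = \<one>\<^bsub>N\<^esub>"
  by (rule \<iota>_eqD) (simp_all add: npart \<theta>(2))

lemma continuous_npart: "continuous_map TG TN npart"
proof (rule continuous_lift)
  show "npart \<in> topspace TG \<rightarrow> carrier N" using npart Gd(4) by auto
  have "continuous_map TG TG (\<lambda>g. \<theta> (\<pi> g))" using continuous_map_compose[OF cont(2,3)] by (simp add: comp_def)
  then have "continuous_map TG TG (\<lambda>g. g \<otimes>\<^bsub>G\<^esub> inv\<^bsub>G\<^esub> \<theta> (\<pi> g))"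
    by (intro continuous_map_group_mult[OF Gd(2)] continuous_map_group_inv[OF Gd(2)]) auto
  then show "continuous_map TG TG (\<lambda>g. \<iota> (npart g))"
    by (rule continuous_map_eq) (simp add: npart Gd(4))
qed

lemma act_hom: "q \<in> carrier Q \<Longrightarrow> act q \<in> hom N N"
proof (rule homI)
  fix m n assume q: "q \<in> carrier Q" and mn: "m \<in> carrier N" "n \<in> carrier N"
  have c: "inv\<^bsub>G\<^esub> x \<otimes>\<^bsub>G\<^esub> (x \<otimes>\<^bsub>G\<^esub> y) = y" if "x \<in> carrier G" "y \<in> carrier G" for x y
    using that by (simp add: G.m_assoc[symmetric])
  show "act q (m \<otimes>\<^bsub>N\<^esub> n) = act q m \<otimes>\<^bsub>N\<^esub> act q n"
    by (rule \<iota>_eqD) (use q mn in \<open>simp_all add: act G.m_assoc c\<close>)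
qed (use act in auto)

lemma act_mult:
  assumes "q \<in> carrier Q" "q' \<in> carrier Q" "n \<in> carrier N"
  shows "act (q \<otimes>\<^bsub>Q\<^esub> q') n = act q (act q' n)"
  by (rule \<iota>_eqD) (use assms in \<open>simp_all add: act G.m_assoc G.inv_mult_group\<close>)

lemma act_continuous:
  assumes q: "q \<in> carrier Q" shows "continuous_map TN TN (act q)"
proof (rule continuous_lift)
  show "act q \<in> topspace TN \<rightarrow> carrier N" using act q Nd(4) by auto
  have "continuous_map TN TG (\<lambda>n. \<theta> q \<otimes>\<^bsub>G\<^esub> \<iota> n \<otimes>\<^bsub>G\<^esub> inv\<^bsub>G\<^esub> \<theta> q)"
    by (intro continuous_map_group_mult[OF Gd(2)] cont(1)) (use q Gd(4) in simp_all)
  then show "continuous_map TN TG (\<lambda>n. \<iota> (act q n))"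
    by (rule continuous_map_eq) (simp add: act q Nd(4))
qed

text \<open>Under \<open>\<iota>\<close>, \<open>act w n\<close> times the inverse of
  \<open>n\<close> is a commutator of \<open>\<theta> w\<close>, so it lies in every normal subgroup
  containing \<open>\<theta> w\<close>, for all \<open>n\<close> at once. It remains to take such a
  subgroup open and disjoint from the closed image of the complement of \<open>U\<close>.\<close>

lemma act_small:
  assumes U: "openin TN U" "\<one>\<^bsub>N\<^esub> \<in> U"
  shows "\<exists>W\<in>open_normal_subgroups Q TQ. \<forall>w\<in>W. \<forall>n\<in>carrier N. act w n \<otimes>\<^bsub>N\<^esub> inv\<^bsub>N\<^esub> n \<in> U"
proof -
  let ?C = "\<iota> ` (carrier N - U)"
  have "closedin TN (carrier N - U)" using U(1) Nd(4) by (metis closedin_def closedin_diff closedin_topspace)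
  then have "closedin TG ?C"
    using T1_Spaces.continuous_imp_closed_map[OF cont(1) Nd(5) Gd(6)] by (simp add: closed_map_def)
  then have "openin TG (carrier G - ?C)" using Gd(4) by (metis closedin_def)
  moreover have "\<one>\<^bsub>G\<^esub> \<notin> ?C"
  proof
    assume "\<one>\<^bsub>G\<^esub> \<in> ?C"
    then obtain n where "n \<in> carrier N" "n \<notin> U" "\<iota> n = \<iota> \<one>\<^bsub>N\<^esub>" by auto
    then show False using \<iota>_eqD[of n "\<one>\<^bsub>N\<^esub>"] U(2) by simp
  qed
  ultimately obtain V where V: "V \<in> open_normal_subgroups G TG" "V \<subseteq> carrier G - ?C"
    using profinite_open_normal_base[OF Gd(1), of "carrier G - ?C"] by auto
  interpret V: normal V G using open_normal_subgroupD(1)[OF V(1)] .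
  let ?W = "{q \<in> carrier Q. \<theta> q \<in> V}"
  have "?W \<lhd> Q"
  proof (rule Q.normal_invI)
    show "subgroup ?W Q" by (rule Q.subgroupI) auto
    show "x \<otimes>\<^bsub>Q\<^esub> w \<otimes>\<^bsub>Q\<^esub> inv\<^bsub>Q\<^esub> x \<in> ?W" if "x \<in> carrier Q" "w \<in> ?W" for x w
      using that V.inv_op_closed2 by simp
  qed
  moreover have "openin TQ ?W"
    using openin_continuous_map_preimage[OF cont(3) open_normal_subgroupD(2)[OF V(1)]] Qd(4) by simp
  moreover have "act w n \<otimes>\<^bsub>N\<^esub> inv\<^bsub>N\<^esub> n \<in> U" if w: "w \<in> ?W" and n: "n \<in> carrier N" for w n
  proof -
    have "\<iota> n \<otimes>\<^bsub>G\<^esub> inv\<^bsub>G\<^esub> \<theta> w \<otimes>\<^bsub>G\<^esub> inv\<^bsub>G\<^esub> \<iota> n \<in> V"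
      using w n V.inv_op_closed2[of "\<iota> n" "inv\<^bsub>G\<^esub> \<theta> w"] by simp
    then have "\<theta> w \<otimes>\<^bsub>G\<^esub> (\<iota> n \<otimes>\<^bsub>G\<^esub> inv\<^bsub>G\<^esub> \<theta> w \<otimes>\<^bsub>G\<^esub> inv\<^bsub>G\<^esub> \<iota> n) \<in> V" using w by simp
    then have "\<iota> (act w n \<otimes>\<^bsub>N\<^esub> inv\<^bsub>N\<^esub> n) \<in> V" using w n by (simp add: act G.m_assoc)
    then have "\<iota> (act w n \<otimes>\<^bsub>N\<^esub> inv\<^bsub>N\<^esub> n) \<notin> ?C" using V(2) by blast
    then show ?thesis using w n act by blast
  qed
  ultimately show ?thesis unfolding open_normal_subgroups_def by blast
qed

definition glue :: "('h, 'k) monoid_scheme \<Rightarrow> ('n \<Rightarrow> 'h) \<Rightarrow> ('q \<Rightarrow> 'h) \<Rightarrow> 'g \<Rightarrow> 'h" where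
  "glue H f \<beta> g = f (npart g) \<otimes>\<^bsub>H\<^esub> \<beta> (\<pi> g)"

text \<open>Moving \<open>\<beta> (\<pi> g)\<close> past \<open>f (npart h)\<close> costs exactly
  the conjugation that equivariance supplies.\<close>

lemma glue_continuous_hom:
  assumes H: "topological_group H TH" and f: "continuous_hom N TN H TH f" and \<beta>: "continuous_hom Q TQ H TH \<beta>"
    and eqv: "\<And>q n. q \<in> carrier Q \<Longrightarrow> n \<in> carrier N \<Longrightarrow> f (act q n) = \<beta> q \<otimes>\<^bsub>H\<^esub> f n \<otimes>\<^bsub>H\<^esub> inv\<^bsub>H\<^esub> \<beta> q"
  shows "continuous_hom G TG H TH (glue H f \<beta>)"
proof -
  interpret H: group H using topological_groupD[OF H] by simp
  interpret f: group_hom N H f using f by unfold_locales (simp add: continuous_hom_def)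
  interpret \<beta>: group_hom Q H \<beta> using \<beta> by unfold_locales (simp add: continuous_hom_def)
  have "glue H f \<beta> \<in> hom G H"
  proof (rule homI)
    fix g h assume gh: "g \<in> carrier G" "h \<in> carrier G"
    have c: "inv\<^bsub>H\<^esub> x \<otimes>\<^bsub>H\<^esub> (x \<otimes>\<^bsub>H\<^esub> y) = y" if "x \<in> carrier H" "y \<in> carrier H" for x y
      using that by (simp add: H.m_assoc[symmetric])
    show "glue H f \<beta> (g \<otimes>\<^bsub>G\<^esub> h) = glue H f \<beta> g \<otimes>\<^bsub>H\<^esub> glue H f \<beta> h"
      unfolding glue_def using gh by (simp add: npart_mult npart act eqv H.m_assoc c)
  qed (simp add: glue_def npart)
  moreover have "continuous_map TG TH (glue H f \<beta>)"
    unfolding glue_def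
    by (rule continuous_map_group_mult[OF H])
      (use continuous_map_compose[OF continuous_npart, of TH f] continuous_map_compose[OF cont(2), of TH \<beta>] f \<beta>
        in \<open>simp_all add: continuous_hom_def comp_def\<close>)
  ultimately show ?thesis by (simp add: continuous_hom_def)
qed

text \<open>Conversely to gluing, a homomorphism on \<open>G\<close> restricts to an equivariant one
  on \<open>N\<close>; this serves the uniqueness half of the coproduct property.\<close>

lemma hom_restrict_equivariant:
  assumes H: "group H" and h: "h \<in> hom G H" and q: "q \<in> carrier Q" and n: "n \<in> carrier N"
  shows "h (\<iota> (act q n)) = h (\<theta> q) \<otimes>\<^bsub>H\<^esub> h (\<iota> n) \<otimes>\<^bsub>H\<^esub> inv\<^bsub>H\<^esub> h (\<theta> q)"
proof -
  interpret h: group_hom G H h using H h G.is_group by (simp add: group_hom_def group_hom_axioms_def)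
  show ?thesis using q n by (simp add: act)
qed

end

text \<open>Here the abstract action is identified with the conjugation action \<open>act\<close> of
  the split extension.\<close>

locale split_special_extension =
  split_extension p N TN \<iota> G TG \<pi> Q TQ \<theta> + equivariant_free_basis p Q TQ N TN act s S X
  for p and N :: "'n monoid" and TN and \<iota> :: "'n \<Rightarrow> 'g" and G :: "'g monoid" and TG
    and \<pi> :: "'g \<Rightarrow> 'q" and Q :: "'q monoid" and TQ \<theta> s S X
begin

lemma F_subset: "F \<subseteq> carrier N" using subgroup.subset[OF F_subgroup] .

text \<open>The maps \<open>\<alpha>\<close> and \<open>\<beta>\<close> determine an equivariant
  \<open>f\<close> on \<open>N\<close> with the values of \<open>\<alpha>\<close> on
  \<open>X\<close>. It agrees with \<open>\<alpha>\<close> on all of \<open>F\<close> by density,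
  and it glues with \<open>\<beta>\<close> to a map on \<open>G\<close>. Any competitor restricts to
  an equivariant map on \<open>N\<close> with the same values on \<open>X\<close>, hence to
  \<open>f\<close>, and the decomposition of \<open>G\<close> determines the rest.\<close>

lemma coproduct: "pro_p_coproduct p FN TF Q TQ G TG \<iota> \<theta>"
  unfolding pro_p_coproduct_def
proof (intro conjI allI impI F_pro_p ext_pro_p(2,3) \<theta>(1))
  have \<iota>c: "continuous_hom N TN G TG \<iota>" using homs(1) cont(1) by (simp add: continuous_hom_def)
  show "continuous_hom FN TF G TG \<iota>" by (rule restrict_to_F[OF \<iota>c])
  fix H :: "('n + 'q + 'g) test monoid" and TH \<alpha> \<beta>
  assume "pro_p_group p H TH \<and> continuous_hom FN TF H TH \<alpha> \<and> continuous_hom Q TQ H TH \<beta>"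
  then have H: "pro_p_group p H TH" and \<alpha>: "continuous_hom FN TF H TH \<alpha>" and \<beta>: "continuous_hom Q TQ H TH \<beta>"
    by auto
  note D = pro_p_groupD[OF H]
  interpret H: group H by (rule D(3))
  have \<beta>h: "\<beta> \<in> hom Q H" using \<beta> by (simp add: continuous_hom_def)
  have conv: "converges_to_one H TH X \<alpha>"
    using converges_to_one_hom[OF pro_p_groupD(2)[OF F_pro_p] D(3) \<alpha> X_converges_F] .
  obtain f where f: "continuous_hom N TN H TH f" "equivariant H \<beta> f" "\<And>x. x \<in> X \<Longrightarrow> f x = \<alpha> x"
    using equivariant_exists[OF H \<beta> conv] by blast
  have fF: "f x = \<alpha> x" if "x \<in> F" for x
    by (rule hom_eq_on_F[OF D(3,6) restrict_to_F[OF f(1)] \<alpha> f(3) that])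
  let ?h = "glue H f \<beta>"
  have h: "continuous_hom G TG H TH ?h"
    by (rule glue_continuous_hom[OF D(2) f(1) \<beta> equivariantD[OF f(2)]])
  have fc: "f n \<in> carrier H" if "n \<in> carrier N" for n using f(1) that by (auto simp: continuous_hom_def hom_def)
  have f1: "f \<one>\<^bsub>N\<^esub> = \<one>\<^bsub>H\<^esub>" using f(1) hom_one[OF _ N.is_group D(3)] by (simp add: continuous_hom_def)
  have \<beta>1: "\<beta> \<one>\<^bsub>Q\<^esub> = \<one>\<^bsub>H\<^esub>" using hom_one[OF \<beta>h Q.is_group D(3)] .
  have h\<iota>: "?h (\<iota> n) = f n" if "n \<in> carrier N" for n
    using that fc by (simp add: glue_def npart_\<iota> \<pi>_\<iota> \<beta>1)
  have h\<theta>: "?h (\<theta> q) = \<beta> q" if "q \<in> carrier Q" for q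
    using that hom_in_carrier[OF \<beta>h] by (simp add: glue_def npart_\<theta> \<theta>(2) f1)
  show "\<exists>!h. h \<in> extensional (carrier G) \<and> continuous_hom G TG H TH h \<and>
      (\<forall>x\<in>carrier FN. h (\<iota> x) = \<alpha> x) \<and> (\<forall>y\<in>carrier Q. h (\<theta> y) = \<beta> y)"
  proof (rule ex1I[of _ "restrict ?h (carrier G)"])
    have "x \<in> carrier N" if "x \<in> F" for x using that F_subset by blast
    then show "restrict ?h (carrier G) \<in> extensional (carrier G) \<and>
        continuous_hom G TG H TH (restrict ?h (carrier G)) \<and>
        (\<forall>x\<in>carrier FN. restrict ?h (carrier G) (\<iota> x) = \<alpha> x) \<and>
        (\<forall>y\<in>carrier Q. restrict ?h (carrier G) (\<theta> y) = \<beta> y)"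
      using continuous_hom_restrict[OF h Gd(2)] by (simp add: h\<iota> h\<theta> fF)
    fix k assume k: "k \<in> extensional (carrier G) \<and> continuous_hom G TG H TH k \<and>
      (\<forall>x\<in>carrier FN. k (\<iota> x) = \<alpha> x) \<and> (\<forall>y\<in>carrier Q. k (\<theta> y) = \<beta> y)"
    then have kc: "continuous_hom G TG H TH k" and kh: "k \<in> hom G H" by (auto simp: continuous_hom_def)
    have k\<theta>: "k (\<theta> q) = \<beta> q" if "q \<in> carrier Q" for q using k that by blast
    have k\<iota>: "k (\<iota> n) = f n" if n: "n \<in> carrier N" for n
    proof (rule equivariant_unique[OF H \<beta>h _ _ f(1,2) _ n])
      show "continuous_hom N TN H TH (\<lambda>n. k (\<iota> n))" by (rule continuous_hom_compose[OF \<iota>c kc])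
      show "equivariant H \<beta> (\<lambda>n. k (\<iota> n))"
        unfolding equivariant_def using hom_restrict_equivariant[OF D(3) kh] k\<theta> by simp
      show "k (\<iota> x) = f x" if "x \<in> X" for x using k f(3) X_in_F that by auto
    qed
    show "k = restrict ?h (carrier G)"
    proof (rule extensionalityI[of _ "carrier G"])
      fix g assume g: "g \<in> carrier G"
      have "k g = k (\<iota> (npart g) \<otimes>\<^bsub>G\<^esub> \<theta> (\<pi> g))" using decompose[OF g] by simp
      also have "\<dots> = f (npart g) \<otimes>\<^bsub>H\<^esub> \<beta> (\<pi> g)"
        using hom_mult[OF kh] k\<iota> k\<theta> npart(1)[OF g] g by simp
      finally show "k g = restrict ?h (carrier G) g" using g by (simp add: glue_def)
    qed (use k in auto)
  qed
qed

end

theorem theorem5p2: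
  fixes p :: nat
    and N :: "'n monoid" and TN :: "'n topology"
    and G :: "'g monoid" and TG :: "'g topology"
    and Q :: "'q monoid" and TQ :: "'q topology"
    and \<iota> :: "'n \<Rightarrow> 'g" and \<pi> :: "'g \<Rightarrow> 'q"
  assumes "prime p"
    and "special_extension p N TN \<iota> G TG \<pi> Q TQ"
    and "splits G TG \<pi> Q TQ"
  shows "\<exists>F. subgroup F N \<and> closedin TN F \<and>
           free_pro_p p (N\<lparr>carrier := F\<rparr>) (subtopology TN F) \<and>
           (\<exists>i j. pro_p_coproduct p (N\<lparr>carrier := F\<rparr>) (subtopology TN F) Q TQ G TG i j)"
proof -
  obtain \<theta> where \<theta>: "continuous_hom Q TQ G TG \<theta>" "\<And>q. q \<in> carrier Q \<Longrightarrow> \<pi> (\<theta> q) = q"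
    using assms(3) by (auto simp: splits_def)
  have ext: "pro_p_extension p N TN \<iota> G TG \<pi> Q TQ"
    using assms(2) by (simp add: special_extension_def)
  interpret E: split_extension p N TN \<iota> G TG \<pi> Q TQ \<theta> by unfold_locales (rule ext \<theta>; assumption?)+
  obtain S where S: "free_pro_p_on p N TN S"
    using assms(2) by (auto simp: special_extension_def free_pro_p_def)
  have "\<exists>s. (\<forall>g\<in>carrier G. \<forall>n\<in>carrier N. \<forall>n'\<in>carrier N.
             \<iota> n' = g \<otimes>\<^bsub>G\<^esub> \<iota> n \<otimes>\<^bsub>G\<^esub> inv\<^bsub>G\<^esub> g \<longrightarrow>
             s (group_like Q TQ (\<pi> g)) (frattini p N TN #>\<^bsub>N\<^esub> n) = frattini p N TN #>\<^bsub>N\<^esub> n') \<and>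
          projective_profinite_module
            (completed_group_algebra p Q TQ) (completed_group_algebra_topology p Q TQ)
            (module_of_group (ab_el p N TN) s) (ab_el_topology p N TN)"
    using assms(2) unfolding special_extension_def by blast
  then obtain s where s: "\<And>g n n'. g \<in> carrier G \<Longrightarrow> n \<in> carrier N \<Longrightarrow> n' \<in> carrier N \<Longrightarrow>
        \<iota> n' = g \<otimes>\<^bsub>G\<^esub> \<iota> n \<otimes>\<^bsub>G\<^esub> inv\<^bsub>G\<^esub> g \<Longrightarrow>
        s (group_like Q TQ (\<pi> g)) (frattini p N TN #>\<^bsub>N\<^esub> n) = frattini p N TN #>\<^bsub>N\<^esub> n'"
    and proj: "projective_profinite_module
      (completed_group_algebra p Q TQ) (completed_group_algebra_topology p Q TQ)
      (module_of_group (ab_el p N TN) s) (ab_el_topology p N TN)" by blast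
  \<comment> \<open>Since \<open>\<theta> q\<close> is a lift of \<open>q\<close>, the condition on
    \<open>s\<close> may be read for conjugation by \<open>\<theta> q\<close>.\<close>
  have s_act: "s (group_like Q TQ q) (frattini p N TN #>\<^bsub>N\<^esub> n) = frattini p N TN #>\<^bsub>N\<^esub> E.act q n"
    if "q \<in> carrier Q" "n \<in> carrier N" for q n
    using s[of "\<theta> q" n "E.act q n"] that \<theta>(2) E.act by simp
  interpret A: equivariant_free p Q TQ N TN E.act s S
  proof unfold_locales
    show "\<exists>W\<in>open_normal_subgroups Q TQ. \<forall>w\<in>W. \<forall>n\<in>carrier N. E.act w n \<otimes>\<^bsub>N\<^esub> inv\<^bsub>N\<^esub> n \<in> U"
      if "openin TN U" "\<one>\<^bsub>N\<^esub> \<in> U" for U using E.act_small[OF that] .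
  qed (use assms(1) E.ext_pro_p E.Nd proj s_act S E.act E.act_hom E.act_mult E.act_continuous in auto)
  obtain X where X: "X \<subseteq> S"
    "\<forall>e\<in>A.invariant_chars. (\<forall>x\<in>X. [e x = 0] (mod int p)) \<longrightarrow> (\<forall>n\<in>carrier N. [e n = 0] (mod int p))"
    "\<forall>f. finite {x \<in> X. \<not> [f x = 0] (mod int p)} \<longrightarrow> (\<exists>e\<in>A.invariant_chars. \<forall>x\<in>X. [e x = f x] (mod int p))"
    using A.dual_basis_subset by blast
  interpret B: split_special_extension p N TN \<iota> G TG \<pi> Q TQ \<theta> s S X
    by unfold_locales (use X in blast)+
  show ?thesis
    using B.F_subgroup B.F_closed B.F_free B.coproduct unfolding free_pro_p_def by blast
qed

end
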